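(* Let $\alpha,a,b>0$ and $\varepsilon>0$ be arbitrary real numbers. Let \[ F_{a,b}^{(\alpha)}(z)=\sum_{n=0}^\infty \frac{z^n}{\Gamma(an+b)^{\alpha}},\qquad z\in\mathbb{C}. \] Then, for $z\to\infty$ in the sector \[ |\arg(z)|\le \begin{cases} \tfrac12 a\alpha\pi-\varepsilon & \text{if } 0<a\alpha<2,\\ (2-\tfrac12 a\alpha)\pi-\varepsilon & \text{if } 2\le a\alpha<4,\\ 0 & \text{if } 4\le a\alpha, \end{cases} \] we have the asymptotics \[ F_{a,b}^{(\alpha)}(z)\sim \frac{1}{a\sqrt{\alpha}}\,(2\pi)^{\frac{1-\alpha}{2}}\, z^{\frac{\alpha-2b\alpha+1}{2a\alpha}}\, e^{\alpha z^{1/(a\alpha)}}. \]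
   Context: For $a,b,\alpha>0$ the power series defining $F_{a,b}^{(\alpha)}$ converges for all $z\in\mathbb{C}$ and defines an entire function. Here $\Gamma(an+b)^\alpha$ is the positive real power of the positive real number $\Gamma(an+b)$. Non-integer powers of $z$ are taken with respect to the principal argument: $z^{s}=\exp(s(\log|z|+i\arg z))$ with $\arg z\in(-\pi,\pi]$. The notation $f(z)\sim g(z)$ as $z\to\infty$ in a sector means that $f(z)/g(z)\to1$ as $|z|\to\infty$ with $z$ restricted to that sector. *)

theory Defs
  imports "HOL-Analysis.Analysis" "HOL-Library.Landau_Symbols"
begin

definition F :: "real \<Rightarrow> real \<Rightarrow> real \<Rightarrow> complex \<Rightarrow> complex" where
  "F a b \<alpha> z = (\<Sum>n. z ^ n / of_real (Gamma (a * real n + b) powr \<alpha>))"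

definition sector_bound :: "real \<Rightarrow> real \<Rightarrow> real \<Rightarrow> real" where
  "sector_bound a \<alpha> \<epsilon> =
     (if a * \<alpha> < 2 then 1 / 2 * a * \<alpha> * pi - \<epsilon>
      else if a * \<alpha> < 4 then (2 - 1 / 2 * a * \<alpha>) * pi - \<epsilon>
      else 0)"

(* The bound is negative when \<epsilon> is large; the sector is then empty. *)
definition sector :: "real \<Rightarrow> complex set" where
  "sector \<theta> = {z. \<bar>Arg z\<bar> \<le> \<theta>}"

definition at_infinity_in :: "complex set \<Rightarrow> complex filter" where
  "at_infinity_in S = inf at_infinity (principal S)"

end

theory Submission
  imports Defs "HOL-Complex_Analysis.Complex_Analysis" "HOL-Real_Asymp.Real_Asymp"
begin

text \<open>
  Put \<open>\<beta> = a\<alpha>\<close> and \<open>\<nu> = b - 1/2\<close>. The idea is to compare the series with the Mittag-Leffler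
  function \<open>E(z) = \<Sum>n. z\<^sup>n / \<Gamma>(\<beta>n + \<alpha>\<nu> + 1/2)\<close>, which is again an instance of \<open>F\<close>, with exponent \<open>1\<close>.

  Stirling's series is most symmetric when the argument is centred at one half: by Binet's formula
  (\<open>ln_Gamma_binet_half\<close>), \<open>ln \<Gamma>(s + 1/2) = s ln s - s + ln(2\<pi>)/2 - Q(s)\<close> for \<open>s > 0\<close>, where \<open>Q\<close> is
  the Laplace transform of a bounded function. For \<open>s = an + \<nu>\<close> the two arguments are \<open>an + b = s + 1/2\<close>
  and \<open>\<beta>n + \<alpha>\<nu> + 1/2 = \<alpha>s + 1/2\<close>, so the main parts of \<open>\<alpha> ln \<Gamma>(an + b)\<close> and of
  \<open>ln \<Gamma>(\<beta>n + \<alpha>\<nu> + 1/2)\<close> cancel up to a function that is affine in \<open>n\<close>, and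
  (\<open>inverse_Gamma_powr_eq\<close>)
  \<open>z\<^sup>n / \<Gamma>(an + b)\<^sup>\<alpha> = C\<^sub>0 * exp(\<lambda>(s)) * Z\<^sup>n / \<Gamma>(\<beta>n + \<alpha>\<nu> + 1/2)\<close>, where \<open>Z\<close> is a positive multiple
  of \<open>z\<close> and \<open>\<lambda>(s) = \<alpha>Q(s) - Q(\<alpha>s)\<close> is the Laplace transform of a bounded function \<open>\<kappa>\<close>.

  Multiplying the coefficients of a power series \<open>f\<close> by \<open>\<lambda>(an + \<nu>)\<close> amounts to applying the operator
  \<open>(T f)(z) = \<integral> \<kappa>(t) exp(-\<nu>t) f(z exp(-at)) dt\<close> over \<open>t > 0\<close>; therefore \<open>F(z) = C\<^sub>0 (exp(T) E)(Z)\<close>. The operator \<open>T\<close>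
  averages \<open>f\<close> over the segment from \<open>z\<close> to \<open>0\<close>. It respects rays, hence sectors, and it
  makes a function that grows exponentially along the ray smaller by a factor that tends to zero
  (\<open>exp_multiplier_perturbation\<close>). So \<open>F(z) - C\<^sub>0 E(Z)\<close> is negligible wherever \<open>E\<close> has
  its full exponential growth. This needs \<open>b\<close> to be large, which is achieved by omitting
  the first terms of the series; a polynomial does not matter against an exponential.

  It remains to treat \<open>E\<close>. Substituting Hankel's integral for the reciprocal Gamma function, written in the
  logarithmic variable \<open>v\<close> so that all contours become rectangles, and summing a geometric series
  expresses \<open>E(exp w)\<close> through the kernel \<open>exp(exp v + (1 - b) v) / (1 - exp(w - \<beta>v))\<close>. The
  residue at \<open>v = w/\<beta>\<close> is the asserted main term, and the rest of the contour integral stays bounded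
  (\<open>mittag_leffler_contour\<close>). For \<open>\<beta> < 1\<close> there is no other relevant pole; larger
  \<open>\<beta>\<close> are reduced to this case by averaging over roots of unity, which produces one exponential for each
  branch of \<open>z\<close> to the power \<open>1/\<beta>\<close>. For \<open>\<bar>arg z\<bar> \<le> \<Theta>\<close> with \<open>\<Theta> < \<pi>\<close> and \<open>\<Theta> < \<beta>\<pi>/2\<close> the principal branch
  grows and dominates the others (\<open>mittag_leffler_asymptotics\<close>), and each nonempty sector
  of the theorem satisfies these two inequalities.
\<close>

section \<open>Rectangle contours\<close>

lemma contour_integral_linepath_same_Im:
  assumes "L < R"
  shows "contour_integral (linepath (Complex L y) (Complex R y)) f
           = integral {L..R} (\<lambda>t. f (Complex t y))"
proof -
  have lp: "linepath (Complex L y) (Complex R y) = (+) (Complex 0 y) \<circ> linepath (of_real L) (of_real R)"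
    by (auto simp: linepath_def fun_eq_iff complex_eq_iff algebra_simps)
  have "contour_integral (linepath (Complex L y) (Complex R y)) f
      = integral {0..1} (\<lambda>x. f (linepath (Complex L y) (Complex R y) x) * of_real (R - L))"
  proof -
    have "Complex R y - Complex L y = of_real (R - L)" by (simp add: complex_eq_iff)
    then show ?thesis by (simp add: contour_integral_integral)
  qed
  also have "\<dots> = integral {0..1} (\<lambda>x. (f \<circ> (+) (Complex 0 y)) (linepath (of_real L) (of_real R) x) * of_real (R - L))"
    unfolding lp by simp
  also have "\<dots> = contour_integral (linepath (of_real L) (of_real R)) (f \<circ> (+) (Complex 0 y))"
    by (simp add: contour_integral_integral)
  also have "\<dots> = integral {L..R} (\<lambda>t. (f \<circ> (+) (Complex 0 y)) (of_real t))"
    using assms by (subst contour_integral_linepath_Reals_eq) auto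
  also have "\<dots> = integral {L..R} (\<lambda>t. f (Complex t y))"
    by (intro integral_cong) (simp add: Complex_eq add.commute)
  finally show ?thesis .
qed

text \<open>
  All contours below are rectangles, because Hankel's integral is taken in a logarithmic variable. This is
  the residue theorem for a rectangle with its four edges written as integrals over real intervals and the
  factor \<open>\<i>\<close> of the vertical edges divided out.
\<close>

lemma vertical_integral_shift:
  fixes f :: "complex \<Rightarrow> complex"
  assumes LR: "L < R" and psi: "0 < \<psi>"
    and S: "open S" "convex S" "cbox (Complex L (-\<psi>)) (Complex R \<psi>) \<subseteq> S"
    and pts: "finite pts" "pts \<subseteq> box (Complex L (-\<psi>)) (Complex R \<psi>)"
    and holo: "f holomorphic_on S - pts"
  shows "integral {-\<psi>..\<psi>} (\<lambda>y. f (Complex R y)) - integral {-\<psi>..\<psi>} (\<lambda>y. f (Complex L y))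
      = 2 * pi * (\<Sum>p\<in>pts. residue f p)
        - \<i> * (integral {L..R} (\<lambda>t. f (Complex t \<psi>)) - integral {L..R} (\<lambda>t. f (Complex t (-\<psi>))))"
proof -
  define a where "a = Complex L (-\<psi>)"
  define b where "b = Complex R \<psi>"
  have le: "Re a \<le> Re b" "Im a \<le> Im b" and lt: "Re a < Re b" "Im a < Im b"
    using LR psi by (auto simp: a_def b_def)
  have im: "path_image (rectpath a b) = cbox a b - box a b"
    by (rule path_image_rectpath_cbox_minus_box[OF le])
  have imS: "path_image (rectpath a b) \<subseteq> S - pts"
    using S(3) pts(2) unfolding im by (auto simp: a_def b_def)
  have pS: "pts \<subseteq> cbox a b"
    using pts(2) box_subset_cbox unfolding a_def b_def by blast
  have "contour_integral (rectpath a b) f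
      = 2 * pi * \<i> * (\<Sum>p\<in>pts. winding_number (rectpath a b) p * residue f p)"
  proof (rule Residue_theorem[OF S(1) _ pts(1) holo _ _ imS])
    show "connected S" using S(2) convex_connected by blast
    show "\<forall>z. z \<notin> S \<longrightarrow> winding_number (rectpath a b) z = 0"
    proof (intro allI impI)
      fix z assume "z \<notin> S"
      then have "z \<notin> cbox a b" using S(3) by (auto simp: a_def b_def)
      then show "winding_number (rectpath a b) z = 0"
        by (rule winding_number_rectpath_outside[OF le])
    qed
  qed auto
  also have "(\<Sum>p\<in>pts. winding_number (rectpath a b) p * residue f p) = (\<Sum>p\<in>pts. residue f p)"
  proof (rule sum.cong[OF refl])
    fix p assume "p \<in> pts"
    then have "p \<in> box a b" using pts(2) by (auto simp: a_def b_def)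
    then show "winding_number (rectpath a b) p * residue f p = residue f p"
      by (simp add: winding_number_rectpath)
  qed
  finally have res: "contour_integral (rectpath a b) f = 2 * pi * \<i> * (\<Sum>p\<in>pts. residue f p)" .
  have cont: "continuous_on (S - pts) f" by (rule holomorphic_on_imp_continuous_on[OF holo])
  have pi4: "path_image (rectpath a b)
        = closed_segment a (Complex R (-\<psi>)) \<union> closed_segment (Complex R (-\<psi>)) b
        \<union> closed_segment b (Complex L \<psi>) \<union> closed_segment (Complex L \<psi>) a"
    by (simp add: rectpath_def Let_def path_image_join a_def b_def Un_assoc)
  have ci: "f contour_integrable_on linepath u v"
    if "closed_segment u v \<subseteq> path_image (rectpath a b)" for u v
    by (rule contour_integrable_continuous_linepath)
      (rule continuous_on_subset[OF cont], use that imS in blast)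
  have i1: "f contour_integrable_on linepath a (Complex R (-\<psi>))"
    and i2: "f contour_integrable_on linepath (Complex R (-\<psi>)) b"
    and i3: "f contour_integrable_on linepath b (Complex L \<psi>)"
    and i4: "f contour_integrable_on linepath (Complex L \<psi>) a"
    by (rule ci, use pi4 in blast)+
  have "contour_integral (rectpath a b) f
      = contour_integral (linepath a (Complex R (-\<psi>))) f + (contour_integral (linepath (Complex R (-\<psi>)) b) f
        + (contour_integral (linepath b (Complex L \<psi>)) f + contour_integral (linepath (Complex L \<psi>) a) f))"
    unfolding rectpath_def Let_def using i1 i2 i3 i4
    by (simp add: a_def b_def contour_integrable_joinI valid_path_join)
  also have "contour_integral (linepath b (Complex L \<psi>)) f = - contour_integral (linepath (Complex L \<psi>) b) f"
    by (rule contour_integral_reverse_linepath)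
      (rule continuous_on_subset[OF cont], use pi4 imS in \<open>auto simp: closed_segment_commute\<close>)
  also have "contour_integral (linepath (Complex L \<psi>) a) f = - contour_integral (linepath a (Complex L \<psi>)) f"
    by (rule contour_integral_reverse_linepath)
      (rule continuous_on_subset[OF cont], use pi4 imS in \<open>auto simp: closed_segment_commute\<close>)
  also have "contour_integral (linepath a (Complex R (-\<psi>))) f = integral {L..R} (\<lambda>t. f (Complex t (-\<psi>)))"
    unfolding a_def by (rule contour_integral_linepath_same_Im[OF LR])
  also have "contour_integral (linepath (Complex L \<psi>) b) f = integral {L..R} (\<lambda>t. f (Complex t \<psi>))"
    unfolding b_def by (rule contour_integral_linepath_same_Im[OF LR])
  also have "contour_integral (linepath (Complex R (-\<psi>)) b) f = \<i> * integral {-\<psi>..\<psi>} (\<lambda>y. f (Complex R y))"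
    unfolding b_def by (rule contour_integral_linepath_same_Re) (use psi in auto)
  also have "contour_integral (linepath a (Complex L \<psi>)) f = \<i> * integral {-\<psi>..\<psi>} (\<lambda>y. f (Complex L y))"
    unfolding a_def by (rule contour_integral_linepath_same_Re) (use psi in auto)
  finally have eq: "2 * pi * \<i> * (\<Sum>p\<in>pts. residue f p)
     = integral {L..R} (\<lambda>t. f (Complex t (-\<psi>))) + (\<i> * integral {-\<psi>..\<psi>} (\<lambda>y. f (Complex R y))
       + (- integral {L..R} (\<lambda>t. f (Complex t \<psi>)) + - (\<i> * integral {-\<psi>..\<psi>} (\<lambda>y. f (Complex L y)))))"
    using res by simp
  have "\<i> * (- \<i> * X) = X" for X :: complex by simp
  then show ?thesis using arg_cong[OF eq, of "\<lambda>x. - \<i> * x"]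
    by (simp add: algebra_simps)
qed

lemma norm_integral_exp_decay:
  fixes f :: "real \<Rightarrow> complex"
  assumes "L \<le> R" "f integrable_on {L..R}" "\<And>t. t \<in> {L..R} \<Longrightarrow> norm (f t) \<le> M * exp (-t)" "0 \<le> M"
  shows "norm (integral {L..R} f) \<le> M * exp (-L)"
proof -
  have "((\<lambda>t. M * exp (-t)) has_integral (- M * exp (-R) - - M * exp (-L))) {L..R}"
    by (rule fundamental_theorem_of_calculus[OF assms(1)])
      (auto intro!: derivative_eq_intros simp: has_real_derivative_iff_has_vector_derivative[symmetric])
  then have "norm (integral {L..R} f) \<le> M * exp (-L) - M * exp (-R)"
    using integral_norm_bound_integral[OF assms(2) _ assms(3)]
    by (metis (no_types, lifting) diff_minus_eq_add add.commute has_integral_integrable integral_unique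
        minus_mult_left uminus_add_conv_diff)
  also have "\<dots> \<le> M * exp (-L)" using assms(4) by simp
  finally show ?thesis .
qed

text \<open>
  A bound for the horizontal edges that does not involve \<open>R\<close> is what allows the right edge to be moved to
  infinity.
\<close>

lemma vertical_integral_shift_bound:
  fixes f :: "complex \<Rightarrow> complex"
  assumes LR: "L < R" and psi: "0 < \<psi>"
    and S: "open S" "convex S" "cbox (Complex L (-\<psi>)) (Complex R \<psi>) \<subseteq> S"
    and pts: "finite pts" "pts \<subseteq> box (Complex L (-\<psi>)) (Complex R \<psi>)"
    and holo: "f holomorphic_on S - pts"
    and M: "0 \<le> M" "\<And>t y. t \<in> {L..R} \<Longrightarrow> \<bar>y\<bar> = \<psi> \<Longrightarrow> norm (f (Complex t y)) \<le> M * exp (-t)"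
  shows "norm (integral {-\<psi>..\<psi>} (\<lambda>y. f (Complex R y)) - integral {-\<psi>..\<psi>} (\<lambda>y. f (Complex L y))
      - 2 * pi * (\<Sum>p\<in>pts. residue f p)) \<le> 2 * M * exp (-L)"
proof -
  have cont: "continuous_on (S - pts) f" by (rule holomorphic_on_imp_continuous_on[OF holo])
  have edge: "norm (integral {L..R} (\<lambda>t. f (Complex t y))) \<le> M * exp (-L)" if "\<bar>y\<bar> = \<psi>" for y
  proof (rule norm_integral_exp_decay)
    show "(\<lambda>t. f (Complex t y)) integrable_on {L..R}"
    proof (rule integrable_continuous_interval, rule continuous_on_compose2[OF cont])
      show "continuous_on {L..R} (\<lambda>t. Complex t y)"
        unfolding Complex_eq by (intro continuous_intros)
      have "Complex t y \<in> cbox (Complex L (-\<psi>)) (Complex R \<psi>)" "Complex t y \<notin> box (Complex L (-\<psi>)) (Complex R \<psi>)"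
        if "t \<in> {L..R}" for t
        using that \<open>\<bar>y\<bar> = \<psi>\<close> by (auto simp: in_cbox_complex_iff in_box_complex_iff)
      then show "(\<lambda>t. Complex t y) ` {L..R} \<subseteq> S - pts" using S(3) pts(2) by blast
    qed
  qed (use LR M that in auto)
  have "integral {-\<psi>..\<psi>} (\<lambda>y. f (Complex R y)) - integral {-\<psi>..\<psi>} (\<lambda>y. f (Complex L y))
      - 2 * pi * (\<Sum>p\<in>pts. residue f p)
      = - \<i> * (integral {L..R} (\<lambda>t. f (Complex t \<psi>)) - integral {L..R} (\<lambda>t. f (Complex t (-\<psi>))))"
    using vertical_integral_shift[OF LR psi S pts holo] by simp
  also have "norm \<dots> = norm (integral {L..R} (\<lambda>t. f (Complex t \<psi>)) - integral {L..R} (\<lambda>t. f (Complex t (-\<psi>))))"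
    by (simp add: norm_mult)
  also have "\<dots> \<le> M * exp (-L) + M * exp (-L)"
    by (intro order.trans[OF norm_triangle_ineq4] add_mono edge) (use psi in auto)
  finally show ?thesis by simp
qed

section \<open>The reciprocal Gamma function as a limit of Hankel integrals\<close>

text \<open>
  In the variable \<open>u = exp v\<close> this is the integrand of Hankel's integral of \<open>exp u\<close> times \<open>u\<close> to the
  power \<open>-x\<close>, with \<open>p = 1 - x\<close>; the summand \<open>1\<close> in \<open>p\<close> comes from \<open>du = u dv\<close>.
\<close>

definition hankel_kernel :: "real \<Rightarrow> complex \<Rightarrow> complex" where
  "hankel_kernel p v = exp (exp v + of_real p * v)"

lemma norm_hankel_kernel: "norm (hankel_kernel p (Complex t y)) = exp (exp t * cos y + p * t)"
  by (simp add: hankel_kernel_def norm_exp_eq_Re Re_exp)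

lemma hankel_kernel_holomorphic [holomorphic_intros]: "hankel_kernel p holomorphic_on S"
  unfolding hankel_kernel_def by (intro holomorphic_intros)

lemma continuous_on_vertical [continuous_intros]:
  "continuous_on UNIV f \<Longrightarrow> continuous_on A (\<lambda>y. f (Complex R y))" for f :: "complex \<Rightarrow> complex"
  unfolding Complex_eq by (rule continuous_on_compose2[of UNIV f]) (auto intro!: continuous_intros)

lemma continuous_on_horizontal [continuous_intros]:
  "continuous_on UNIV f \<Longrightarrow> continuous_on A (\<lambda>t. f (Complex t y))" for f :: "complex \<Rightarrow> complex"
  unfolding Complex_eq by (rule continuous_on_compose2[of UNIV f]) (auto intro!: continuous_intros)

lemma continuous_on_hankel_kernel: "continuous_on A (hankel_kernel p)"
  by (rule holomorphic_on_imp_continuous_on[OF hankel_kernel_holomorphic])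

lemma hankel_vertical_integrable: "(\<lambda>y. hankel_kernel p (Complex R y)) integrable_on {a..b}"
  by (intro integrable_continuous_interval continuous_on_vertical continuous_on_hankel_kernel)

lemma gamma_integral_exp_substitution:
  fixes p :: real
  assumes p: "0 < p"
  shows "((\<lambda>t. exp (- exp t + p * t)) has_integral Gamma p) UNIV"
proof -
  let ?f = "\<lambda>s::real. s powr (p - 1) / exp s"
  have 1: "(?f has_integral Gamma p) {0<..}"
  proof -
    have "((\<lambda>t. if t \<in> {0<..} then ?f t else 0) has_integral Gamma p) {0..}"
      by (rule has_integral_spike[of "{0}", rotated 2, OF Gamma_integral_real[OF p]]) auto
    then show ?thesis by (subst (asm) has_integral_restrict) auto
  qed
  have 2: "?f absolutely_integrable_on {0<..}"
    by (rule nonnegative_absolutely_integrable_1) (use 1 in \<open>auto intro: has_integral_integrable\<close>)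
  have img: "range (exp :: real \<Rightarrow> real) = {0<..}"
    by (auto simp: image_iff) (metis exp_ln)
  have "(\<lambda>x. \<bar>exp x\<bar> * ?f (exp x)) absolutely_integrable_on UNIV \<and>
      integral UNIV (\<lambda>x. \<bar>exp x\<bar> * ?f (exp x)) = Gamma p"
    using 1 2 by (subst has_absolute_integral_change_of_variables_1'[where g = exp and g' = exp])
      (auto intro!: derivative_eq_intros simp: img integral_unique inj_on_def)
  then have "((\<lambda>x. \<bar>exp x\<bar> * ?f (exp x)) has_integral Gamma p) UNIV"
    by (auto simp: has_integral_iff absolutely_integrable_on_def)
  moreover have "\<bar>exp x\<bar> * ?f (exp x) = exp (- exp x + p * x)" for x :: real
    by (simp add: powr_def exp_add exp_minus exp_diff algebra_simps field_simps)
  ultimately show ?thesis by simp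
qed

text \<open>
  Moving the vertical segment far to the left leaves the integrals along \<open>Im v = \<plusminus>\<pi>\<close>, where \<open>exp v\<close> is
  negative. They combine to Euler's integral for \<open>\<Gamma>(p)\<close> times \<open>2 sin(\<pi>p)\<close>, and the reflection formula
  turns this into \<open>2\<pi>/\<Gamma>(1 - p)\<close>. For \<open>p = 0\<close> the two lines cancel, and the value \<open>2\<pi>\<close> comes from the
  left edge instead, on which the kernel tends to \<open>1\<close>.
\<close>

lemma hankel_integral_pi_tendsto_base:
  assumes p: "0 \<le> p" "p < 1"
  shows "((\<lambda>R. integral {-pi..pi} (\<lambda>y. hankel_kernel p (Complex R y))) \<longlongrightarrow> complex_of_real (2 * pi * rGamma (1 - p))) at_top"
proof -
  let ?h = "\<lambda>t y. hankel_kernel p (Complex t y)"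
  define J where "J = (\<lambda>R. integral {-pi..pi} (\<lambda>y. ?h R y))"
  define G where "G = (\<lambda>R. integral {-R..R} (\<lambda>t. exp (- exp t + p * t)))"
  have shift: "J R = J (-R) + of_real (2 * sin (pi * p) * G R)" if R: "R > 0" for R
  proof -
    have "J R - J (-R) = - \<i> * (integral {-R..R} (\<lambda>t. ?h t pi)
                      - integral {-R..R} (\<lambda>t. ?h t (-pi)))"
      unfolding J_def using R
      by (subst vertical_integral_shift[where S = UNIV and pts = "{}"])
        (auto intro!: hankel_kernel_holomorphic)
    also have "integral {-R..R} (\<lambda>t. ?h t pi)
                      - integral {-R..R} (\<lambda>t. ?h t (-pi))
       = integral {-R..R} (\<lambda>t. ?h t pi - ?h t (-pi))"
      by (intro integral_diff[symmetric] integrable_continuous_interval continuous_on_horizontal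
          continuous_on_hankel_kernel)
    also have "(\<lambda>t. ?h t pi - ?h t (-pi))
        = (\<lambda>t. (2 * \<i> * sin (pi * p)) * of_real (exp (- exp t + p * t)))"
    proof
      fix t
      have e: "exp (Complex t y) + of_real p * Complex t y = of_real (- exp t + p * t) + \<i> * of_real (p * y)"
        if "y = pi \<or> y = -pi" for y
        using that by (auto simp: complex_eq_iff Re_exp Im_exp)
      have "?h t pi - ?h t (-pi)
         = exp (of_real (- exp t + p * t)) * (exp (\<i> * of_real (p * pi)) - exp (- (\<i> * of_real (p * pi))))"
        unfolding hankel_kernel_def by (simp add: e exp_add[symmetric] right_diff_distrib del: of_real_add of_real_mult)
      also have "exp (\<i> * of_real (p * pi)) - exp (- (\<i> * of_real (p * pi))) = 2 * \<i> * sin (of_real (p * pi))"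
        by (simp add: sin_exp_eq)
      finally show "?h t pi - ?h t (-pi)
          = (2 * \<i> * sin (pi * p)) * of_real (exp (- exp t + p * t))"
        by (simp add: exp_of_real sin_of_real mult.commute del: of_real_add of_real_mult of_real_diff)
    qed
    also have "integral {-R..R} (\<lambda>t. (2 * \<i> * sin (pi * p)) * complex_of_real (exp (- exp t + p * t)))
      = (2 * \<i> * sin (pi * p)) * integral {-R..R} (\<lambda>t. complex_of_real (exp (- exp t + p * t)))"
      by (rule integral_mult_right)
    also have "integral {-R..R} (\<lambda>t. complex_of_real (exp (- exp t + p * t))) = of_real (G R)"
      unfolding G_def
      by (intro integral_unique has_integral_of_real integrable_integral integrable_continuous_interval
          continuous_intros)
    finally show ?thesis by (simp add: algebra_simps)
  qed
  have lim1: "((\<lambda>R. J (-R)) \<longlongrightarrow> (if p = 0 then 2 * pi else 0)) at_top"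
  proof -
    have "((\<lambda>R. J (-R) - (if p = 0 then 2 * pi else 0)) \<longlongrightarrow> 0) at_top"
    proof (cases "p = 0")
      case False
      have "\<forall>\<^sub>F R in at_top. norm (J (-R)) \<le> exp (exp (-R) + p * (-R)) * (pi - - pi)"
        unfolding J_def
        by (intro always_eventually allI integral_bound)
          (auto intro!: continuous_on_vertical continuous_on_hankel_kernel simp: norm_hankel_kernel)
      moreover have "((\<lambda>R. exp (exp (-R) + p * (-R)) * (pi - - pi)) \<longlongrightarrow> 0) at_top"
        using False p by real_asymp
      ultimately have "((\<lambda>R. J (-R)) \<longlongrightarrow> 0) at_top"
        by (rule Lim_null_comparison)
      then show ?thesis using False by simp
    next
      case True
      have "norm (J (-R) - 2 * pi) \<le> (3 * exp (-R)) * (pi - - pi)" if "R > 1" for R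
      proof -
        have "J (-R) - 2 * pi = integral {-pi..pi} (\<lambda>y. ?h (-R) y - 1)"
          unfolding J_def by (subst integral_diff)
            (auto intro!: hankel_vertical_integrable simp: scaleR_conv_of_real)
        also have "norm \<dots> \<le> (3 * exp (-R)) * (pi - - pi)"
        proof (rule integral_bound)
          fix y
          have n: "norm (exp (Complex (-R) y)) = exp (-R)" by (simp add: norm_exp_eq_Re)
          have "2 \<le> 1 + R" using that by simp
          also have "\<dots> \<le> exp R" by (rule exp_ge_add_one_self)
          finally have "exp (-R) \<le> 1 / 2" by (simp add: exp_minus field_simps)
          then have "norm (exp (exp (Complex (-R) y)) - 1) \<le> 3 / 2 * norm (exp (Complex (-R) y))"
            by (intro norm_exp_bounds) (simp add: n)
          also have "\<dots> \<le> 3 * norm (exp (Complex (-R) y))" by simp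
          finally have "norm (exp (exp (Complex (-R) y)) - 1) \<le> 3 * norm (exp (Complex (-R) y))" .
          then show "norm (?h (-R) y - 1) \<le> 3 * exp (-R)"
            by (simp add: hankel_kernel_def True n)
        qed (auto intro!: continuous_intros continuous_on_hankel_kernel)
        finally show ?thesis .
      qed
      then have "\<forall>\<^sub>F R in at_top. norm (J (-R) - 2 * pi) \<le> (3 * exp (-R)) * (pi - - pi)"
        by (rule eventually_mono[OF eventually_gt_at_top[of "1::real"]])
      moreover have "((\<lambda>R::real. (3 * exp (-R)) * (pi - - pi)) \<longlongrightarrow> 0) at_top" by real_asymp
      ultimately have "((\<lambda>R. J (-R) - 2 * pi) \<longlongrightarrow> 0) at_top"
        by (rule Lim_null_comparison)
      then show ?thesis using True by simp
    qed
    then show ?thesis by (rule LIM_zero_cancel)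
  qed
  show ?thesis
  proof (cases "p = 0")
    case True
    have "\<forall>\<^sub>F R in at_top. J (-R) = J R"
      using eventually_gt_at_top[of "0::real"] by eventually_elim (simp add: shift True)
    moreover have "((\<lambda>R. J (-R)) \<longlongrightarrow> complex_of_real (2 * pi)) at_top" using lim1 True by simp
    ultimately have "(J \<longlongrightarrow> complex_of_real (2 * pi)) at_top" by (rule Lim_transform_eventually[rotated])
    then show ?thesis using True unfolding J_def by simp
  next
    case False
    then have p0: "0 < p" using p by simp
    have G: "(G \<longlongrightarrow> Gamma p) at_top"
    proof (rule tendstoI)
      fix e :: real assume "e > 0"
      obtain B where B: "B > 0" "\<And>a b. ball 0 B \<subseteq> cbox a b \<Longrightarrow> norm (integral (cbox a b) (\<lambda>t. exp (- exp t + p * t)) - Gamma p) < e"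
        using gamma_integral_exp_substitution[OF p0] \<open>e > 0\<close> unfolding has_integral_alt' by auto
      have "dist (G R) (Gamma p) < e" if "R > B" for R
      proof -
        have "ball 0 B \<subseteq> cbox (-R) R" using that by (auto simp: dist_real_def)
        from B(2)[OF this] show ?thesis by (simp add: G_def dist_norm)
      qed
      then show "\<forall>\<^sub>F R in at_top. dist (G R) (Gamma p) < e"
        by (rule eventually_mono[OF eventually_gt_at_top[of B]])
    qed
    have "((\<lambda>R. J (-R) + of_real (2 * sin (pi * p) * G R)) \<longlongrightarrow> 0 + of_real (2 * sin (pi * p) * Gamma p)) at_top"
      using lim1 False by (intro tendsto_intros G) auto
    moreover have "\<forall>\<^sub>F R in at_top. J (-R) + of_real (2 * sin (pi * p) * G R) = J R"
      using eventually_gt_at_top[of "0::real"] by eventually_elim (simp add: shift)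
    ultimately have "(J \<longlongrightarrow> 0 + of_real (2 * sin (pi * p) * Gamma p)) at_top"
      by (rule Lim_transform_eventually)
    then have "(J \<longlongrightarrow> of_real (2 * sin (pi * p) * Gamma p)) at_top" by simp
    also have "complex_of_real (2 * sin (pi * p) * Gamma p) = complex_of_real (2 * pi * rGamma (1 - p))"
    proof -
      have "complex_of_real (rGamma p * rGamma (1 - p)) = of_real (sin (pi * p) / pi)"
        using rGamma_reflection_complex[of "of_real p"] rGamma_complex_of_real[of "1 - p"]
        by (simp add: rGamma_complex_of_real sin_of_real flip: of_real_mult)
      then have "rGamma p * rGamma (1 - p) = sin (pi * p) / pi" by (simp only: of_real_eq_iff)
      moreover have "Gamma p \<noteq> 0" using Gamma_real_pos[OF p0] by linarith
      moreover have "rGamma p = 1 / Gamma p" by (simp add: rGamma_inverse_Gamma divide_inverse)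
      ultimately have "rGamma (1 - p) = Gamma p * sin (pi * p) / pi" by (simp add: divide_simps mult.commute)
      then show ?thesis by simp
    qed
    finally show ?thesis unfolding J_def .
  qed
qed

text \<open>
  The recurrence \<open>rGamma x = x * rGamma (x + 1)\<close> appears as the integral of the derivative of
  \<open>exp (exp v - x * v)\<close> along the segment, whose boundary values vanish in the limit.
\<close>

lemma hankel_integral_step:
  assumes lim: "((\<lambda>R. integral {-pi..pi} (\<lambda>y. hankel_kernel (1 - x) (Complex R y))) \<longlongrightarrow> complex_of_real (2 * pi * rGamma x)) at_top"
    and x: "x \<noteq> 0"
  shows "((\<lambda>R. integral {-pi..pi} (\<lambda>y. hankel_kernel (- x) (Complex R y))) \<longlongrightarrow> complex_of_real (2 * pi * rGamma (x + 1))) at_top"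
proof -
  let ?k = "\<lambda>t y. hankel_kernel (1 - x) (Complex t y)"
  let ?h = "\<lambda>t y. hankel_kernel (-x) (Complex t y)"
  define J where "J = (\<lambda>p R. integral {-pi..pi} (\<lambda>y. hankel_kernel p (Complex R y)))"
  have bnd: "norm (J (1 - x) R - of_real x * J (-x) R) \<le> 2 * exp (- exp R - x * R)" for R
  proof -
    have D: "((\<lambda>y. - \<i> * ?h R y) has_vector_derivative
          (?k R y - of_real x * ?h R y)) (at y within {-pi..pi})" for y
    proof -
      have "((\<lambda>v. - \<i> * hankel_kernel (-x) v) has_field_derivative
          - \<i> * ((exp v - of_real x) * hankel_kernel (-x) v)) (at v)" for v
        unfolding hankel_kernel_def by (auto intro!: derivative_eq_intros simp: algebra_simps)
      moreover have "((\<lambda>y. Complex R y) has_vector_derivative \<i>) (at y within {-pi..pi})"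
        unfolding Complex_eq by (auto intro!: derivative_eq_intros)
      ultimately have "(((\<lambda>v. - \<i> * hankel_kernel (-x) v) \<circ> Complex R) has_vector_derivative
           \<i> * (- \<i> * ((exp (Complex R y) - of_real x) * ?h R y))) (at y within {-pi..pi})"
        by (intro field_vector_diff_chain_within) (auto intro: has_field_derivative_at_within)
      moreover have "\<i> * (- \<i> * ((exp (Complex R y) - of_real x) * ?h R y))
          = ?k R y - of_real x * ?h R y"
        by (simp add: hankel_kernel_def exp_add exp_diff exp_minus left_diff_distrib right_diff_distrib diff_divide_distrib)
      ultimately show ?thesis by (simp add: o_def)
    qed
    have "((\<lambda>y. ?k R y - of_real x * ?h R y) has_integral
       (- \<i> * ?h R pi - (- \<i> * ?h R (-pi)))) {-pi..pi}"
      by (rule fundamental_theorem_of_calculus[OF _ D]) auto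
    moreover have "((\<lambda>y. ?k R y - of_real x * ?h R y)
       has_integral (J (1 - x) R - of_real x * J (-x) R)) {-pi..pi}"
      unfolding J_def by (intro has_integral_diff has_integral_mult_right integrable_integral hankel_vertical_integrable)
    ultimately have "J (1 - x) R - of_real x * J (-x) R
       = - \<i> * ?h R pi - (- \<i> * ?h R (-pi))"
      by (rule has_integral_unique[rotated])
    also have "norm \<dots> \<le> norm (- \<i> * ?h R pi) + norm (- \<i> * ?h R (-pi))"
      by (rule norm_triangle_ineq4)
    also have "\<dots> = 2 * exp (- exp R - x * R)" by (simp add: norm_mult norm_hankel_kernel)
    finally show ?thesis .
  qed
  have "((\<lambda>R. 2 * exp (- exp R - x * R)) \<longlongrightarrow> 0) at_top" by real_asymp
  then have "((\<lambda>R. J (1 - x) R - of_real x * J (-x) R) \<longlongrightarrow> 0) at_top"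
    by (rule Lim_null_comparison[rotated]) (use bnd in auto)
  moreover have lim': "(J (1 - x) \<longlongrightarrow> complex_of_real (2 * pi * rGamma x)) at_top"
    using lim unfolding J_def .
  ultimately have "((\<lambda>R. (J (1 - x) R - (J (1 - x) R - of_real x * J (-x) R)) / of_real x)
      \<longlongrightarrow> (complex_of_real (2 * pi * rGamma x) - 0) / of_real x) at_top"
    by (intro tendsto_intros) (use x in auto)
  moreover have "(complex_of_real (2 * pi * rGamma x) - 0) / of_real x = complex_of_real (2 * pi * rGamma (x + 1))"
    using rGamma_plus1[of x, THEN arg_cong[of _ _ complex_of_real]] x by (simp add: field_simps)
  ultimately show ?thesis using x unfolding J_def by simp
qed

lemma hankel_integral_pi_tendsto:
  assumes "0 < x"
  shows "((\<lambda>R. integral {-pi..pi} (\<lambda>y. hankel_kernel (1 - x) (Complex R y))) \<longlongrightarrow> complex_of_real (2 * pi * rGamma x)) at_top"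
proof -
  have "((\<lambda>R. integral {-pi..pi} (\<lambda>y. hankel_kernel (1 - x) (Complex R y))) \<longlongrightarrow> complex_of_real (2 * pi * rGamma x)) at_top"
    if "real n < x" "x \<le> real n + 1" for n x
    using that
  proof (induction n arbitrary: x)
    case 0
    then show ?case using hankel_integral_pi_tendsto_base[of "1 - x"] by simp
  next
    case (Suc n)
    then show ?case using hankel_integral_step[OF Suc.IH, of "x - 1"] by simp
  qed
  from this[of "nat (\<lceil>x\<rceil> - 1)" x] show ?thesis
    using assms ceiling_correct[of x] by simp
qed

lemma cos_neg_second_quadrant:
  assumes "pi / 2 < \<psi>" "\<psi> \<le> pi" shows "cos \<psi> < 0"
proof -
  have "- (pi/2) < pi - \<psi>" "pi - \<psi> < pi/2" using assms by linarith+
  from cos_gt_zero_pi[OF this] show ?thesis by (simp add: cos_diff)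
qed

text \<open>
  Where \<open>cos y\<close> is negative the kernel is doubly exponentially small for large \<open>R\<close>, so the segment may end
  anywhere beyond the right angle. This freedom serves to keep the edges of later contours away from poles.
\<close>

lemma hankel_integral_tendsto:
  assumes x: "0 < x" and psi: "pi / 2 < \<psi>" "\<psi> \<le> pi"
  shows "((\<lambda>R. integral {-\<psi>..\<psi>} (\<lambda>y. hankel_kernel (1 - x) (Complex R y))) \<longlongrightarrow> complex_of_real (2 * pi * rGamma x)) at_top"
proof -
  define p where "p = 1 - x"
  let ?h = "\<lambda>t y. hankel_kernel p (Complex t y)"
  have neg: "cos \<psi> < 0" by (rule cos_neg_second_quadrant[OF psi])
  have int: "(\<lambda>y. ?h R y) integrable_on {a..b}" for R a b
    by (rule hankel_vertical_integrable)
  have piece: "norm (integral {a..b} (\<lambda>y. ?h R y)) \<le> exp (exp R * cos \<psi> + p * R) * pi"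
    if "a \<le> b" "b - a \<le> pi" "\<And>y. y \<in> {a..b} \<Longrightarrow> \<psi> \<le> \<bar>y\<bar> \<and> \<bar>y\<bar> \<le> pi" for a b R
  proof -
    have "norm (integral {a..b} (\<lambda>y. ?h R y)) \<le> exp (exp R * cos \<psi> + p * R) * (b - a)"
    proof (rule integral_bound[OF that(1)])
      show "continuous_on {a..b} (\<lambda>y. ?h R y)"
        by (intro continuous_on_vertical continuous_on_hankel_kernel)
      fix y assume "y \<in> {a..b}"
      then have "cos \<bar>y\<bar> \<le> cos \<psi>" using that(3)[of y] psi by (intro cos_monotone_0_pi_le) auto
      then show "norm (?h R y) \<le> exp (exp R * cos \<psi> + p * R)"
        by (simp add: norm_hankel_kernel)
    qed
    also have "\<dots> \<le> exp (exp R * cos \<psi> + p * R) * pi" using that by (intro mult_left_mono) auto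
    finally show ?thesis .
  qed
  have diff: "norm (integral {-pi..pi} (\<lambda>y. ?h R y)
       - integral {-\<psi>..\<psi>} (\<lambda>y. ?h R y)) \<le> 2 * pi * exp (exp R * cos \<psi> + p * R)" for R
  proof -
    have "integral {-pi..pi} (\<lambda>y. ?h R y)
       = integral {-pi..-\<psi>} (\<lambda>y. ?h R y) + integral {-\<psi>..\<psi>} (\<lambda>y. ?h R y)
         + integral {\<psi>..pi} (\<lambda>y. ?h R y)"
      using Henstock_Kurzweil_Integration.integral_combine[OF _ _ int, of "-pi" "-\<psi>" "\<psi>" R]
        Henstock_Kurzweil_Integration.integral_combine[OF _ _ int, of "-pi" "\<psi>" "pi" R] psi by simp
    then have "norm (integral {-pi..pi} (\<lambda>y. ?h R y)
       - integral {-\<psi>..\<psi>} (\<lambda>y. ?h R y))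
       \<le> norm (integral {-pi..-\<psi>} (\<lambda>y. ?h R y)) + norm (integral {\<psi>..pi} (\<lambda>y. ?h R y))"
      using norm_triangle_ineq by (simp add: algebra_simps)
    also have "\<dots> \<le> exp (exp R * cos \<psi> + p * R) * pi + exp (exp R * cos \<psi> + p * R) * pi"
      by (intro add_mono piece) (use psi in auto)
    finally show ?thesis by (simp add: algebra_simps)
  qed
  have "((\<lambda>R. 2 * pi * exp (exp R * cos \<psi> + p * R)) \<longlongrightarrow> 0) at_top"
    using neg by real_asymp
  then have "((\<lambda>R. integral {-pi..pi} (\<lambda>y. ?h R y)
       - integral {-\<psi>..\<psi>} (\<lambda>y. ?h R y)) \<longlongrightarrow> 0) at_top"
    by (rule Lim_null_comparison[rotated]) (use diff in auto)
  from tendsto_diff[OF hankel_integral_pi_tendsto[OF x, folded p_def] this]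
  show ?thesis by (simp add: p_def)
qed

section \<open>Absolute convergence of the series\<close>

text \<open>
  Euler's integral restricted to \<open>{m..m + 1}\<close>. As \<open>m\<close> is arbitrary, \<open>\<Gamma>\<close> outgrows every exponential.
\<close>

lemma Gamma_ge:
  fixes x m :: real
  assumes x: "1 \<le> x" and m: "0 < m"
  shows "m powr (x - 1) / exp (m + 1) \<le> Gamma x"
proof -
  let ?f = "\<lambda>t::real. t powr (x - 1) / exp t"
  have int: "(?f has_integral Gamma x) {0..}" using Gamma_integral_real x by simp
  have int': "?f integrable_on {m..m+1}"
    using m by (intro integrable_continuous_interval continuous_intros) auto
  have "m powr (x - 1) / exp (m + 1) * (m + 1 - m) \<le> integral {m..m+1} ?f"
  proof (rule has_integral_le[OF _ integrable_integral[OF int']])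
    show "((\<lambda>t. m powr (x - 1) / exp (m + 1)) has_integral m powr (x - 1) / exp (m + 1) * (m + 1 - m)) {m..m + 1}"
      using has_integral_const_real[of "m powr (x - 1) / exp (m + 1)" m "m + 1"] by simp
    show "m powr (x - 1) / exp (m + 1) \<le> ?f t" if "t \<in> {m..m+1}" for t
      using that x m by (intro frac_le powr_mono2) auto
  qed
  also have "\<dots> \<le> Gamma x"
    by (rule has_integral_subset_le[OF _ integrable_integral[OF int'] int]) (use m in auto)
  finally show ?thesis by simp
qed

lemma summable_F_norm:
  assumes a: "0 < a" and b: "0 < b" and \<alpha>: "0 < \<alpha>" and r: "0 \<le> r"
  shows "summable (\<lambda>n. r ^ n / Gamma (a * real n + b) powr \<alpha>)"
proof -
  define m where "m = (2 * (r + 1)) powr (1 / (a * \<alpha>))"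
  have m: "m > 0" "m powr (a * \<alpha>) = 2 * (r + 1)"
    using r a \<alpha> by (auto simp: m_def powr_powr)
  define C where "C = exp (\<alpha> * (m + 1)) * m powr (\<alpha> * (1 - b))"
  have "\<forall>\<^sub>F n in sequentially. norm (r ^ n / Gamma (a * real n + b) powr \<alpha>) \<le> C * (1/2) ^ n"
  proof -
    have "filterlim (\<lambda>n. a * real n + b) at_top sequentially" using a by real_asymp
    then have "\<forall>\<^sub>F n in sequentially. 1 \<le> a * real n + b" by (simp add: filterlim_at_top)
    then show ?thesis
    proof eventually_elim
      case (elim n)
      let ?x = "a * real n + b"
      have G: "m powr (?x - 1) / exp (m + 1) \<le> Gamma ?x" by (rule Gamma_ge[OF elim m(1)])
      have "(m powr (?x - 1) / exp (m + 1)) powr \<alpha> \<le> Gamma ?x powr \<alpha>"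
        using G \<alpha> by (intro powr_mono2) auto
      then have "r ^ n / Gamma ?x powr \<alpha> \<le> r ^ n / (m powr (?x - 1) / exp (m + 1)) powr \<alpha>"
      proof (rule divide_left_mono)
        have "0 < Gamma ?x" by (rule Gamma_real_pos) (use elim in simp)
        then show "0 < Gamma ?x powr \<alpha> * (m powr (?x - 1) / exp (m + 1)) powr \<alpha>"
          using m(1) by (intro mult_pos_pos) (simp_all only: powr_gt_zero, simp_all)
      qed (use r in auto)
      also have "(m powr (?x - 1) / exp (m + 1)) powr \<alpha> = (2 * (r + 1)) ^ n / C"
      proof -
        have "(m powr (?x - 1) / exp (m + 1)) powr \<alpha> = m powr (\<alpha> * (?x - 1)) / exp (\<alpha> * (m + 1))"
          by (simp add: powr_divide powr_powr mult.commute exp_powr_real)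
        also have "m powr (\<alpha> * (?x - 1)) = m powr (a * \<alpha> * real n) * m powr (- (\<alpha> * (1 - b)))"
          by (simp add: powr_add[symmetric] algebra_simps)
        also have "m powr (a * \<alpha> * real n) = (2 * (r + 1)) ^ n"
          using m r by (simp add: powr_powr[symmetric] powr_realpow)
        finally show ?thesis by (simp only: C_def powr_minus divide_inverse inverse_mult_distrib mult_ac)
      qed
      also have "r ^ n / ((2 * (r + 1)) ^ n / C) = C * (1/2) ^ n * (r / (r + 1)) ^ n"
        by (simp only: power_mult_distrib power_divide power_one) (simp add: divide_simps)
      also have "\<dots> \<le> C * (1/2) ^ n * 1"
        using r by (intro mult_left_mono power_le_one) (auto simp: C_def)
      finally show ?case using r by simp
    qed
  qed
  then show ?thesis
    by (rule summable_comparison_test_ev) (intro summable_mult summable_geometric, simp)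
qed

lemma F_sums:
  assumes "0 < a" "0 < b" "0 < \<alpha>"
  shows "(\<lambda>n. z ^ n / of_real (Gamma (a * real n + b) powr \<alpha>)) sums F a b \<alpha> z"
proof -
  have "summable (\<lambda>n. norm (z ^ n / of_real (Gamma (a * real n + b) powr \<alpha>)))"
    using summable_F_norm[OF assms, of "norm z"] by (simp add: norm_divide norm_power)
  then show ?thesis unfolding F_def by (rule summable_sums[OF summable_norm_cancel])
qed

lemma mittag_leffler_sums:
  assumes "0 < \<beta>" "0 < b"
  shows "(\<lambda>n. z ^ n * of_real (rGamma (\<beta> * real n + b))) sums F \<beta> b 1 z"
proof -
  have "z ^ n / of_real (Gamma (\<beta> * real n + b) powr 1) = z ^ n * of_real (rGamma (\<beta> * real n + b))" for n
  proof -
    have "0 < \<beta> * real n + b" using assms by (intro add_nonneg_pos) auto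
    then have "0 < Gamma (\<beta> * real n + b)" by (rule Gamma_real_pos)
    then show ?thesis by (simp add: rGamma_inverse_Gamma divide_inverse)
  qed
  then show ?thesis using F_sums[of \<beta> b 1 z] assms by simp
qed

section \<open>The Mittag-Leffler function as a contour integral\<close>

text \<open>
  On a horizontal line the argument of \<open>exp (w - \<beta> * v)\<close> is constant. If it stays away from the multiples
  of \<open>2\<pi>\<close>, the denominator of the kernel is bounded below, whatever the modulus \<open>r\<close> is.
\<close>

lemma norm_one_minus_polar_ge:
  assumes r: "0 \<le> r" and om: "0 < \<omega>" "\<omega> \<le> pi / 2" and phi: "\<omega> \<le> \<bar>\<phi>\<bar>" "\<bar>\<phi>\<bar> \<le> 2 * pi - \<omega>"
  shows "(1 - cos \<omega>) / 2 \<le> norm (1 - of_real r * cis \<phi>)"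
proof -
  have c: "cos \<phi> \<le> cos \<omega>"
  proof (cases "\<bar>\<phi>\<bar> \<le> pi")
    case True
    have "cos \<bar>\<phi>\<bar> \<le> cos \<omega>" by (rule cos_monotone_0_pi_le) (use om phi True in linarith)+
    then show ?thesis by (simp only: cos_abs_real)
  next
    case False
    have "cos (2 * pi - \<bar>\<phi>\<bar>) \<le> cos \<omega>" by (rule cos_monotone_0_pi_le) (use om phi False in linarith)+
    then show ?thesis by (simp add: cos_diff)
  qed
  have c1: "cos \<omega> \<le> 1" by simp
  have c0: "0 \<le> cos \<omega>" by (rule cos_ge_zero) (use om in linarith)+
  \<comment> \<open>completing the square in \<open>r\<close>\<close>
  have "((1 - cos \<omega>) / 2)\<^sup>2 \<le> (r - cos \<omega>)\<^sup>2 + (1 - cos \<omega>) * (3 + 5 * cos \<omega>) / 4 + ((1 - cos \<omega>) / 2)\<^sup>2"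
    using c0 c1 by simp
  also have "\<dots> = 1 - 2 * r * cos \<omega> + r\<^sup>2" by (simp add: power2_eq_square field_simps)
  also have "\<dots> \<le> 1 - 2 * r * cos \<phi> + r\<^sup>2" using c r by (simp add: mult_left_mono)
  also have "\<dots> = 1 - 2 * r * cos \<phi> + r\<^sup>2 * ((cos \<phi>)\<^sup>2 + (sin \<phi>)\<^sup>2)" by simp
  also have "\<dots> = (1 - r * cos \<phi>)\<^sup>2 + (r * sin \<phi>)\<^sup>2"
    by (simp only: power2_eq_square) algebra
  also have "\<dots> = (norm (1 - of_real r * cis \<phi>))\<^sup>2" by (simp add: cmod_power2)
  finally show ?thesis by (rule power2_le_imp_le) simp
qed

lemma double_exp_le_exp:
  fixes c q :: real
  assumes "c < 0"
  obtains K where "0 \<le> K" "\<And>t. 0 \<le> t \<Longrightarrow> exp (exp t * c + q * t) \<le> K * exp (-t)"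
proof -
  have "((\<lambda>t. exp (exp t * c + (q + 1) * t)) \<longlongrightarrow> 0) at_top" using assms by real_asymp
  then have "\<forall>\<^sub>F t in at_top. exp (exp t * c + (q + 1) * t) < 1" by (rule order_tendstoD) simp
  then obtain T where T: "\<And>t. t \<ge> T \<Longrightarrow> exp (exp t * c + (q + 1) * t) < 1"
    by (auto simp: eventually_at_top_linorder)
  show ?thesis
  proof (rule that[of "exp (\<bar>q + 1\<bar> * max T 0)"])
    fix t :: real assume t: "0 \<le> t"
    have "exp t * c + (q + 1) * t \<le> \<bar>q + 1\<bar> * max T 0"
    proof (cases "t \<ge> T")
      case True
      from T[OF this] have "exp t * c + (q + 1) * t < 0" by simp
      also have "0 \<le> \<bar>q + 1\<bar> * max T 0" by simp
      finally show ?thesis by simp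
    next
      case False
      have "exp t * c + (q + 1) * t \<le> 0 + \<bar>q + 1\<bar> * t"
        using assms t by (intro add_mono mult_right_mono) (auto simp: mult_nonneg_nonpos)
      also have "\<dots> \<le> \<bar>q + 1\<bar> * max T 0" using False by (simp add: mult_left_mono)
      finally show ?thesis .
    qed
    then have "exp (exp t * c + (q + 1) * t) \<le> exp (\<bar>q + 1\<bar> * max T 0)" by simp
    then have "exp (exp t * c + (q + 1) * t) * exp (-t) \<le> exp (\<bar>q + 1\<bar> * max T 0) * exp (-t)" by simp
    then show "exp (exp t * c + q * t) \<le> exp (\<bar>q + 1\<bar> * max T 0) * exp (-t)"
      by (simp add: exp_add[symmetric] algebra_simps)
  qed simp
qed

text \<open>
  Put \<open>q(v) = exp (w - \<beta> * v)\<close>. The sum of the first \<open>N\<close> terms of the series is the limit of the vertical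
  integrals of \<open>h * (1 - q ^ N)\<close>. The two parts are treated on different lines. The integral of
  \<open>h * q ^ N\<close> stays to the right of \<open>L = (Re w + 1) / \<beta>\<close>, where \<open>\<bar>q\<bar> \<le> 1/e\<close>, and is
  \<open>O(exp (- N))\<close>. The integral of \<open>h\<close> alone is moved to the imaginary axis, where \<open>\<bar>q\<bar> \<ge> e\<close>, and picks
  up the residues at \<open>pts\<close>. Letting first \<open>R\<close> and then \<open>N\<close> tend to infinity gives the
  claim without an interchange of series and integral. The bound depends on \<open>w\<close> only through \<open>\<delta>\<close>.
\<close>

lemma mittag_leffler_contour:
  fixes \<beta> b \<psi> \<delta> K \<rho> \<theta> :: real and S pts :: "complex set"
  defines "h \<equiv> \<lambda>v. hankel_kernel (1 - b) v / (1 - exp (Complex \<rho> \<theta> - of_real \<beta> * v))"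
  assumes \<beta>: "0 < \<beta>" and b: "0 < b" and psi: "pi / 2 < \<psi>" "\<psi> \<le> pi" and \<rho>: "1 \<le> \<rho>"
    and K: "0 \<le> K" "\<And>t. 0 \<le> t \<Longrightarrow> exp (exp t * cos \<psi> + (1 - b) * t) \<le> K * exp (-t)"
    and \<delta>: "0 < \<delta>" "\<And>t y. \<bar>y\<bar> = \<psi> \<Longrightarrow> \<delta> \<le> norm (1 - exp (Complex \<rho> \<theta> - of_real \<beta> * Complex t y))"
    and S: "open S" "convex S" "\<And>t y. \<bar>y\<bar> \<le> \<psi> \<Longrightarrow> Complex t y \<in> S"
    and pts: "finite pts" "\<And>p. p \<in> pts \<Longrightarrow> 0 < Re p \<and> \<bar>Im p\<bar> < \<psi>"
    and holo: "h holomorphic_on S - pts"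
  shows "norm (F \<beta> b 1 (exp (Complex \<rho> \<theta>)) - (\<Sum>p\<in>pts. residue h p)) \<le> exp 1 + K / (pi * \<delta>)"
proof -
  let ?hk = "\<lambda>n. hankel_kernel (1 - (\<beta> * real n + b))"
  define w where "w = Complex \<rho> \<theta>"
  define g where "g = hankel_kernel (1 - b)"
  define q where "q = (\<lambda>v. exp (w - of_real \<beta> * v))"
  define J where "J = (\<lambda>R (f :: complex \<Rightarrow> complex). integral {-\<psi>..\<psi>} (\<lambda>y. f (Complex R y)))"
  define Res where "Res = (\<Sum>p\<in>pts. residue h p)"
  define L where "L = (\<rho> + 1) / \<beta>"
  let ?q = "\<lambda>t y. norm (q (Complex t y))"
  let ?g = "\<lambda>t y. norm (g (Complex t y))"
  have psi0: "0 < \<psi>" using psi pi_gt_zero by linarith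
  have L: "0 < L" "\<beta> * L = \<rho> + 1" using \<beta> \<rho> by (auto simp: L_def)
  have h: "h v = g v / (1 - q v)" for v by (simp add: h_def g_def q_def w_def)
  have nq: "?q t y = exp (\<rho> - \<beta> * t)" for t y
    by (simp add: q_def w_def norm_exp_eq_Re)
  have ng: "?g t y = exp (exp t * cos y + (1 - b) * t)" for t y
    unfolding g_def by (rule norm_hankel_kernel)
  have contJ: "continuous_on {-\<psi>..\<psi>} (\<lambda>y. f (Complex R y))"
    if "f holomorphic_on A" "\<And>y. \<bar>y\<bar> \<le> \<psi> \<Longrightarrow> Complex R y \<in> A" for f A R
    by (rule continuous_on_compose2[OF holomorphic_on_imp_continuous_on[OF that(1)]])
      (use that(2) in \<open>auto intro!: continuous_intros simp: Complex_eq\<close>)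
  \<comment> \<open>the half-plane on which the geometric series converges; the kernel has no pole there\<close>
  define A where "A = {v::complex. Re v > \<rho> / \<beta>}"
  have A: "open A" "convex A"
    unfolding A_def by (auto intro: open_halfspace_Re_gt convex_halfspace_Re_gt)
  have LA: "Complex t y \<in> A" if "t \<ge> L" for t y
  proof -
    have "\<rho> / \<beta> < L" using \<beta> by (simp add: L_def divide_strict_right_mono)
    then show ?thesis using that by (simp add: A_def)
  qed
  have q_lt1: "norm (q v) < 1" if "v \<in> A" for v
  proof -
    have "\<rho> < \<beta> * Re v" using that \<beta> by (simp add: A_def field_simps)
    then show ?thesis using nq[of "Re v" "Im v"] by simp
  qed
  have holoq: "q holomorphic_on A" unfolding q_def by (intro holomorphic_intros)
  have "(\<lambda>v. g v / (1 - q v)) holomorphic_on A"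
    using q_lt1 unfolding g_def by (intro holomorphic_intros holoq) fastforce
  moreover have "h = (\<lambda>v. g v / (1 - q v))" using h by blast
  ultimately have holoA: "h holomorphic_on A" by simp
  have nqL: "?q t y \<le> exp (-1)" if "t \<ge> L" for t y
  proof -
    have "\<beta> * t \<ge> \<rho> + 1" using that \<beta> L by (metis mult_le_cancel_left_pos)
    then show ?thesis by (simp add: nq)
  qed
  have e2: "exp (-1) \<le> (1/2 :: real)"
  proof -
    have "(2::real) \<le> exp 1" using exp_ge_add_one_self[of 1] by simp
    then show ?thesis by (simp add: exp_minus field_simps)
  qed
  have denL: "1/2 \<le> norm (1 - q (Complex t y))" if "t \<ge> L" for t y
  proof -
    have "1 - 1/2 \<le> norm (1::complex) - ?q t y" using nqL[OF that, of y] e2 by simp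
    also have "\<dots> \<le> norm (1 - q (Complex t y))" by (rule norm_triangle_ineq2)
    finally show ?thesis by simp
  qed
  \<comment> \<open>the remainder of the geometric series\<close>
  define M where "M = 4 * K + 2 * \<psi> * (2 * exp (exp L + \<bar>1 - b\<bar> * L))"
  have rem: "norm (J R (\<lambda>v. h v * q v ^ N)) \<le> M * exp (-1) ^ N" if R: "R > L" for R N
  proof -
    let ?k = "\<lambda>v. h v * q v ^ N"
    have nk: "norm (?k (Complex t y)) \<le> 2 * ?g t y * exp (-1) ^ N" if "t \<ge> L" for t y
    proof -
      have "norm (?k (Complex t y)) = ?g t y / norm (1 - q (Complex t y)) * ?q t y ^ N"
        by (simp add: h norm_mult norm_divide norm_power)
      also have "\<dots> \<le> ?g t y / (1/2) * exp (-1) ^ N"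
        using denL[OF that, of y] by (intro mult_mono divide_left_mono power_mono nqL that mult_pos_pos) auto
      finally show ?thesis by simp
    qed
    have "norm (J R ?k - J L ?k - 2 * pi * (\<Sum>p\<in>{}. residue ?k p)) \<le> 2 * (2 * K * exp (-1) ^ N) * exp (-L)"
      unfolding J_def
    proof (rule vertical_integral_shift_bound[OF R psi0 A])
      show "cbox (Complex L (-\<psi>)) (Complex R \<psi>) \<subseteq> A"
      proof
        fix v assume "v \<in> cbox (Complex L (-\<psi>)) (Complex R \<psi>)"
        then have "Re v \<ge> L" by (simp add: in_cbox_complex_iff)
        from LA[OF this, of "Im v"] show "v \<in> A" by simp
      qed
      show "?k holomorphic_on A - {}" using holoA holoq by (auto intro!: holomorphic_intros)
      fix t y assume t: "t \<in> {L..R}" and y: "\<bar>y\<bar> = \<psi>"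
      have "cos y = cos \<psi>" using y by (metis cos_abs_real)
      have "norm (?k (Complex t y)) \<le> 2 * ?g t y * exp (-1) ^ N" using t by (intro nk) simp
      also have "\<dots> \<le> 2 * (K * exp (-t)) * exp (-1) ^ N"
        using K(2)[of t] t L by (intro mult_right_mono mult_left_mono) (auto simp: ng \<open>cos y = cos \<psi>\<close>)
      finally show "norm (?k (Complex t y)) \<le> 2 * K * exp (-1) ^ N * exp (-t)" by (simp add: mult_ac)
    qed (use K in auto)
    then have 1: "norm (J R ?k - J L ?k) \<le> 4 * K * exp (-1) ^ N * exp (-L)" by simp
    also have "\<dots> \<le> 4 * K * exp (-1) ^ N * 1" using K L by (intro mult_left_mono) auto
    finally have 1: "norm (J R ?k - J L ?k) \<le> 4 * K * exp (-1) ^ N" by simp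
    have 2: "norm (J L ?k) \<le> (2 * exp (exp L + \<bar>1 - b\<bar> * L)) * exp (-1) ^ N * (\<psi> - - \<psi>)"
      unfolding J_def
    proof (rule integral_bound)
      show "continuous_on {-\<psi>..\<psi>} (\<lambda>y. ?k (Complex L y))"
        by (rule contJ[of ?k A]) (use holoA holoq LA in \<open>auto intro!: holomorphic_intros\<close>)
      fix y
      have "norm (?k (Complex L y)) \<le> 2 * ?g L y * exp (-1) ^ N" by (rule nk) simp
      also have "\<dots> \<le> 2 * exp (exp L + \<bar>1 - b\<bar> * L) * exp (-1) ^ N"
      proof -
        have "exp L * cos y \<le> exp L * 1" by (intro mult_left_mono) auto
        moreover have "(1 - b) * L \<le> \<bar>1 - b\<bar> * L" using L by (intro mult_right_mono) auto
        ultimately have "exp L * cos y + (1 - b) * L \<le> exp L + \<bar>1 - b\<bar> * L" by linarith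
        then show ?thesis by (simp add: ng)
      qed
      finally show "norm (?k (Complex L y)) \<le> 2 * exp (exp L + \<bar>1 - b\<bar> * L) * exp (-1) ^ N" .
    qed (use psi0 in simp)
    have "norm (J R ?k) \<le> norm (J R ?k - J L ?k) + norm (J L ?k)"
      using norm_triangle_ineq[of "J R ?k - J L ?k" "J L ?k"] by simp
    also have "\<dots> \<le> M * exp (-1) ^ N" using 1 2 by (simp add: M_def algebra_simps)
    finally show ?thesis .
  qed
  \<comment> \<open>moving the full integral to the imaginary axis\<close>
  have "\<exists>R0\<ge>L. \<forall>p\<in>pts. Re p < R0"
  proof -
    have "\<forall>p\<in>pts. Re p < Max (insert L (Re ` pts)) + 1"
    proof
      fix p assume "p \<in> pts"
      then have "Re p \<le> Max (insert L (Re ` pts))" using pts(1) by (intro Max_ge) auto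
      then show "Re p < Max (insert L (Re ` pts)) + 1" by simp
    qed
    moreover have "L \<le> Max (insert L (Re ` pts))" using pts(1) by (intro Max_ge) auto
    ultimately show ?thesis by (intro exI[of _ "Max (insert L (Re ` pts)) + 1"]) auto
  qed
  then obtain R0 where R0: "R0 \<ge> L" "\<And>p. p \<in> pts \<Longrightarrow> Re p < R0" by blast
  have main: "norm (J R h - 2 * pi * Res) \<le> 2 * pi * exp 1 + 2 * K / \<delta>" if R: "R > R0" for R
  proof -
    have nh: "norm (h (Complex t y)) \<le> ?g t y / d"
      if "0 < d" "d \<le> norm (1 - q (Complex t y))" for t y d
      unfolding h norm_divide using that by (intro divide_left_mono mult_pos_pos) auto
    have "norm (J R h - J 0 h - 2 * pi * (\<Sum>p\<in>pts. residue h p)) \<le> 2 * (K / \<delta>) * exp (-0)"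
      unfolding J_def
    proof (rule vertical_integral_shift_bound[OF _ psi0 S(1,2)])
      show "0 < R" using R R0(1) L by linarith
      show "cbox (Complex 0 (-\<psi>)) (Complex R \<psi>) \<subseteq> S"
      proof
        fix v assume "v \<in> cbox (Complex 0 (-\<psi>)) (Complex R \<psi>)"
        then have "\<bar>Im v\<bar> \<le> \<psi>" by (auto simp: in_cbox_complex_iff)
        from S(3)[OF this, of "Re v"] show "v \<in> S" by simp
      qed
      show "pts \<subseteq> box (Complex 0 (-\<psi>)) (Complex R \<psi>)"
        using pts(2) R0(2) R by (force simp: in_box_complex_iff abs_less_iff)
      fix t y assume t: "t \<in> {0..R}" and y: "\<bar>y\<bar> = \<psi>"
      have "cos y = cos \<psi>" using y by (metis cos_abs_real)
      have "norm (h (Complex t y)) \<le> ?g t y / \<delta>"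
        by (rule nh) (use \<delta> y in \<open>auto simp: q_def w_def\<close>)
      also have "\<dots> \<le> K * exp (-t) / \<delta>"
        using K(2)[of t] t \<delta>(1) by (intro divide_right_mono) (auto simp: ng \<open>cos y = cos \<psi>\<close>)
      finally show "norm (h (Complex t y)) \<le> K / \<delta> * exp (-t)" by simp
    qed (use K \<delta> pts holo in auto)
    then have 1: "norm (J R h - J 0 h - 2 * pi * Res) \<le> 2 * K / \<delta>" by (simp add: Res_def)
    have 2: "norm (J 0 h) \<le> exp 1 * (\<psi> - - \<psi>)"
      unfolding J_def
    proof (rule integral_bound)
      show "continuous_on {-\<psi>..\<psi>} (\<lambda>y. h (Complex 0 y))"
        by (rule contJ[OF holo]) (use S(3) pts(2) in force)
      fix y
      have "2 \<le> exp \<rho>" using exp_ge_add_one_self[of \<rho>] \<rho> by linarith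
      then have "1 \<le> ?q 0 y - norm (1::complex)" by (simp add: nq)
      also have "\<dots> \<le> norm (1 - q (Complex 0 y))" using norm_triangle_ineq2[of "q (Complex 0 y)" 1] by (simp add: norm_minus_commute)
      finally have "norm (h (Complex 0 y)) \<le> ?g 0 y / 1" by (intro nh) auto
      also have "\<dots> \<le> exp 1" by (simp add: ng)
      finally show "norm (h (Complex 0 y)) \<le> exp 1" .
    qed (use psi0 in simp)
    also have "exp 1 * (\<psi> - - \<psi>) \<le> 2 * pi * exp 1" using psi by simp
    finally have 2: "norm (J 0 h) \<le> 2 * pi * exp 1" .
    have "norm (J R h - 2 * pi * Res) \<le> norm (J R h - J 0 h - 2 * pi * Res) + norm (J 0 h)"
      using norm_triangle_ineq[of "J R h - J 0 h - 2 * pi * Res" "J 0 h"] by (simp add: algebra_simps)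
    with 1 2 show ?thesis by simp
  qed
  define c where "c = (\<lambda>n. exp w ^ n * complex_of_real (rGamma (\<beta> * real n + b)))"
  have gq: "g v * q v ^ n = exp w ^ n * ?hk n v" for v n
    unfolding g_def q_def hankel_kernel_def
    by (simp add: exp_add[symmetric] exp_of_nat_mult[symmetric] algebra_simps)
  have part: "norm (2 * pi * (\<Sum>n<N. c n) - 2 * pi * Res) \<le> 2 * pi * exp 1 + 2 * K / \<delta> + M * exp (-1) ^ N" for N
  proof (rule tendsto_upperbound)
    show "((\<lambda>R. norm ((\<Sum>n<N. exp w ^ n * J R (?hk n)) - 2 * pi * Res))
        \<longlongrightarrow> norm (2 * pi * (\<Sum>n<N. c n) - 2 * pi * Res)) at_top"
    proof -
      have "((\<lambda>R. J R (?hk n)) \<longlongrightarrow> of_real (2 * pi * rGamma (\<beta> * real n + b))) at_top" for n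
        unfolding J_def by (rule hankel_integral_tendsto[OF _ psi]) (use \<beta> b in \<open>auto intro: add_nonneg_pos\<close>)
      then have "((\<lambda>R. \<Sum>n<N. exp w ^ n * J R (?hk n))
         \<longlongrightarrow> (\<Sum>n<N. exp w ^ n * of_real (2 * pi * rGamma (\<beta> * real n + b)))) at_top"
        by (intro tendsto_intros)
      moreover have "(\<Sum>n<N. exp w ^ n * of_real (2 * pi * rGamma (\<beta> * real n + b))) = 2 * pi * (\<Sum>n<N. c n)"
        by (simp add: c_def sum_distrib_left mult_ac)
      ultimately show ?thesis by (intro tendsto_intros) simp
    qed
    show "\<forall>\<^sub>F R in at_top. norm ((\<Sum>n<N. exp w ^ n * J R (?hk n)) - 2 * pi * Res)
       \<le> 2 * pi * exp 1 + 2 * K / \<delta> + M * exp (-1) ^ N"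
    proof (rule eventually_mono[OF eventually_gt_at_top[of R0]])
      fix R assume R: "R > R0"
      then have RL: "R > L" using R0 by linarith
      have "(\<Sum>n<N. exp w ^ n * J R (?hk n))
         = integral {-\<psi>..\<psi>} (\<lambda>y. \<Sum>n<N. exp w ^ n * ?hk n (Complex R y))"
        unfolding J_def
        by (subst integral_sum)
          (auto intro!: integrable_on_mult_right hankel_vertical_integrable)
      also have "\<dots> = integral {-\<psi>..\<psi>} (\<lambda>y. h (Complex R y) - h (Complex R y) * q (Complex R y) ^ N)"
      proof (rule integral_cong)
        fix y
        let ?v = "Complex R y"
        have "q ?v \<noteq> 1" using denL[of R y] RL by auto
        then have "(\<Sum>n<N. q ?v ^ n) = (1 - q ?v ^ N) / (1 - q ?v)"
          using sum_gp_strict[of "q ?v" N] by simp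
        then have "g ?v * (\<Sum>n<N. q ?v ^ n) = h ?v - h ?v * q ?v ^ N"
          by (simp add: h diff_divide_distrib right_diff_distrib)
        then show "(\<Sum>n<N. exp w ^ n * ?hk n ?v) = h ?v - h ?v * q ?v ^ N"
          by (simp add: sum_distrib_left gq)
      qed
      also have "\<dots> = J R h - J R (\<lambda>v. h v * q v ^ N)"
        unfolding J_def
        by (intro integral_diff integrable_continuous_interval contJ[of _ A])
          (use holoA holoq LA RL in \<open>auto intro!: holomorphic_intros\<close>)
      finally have eq: "(\<Sum>n<N. exp w ^ n * J R (?hk n)) = J R h - J R (\<lambda>v. h v * q v ^ N)" .
      have "norm (J R h - J R (\<lambda>v. h v * q v ^ N) - 2 * pi * Res)
         \<le> norm (J R h - 2 * pi * Res) + norm (J R (\<lambda>v. h v * q v ^ N))"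
        using norm_triangle_ineq4[of "J R h - 2 * pi * Res" "J R (\<lambda>v. h v * q v ^ N)"] by (simp add: algebra_simps)
      also have "\<dots> \<le> 2 * pi * exp 1 + 2 * K / \<delta> + M * exp (-1) ^ N"
        by (intro add_mono main[OF R] rem[OF RL])
      finally show "norm ((\<Sum>n<N. exp w ^ n * J R (?hk n)) - 2 * pi * Res)
       \<le> 2 * pi * exp 1 + 2 * K / \<delta> + M * exp (-1) ^ N" unfolding eq .
    qed
  qed simp
  have "norm (2 * pi * F \<beta> b 1 (exp w) - 2 * pi * Res) \<le> 2 * pi * exp 1 + 2 * K / \<delta> + M * 0"
  proof (rule LIMSEQ_le)
    show "(\<lambda>N. norm (2 * pi * (\<Sum>n<N. c n) - 2 * pi * Res)) \<longlonglongrightarrow> norm (2 * pi * F \<beta> b 1 (exp w) - 2 * pi * Res)"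
      using mittag_leffler_sums[OF \<beta> b, of "exp w"] unfolding sums_def c_def by (intro tendsto_intros)
    show "(\<lambda>N. 2 * pi * exp 1 + 2 * K / \<delta> + M * exp (-1) ^ N) \<longlonglongrightarrow> 2 * pi * exp 1 + 2 * K / \<delta> + M * 0"
      by (intro tendsto_intros LIMSEQ_power_zero) simp
  qed (use part in auto)
  also have "2 * pi * F \<beta> b 1 (exp w) - 2 * pi * Res = of_real (2 * pi) * (F \<beta> b 1 (exp w) - Res)"
    by (simp add: algebra_simps)
  also have "norm \<dots> = 2 * pi * norm (F \<beta> b 1 (exp w) - Res)" by (simp add: norm_mult)
  finally show ?thesis using \<delta>(1) unfolding Res_def w_def by (simp add: field_simps)
qed

text \<open>
  The residue at \<open>v\<close> of the kernel with denominator \<open>1 - exp (w - \<beta> * u)\<close>, where \<open>w = \<beta> * v\<close>. In terms of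
  \<open>z = exp w\<close> it is \<open>exp \<zeta> / \<beta>\<close> times \<open>\<zeta>\<close> to the power \<open>1 - b\<close>, for a branch \<open>\<zeta> = exp v\<close> of \<open>z\<close> to the
  power \<open>1/\<beta>\<close>.
\<close>

definition pole_term :: "real \<Rightarrow> real \<Rightarrow> complex \<Rightarrow> complex" where
  "pole_term \<beta> b v = hankel_kernel (1 - b) v / of_real \<beta>"

lemma residue_mittag_leffler_kernel:
  assumes "\<beta> \<noteq> 0"
  shows "residue (\<lambda>v. hankel_kernel p v / (1 - exp (w - of_real \<beta> * v))) (w / of_real \<beta>)
    = hankel_kernel p (w / of_real \<beta>) / of_real \<beta>"
proof (rule residue_simple_pole_deriv[of _ UNIV])
  show "(\<lambda>v. 1 - exp (w - of_real \<beta> * v)) holomorphic_on UNIV" by (intro holomorphic_intros)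
  show "((\<lambda>v. 1 - exp (w - of_real \<beta> * v)) has_field_derivative of_real \<beta>) (at (w / of_real \<beta>))"
    using assms by (auto intro!: derivative_eq_intros)
  show "hankel_kernel p (w / of_real \<beta>) \<noteq> 0" by (simp add: hankel_kernel_def)
qed (use assms in \<open>auto intro: hankel_kernel_holomorphic\<close>)

lemma convex_open_strip: "open {v::complex. \<bar>Im v\<bar> < c}" "convex {v::complex. \<bar>Im v\<bar> < c}"
proof -
  have "{v::complex. \<bar>Im v\<bar> < c} = {v. Im v > - c} \<inter> {v. Im v < c}" by auto
  then show "open {v::complex. \<bar>Im v\<bar> < c}" "convex {v::complex. \<bar>Im v\<bar> < c}"
    by (auto intro!: open_Int convex_Int open_halfspace_Im_gt open_halfspace_Im_lt
        convex_halfspace_Im_gt convex_halfspace_Im_lt)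
qed

lemma exp_strip_eq_1:
  assumes "exp (w - of_real \<beta> * v) = (1::complex)" "\<bar>Im w\<bar> + \<bar>\<beta> * Im v\<bar> < 2 * pi"
  shows "w = of_real \<beta> * v"
proof -
  obtain n :: int where n: "Re (w - of_real \<beta> * v) = 0" "Im (w - of_real \<beta> * v) = of_int (2 * n) * pi"
    using assms(1) unfolding exp_eq_1 by auto
  have "\<bar>Im (w - of_real \<beta> * v)\<bar> < 2 * pi" using assms(2) by simp
  then have "\<bar>of_int (2 * n) * pi\<bar> < 2 * pi" using n(2) by simp
  then have "\<bar>real_of_int n\<bar> < 1" by (simp add: abs_mult)
  then have "n = 0" by linarith
  with n show ?thesis by (simp add: complex_eq_iff)
qed

text \<open>
  The pole \<open>w / \<beta>\<close> must not come close to the edges \<open>Im v = \<plusminus>\<psi>\<close>. Of the two choices \<open>\<psi> = \<pi>\<close> and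
  \<open>\<psi> = 3\<pi>/4\<close> the first is good, with the pole inside, if \<open>\<bar>Im w\<bar> \<le> 7/8 * (\<beta> * pi)\<close>, and the second
  is good, with the pole outside, otherwise. As \<open>\<beta> < 1\<close>, the other poles \<open>(w + 2\<pi>\<i>n) / \<beta>\<close> do not lie in
  the contour.
\<close>

lemma mittag_leffler_estimate_small:
  assumes \<beta>: "0 < \<beta>" "\<beta> < 1" and b: "0 < b"
  obtains C where "\<And>w. 1 \<le> Re w \<Longrightarrow> \<bar>Im w\<bar> \<le> pi \<Longrightarrow>
     norm (F \<beta> b 1 (exp w) - (if \<bar>Im w\<bar> \<le> 7/8 * (\<beta> * pi) then pole_term \<beta> b (w / of_real \<beta>) else 0)) \<le> C"
proof -
  \<comment> \<open>distance of the argument of \<open>exp (w - \<beta> * v)\<close> from \<open>2\<pi>\<int>\<close> on the horizontal edges\<close>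
  define \<omega> where "\<omega> = \<beta> * pi / 8"
  have bp: "\<beta> * pi < pi" "0 < \<beta> * pi" using \<beta> by auto
  have om: "0 < \<omega>" "\<omega> \<le> pi / 2" using bp unfolding \<omega>_def by linarith+
  define \<delta> where "\<delta> = (1 - cos \<omega>) / 2"
  have \<delta>: "0 < \<delta>"
    using cos_monotone_0_pi[of 0 \<omega>] om by (simp add: \<delta>_def)
  have "cos (3 / 4 * pi) < 0"
    by (rule cos_neg_second_quadrant) (use pi_gt_zero in linarith)+
  then obtain K2 where K2: "0 \<le> K2" "\<And>t. 0 \<le> t \<Longrightarrow> exp (exp t * cos (3/4*pi) + (1 - b) * t) \<le> K2 * exp (-t)"
    using double_exp_le_exp[of "cos (3/4*pi)" "1 - b"] by metis
  obtain K1 where K1: "0 \<le> K1" "\<And>t. 0 \<le> t \<Longrightarrow> exp (exp t * cos pi + (1 - b) * t) \<le> K1 * exp (-t)"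
    using double_exp_le_exp[of "cos pi" "1 - b"] by (metis cos_pi neg_less_0_iff_less zero_less_one)
  have den: "\<delta> \<le> norm (1 - exp (Complex \<rho> \<theta> - of_real \<beta> * Complex t y))"
    if "\<omega> \<le> \<bar>\<theta> - \<beta> * y\<bar>" "\<bar>\<theta> - \<beta> * y\<bar> \<le> 2 * pi - \<omega>" for \<rho> \<theta> t y
  proof -
    have "exp (Complex \<rho> \<theta> - of_real \<beta> * Complex t y) = of_real (exp (\<rho> - \<beta> * t)) * cis (\<theta> - \<beta> * y)"
      by (simp add: exp_eq_polar)
    then show ?thesis using norm_one_minus_polar_ge[of "exp (\<rho> - \<beta> * t)" \<omega> "\<theta> - \<beta> * y"] om that
      by (simp add: \<delta>_def)
  qed
  show ?thesis
  proof (rule that[of "max (exp 1 + K1 / (pi * \<delta>)) (exp 1 + K2 / (pi * \<delta>))"])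
    fix w :: complex assume w: "1 \<le> Re w" "\<bar>Im w\<bar> \<le> pi"
    define \<rho> \<theta> where "\<rho> = Re w" and "\<theta> = Im w"
    have w': "w = Complex \<rho> \<theta>" by (simp add: \<rho>_def \<theta>_def)
    let ?h = "\<lambda>v. hankel_kernel (1 - b) v / (1 - exp (Complex \<rho> \<theta> - of_real \<beta> * v))"
    have hol: "?h holomorphic_on A" if "\<And>v. v \<in> A \<Longrightarrow> exp (w - of_real \<beta> * v) \<noteq> 1" for A
      using that unfolding w' by (intro holomorphic_intros) auto
    show "norm (F \<beta> b 1 (exp w) - (if \<bar>Im w\<bar> \<le> 7/8 * (\<beta> * pi) then pole_term \<beta> b (w / of_real \<beta>) else 0))
      \<le> max (exp 1 + K1 / (pi * \<delta>)) (exp 1 + K2 / (pi * \<delta>))"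
    proof (cases "\<bar>Im w\<bar> \<le> 7/8 * (\<beta> * pi)")
      case True
      have "norm (F \<beta> b 1 (exp (Complex \<rho> \<theta>)) - (\<Sum>p\<in>{w / of_real \<beta>}. residue ?h p)) \<le> exp 1 + K1 / (pi * \<delta>)"
      proof (rule mittag_leffler_contour[where \<psi> = pi and S = "{v. \<bar>Im v\<bar> < pi / \<beta>}"])
        show "\<delta> \<le> norm (1 - exp (Complex \<rho> \<theta> - of_real \<beta> * Complex t y))" if y: "\<bar>y\<bar> = pi" for t y
        proof (rule den)
          have "\<bar>\<beta> * y\<bar> = \<beta> * pi" using y \<beta> by (simp add: abs_mult)
          then show "\<omega> \<le> \<bar>\<theta> - \<beta> * y\<bar>" "\<bar>\<theta> - \<beta> * y\<bar> \<le> 2 * pi - \<omega>"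
            using True bp unfolding \<omega>_def \<theta>_def by linarith+
        qed
        show "Complex t y \<in> {v. \<bar>Im v\<bar> < pi / \<beta>}" if "\<bar>y\<bar> \<le> pi" for t y
        proof -
          have "pi < pi / \<beta>" using \<beta> by (simp add: field_simps)
          then show ?thesis using that by simp
        qed
        show "0 < Re p \<and> \<bar>Im p\<bar> < pi" if "p \<in> {w / of_real \<beta>}" for p
        proof -
          have "\<bar>Im w\<bar> < \<beta> * pi" using True bp by linarith
          then have "\<bar>Im w\<bar> / \<beta> < pi" using \<beta> by (simp add: field_simps)
          then show ?thesis using that w \<beta> by (simp add: Re_divide_of_real Im_divide_of_real abs_divide)
        qed
        show "?h holomorphic_on {v. \<bar>Im v\<bar> < pi / \<beta>} - {w / of_real \<beta>}"
        proof (rule hol, rule notI)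
          fix v assume v: "v \<in> {v. \<bar>Im v\<bar> < pi / \<beta>} - {w / of_real \<beta>}" and e: "exp (w - of_real \<beta> * v) = 1"
          have "\<bar>\<beta> * Im v\<bar> < pi" using v \<beta> by (simp add: abs_mult field_simps)
          then have "\<bar>Im w\<bar> + \<bar>\<beta> * Im v\<bar> < 2 * pi" using w True bp by linarith
          from exp_strip_eq_1[OF e this] have "v = w / of_real \<beta>" using \<beta> by simp
          with v show False by simp
        qed
      qed (use \<beta> b w K1 \<delta> convex_open_strip in \<open>auto simp: \<rho>_def\<close>)
      also have "(\<Sum>p\<in>{w / of_real \<beta>}. residue ?h p) = pole_term \<beta> b (w / of_real \<beta>)"
        using residue_mittag_leffler_kernel[of \<beta> "1 - b" w] \<beta> by (simp add: pole_term_def w')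
      finally have "norm (F \<beta> b 1 (exp w) - pole_term \<beta> b (w / of_real \<beta>)) \<le> exp 1 + K1 / (pi * \<delta>)"
        by (simp add: w')
      then show ?thesis using True by simp
    next
      case False
      have "norm (F \<beta> b 1 (exp (Complex \<rho> \<theta>)) - (\<Sum>p\<in>{}. residue ?h p)) \<le> exp 1 + K2 / (pi * \<delta>)"
      proof (rule mittag_leffler_contour[where \<psi> = "3/4 * pi" and S = "{v. \<bar>Im v\<bar> < 7/8 * pi}"])
        show "\<delta> \<le> norm (1 - exp (Complex \<rho> \<theta> - of_real \<beta> * Complex t y))" if y: "\<bar>y\<bar> = 3/4 * pi" for t y
        proof (rule den)
          have "\<bar>\<beta> * y\<bar> = 3/4 * (\<beta> * pi)" using y \<beta> by (simp add: abs_mult)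
          then show "\<omega> \<le> \<bar>\<theta> - \<beta> * y\<bar>" "\<bar>\<theta> - \<beta> * y\<bar> \<le> 2 * pi - \<omega>"
            using False w bp unfolding \<omega>_def \<theta>_def by linarith+
        qed
        show "open {v. \<bar>Im v\<bar> < 7/8 * pi}" "convex {v. \<bar>Im v\<bar> < 7/8 * pi}" by (rule convex_open_strip)+
        show "pi / 2 < 3/4 * pi" "3/4 * pi \<le> pi" using pi_gt_zero by linarith+
        show "Complex t y \<in> {v. \<bar>Im v\<bar> < 7/8 * pi}" if "\<bar>y\<bar> \<le> 3/4 * pi" for t y
          using that pi_gt_zero unfolding mem_Collect_eq complex.sel by linarith
        show "?h holomorphic_on {v. \<bar>Im v\<bar> < 7/8 * pi} - {}"
        proof (rule hol, rule notI)
          fix v assume v: "v \<in> {v. \<bar>Im v\<bar> < 7/8 * pi} - {}" and e: "exp (w - of_real \<beta> * v) = 1"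
          have v': "\<bar>\<beta> * Im v\<bar> < 7/8 * (\<beta> * pi)" using v \<beta> by (simp add: abs_mult)
          then have "\<bar>Im w\<bar> + \<bar>\<beta> * Im v\<bar> < 2 * pi" using w bp by linarith
          from exp_strip_eq_1[OF e this] have "Im w = \<beta> * Im v" by simp
          with v' False show False by simp
        qed
      qed (use \<beta> b w K2 \<delta> convex_open_strip in \<open>auto simp: \<rho>_def\<close>)
      then show ?thesis using False by (simp add: w')
    qed
  qed
qed

section \<open>Mittag-Leffler functions of arbitrary order\<close>

lemma sum_roots_of_unity:
  fixes m n j :: nat
  assumes m: "0 < m"
  shows "(\<Sum>k<m. exp (2 * of_real pi * \<i> * (of_nat k - of_nat j) * of_nat n / of_nat m))
      = (if m dvd n then of_nat m else (0::complex))"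
proof -
  define z where "z = exp (2 * of_real pi * \<i> * of_nat n / of_nat m :: complex)"
  define c where "c = exp (- (2 * of_real pi * \<i> * of_nat j * of_nat n / of_nat m) :: complex)"
  have pw: "exp (2 * of_real pi * \<i> * (of_nat k - of_nat j) * of_nat n / of_nat m) = c * z ^ k" for k
    unfolding z_def c_def exp_of_nat_mult[symmetric] exp_add[symmetric]
    using m by (intro arg_cong[of _ _ exp]) (simp add: field_simps)
  have zm: "z ^ m = 1"
    unfolding z_def exp_of_nat_mult[symmetric] using m
    by (simp add: exp_eq_1) (metis of_int_of_nat_eq mult.commute mult.left_commute)
  have z1: "z = 1 \<longleftrightarrow> m dvd n"
  proof -
    have "z = 1 \<longleftrightarrow> (\<exists>i::int. 2 * pi * real n / real m = of_int (2 * i) * pi)"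
      unfolding z_def exp_eq_1 by simp
    also have "\<dots> \<longleftrightarrow> (\<exists>i::int. real n = of_int i * real m)"
      using m by (simp add: field_simps)
    also have "\<dots> \<longleftrightarrow> (\<exists>i::int. int n = i * int m)"
      by (metis of_int_eq_iff of_int_mult of_int_of_nat_eq)
    also have "\<dots> \<longleftrightarrow> int m dvd int n" by (auto simp: dvd_def mult.commute)
    finally show ?thesis by (simp only: int_dvd_int_iff)
  qed
  show ?thesis
  proof (cases "m dvd n")
    case True
    then have "z = 1" using z1 by simp
    moreover have "c = 1"
    proof -
      from True obtain l where l: "n = m * l" by blast
      have "2 * of_real pi * \<i> * of_nat j * of_nat n / of_nat m = 2 * of_real pi * \<i> * of_int (int (j * l))"
        using m by (simp add: l)
      then show ?thesis unfolding c_def exp_minus by (simp add: exp_eq_1) (metis of_nat_mult of_int_of_nat_eq)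
    qed
    ultimately show ?thesis using True by (simp add: pw)
  next
    case False
    then have "(\<Sum>k<m. z ^ k) = 0" using z1 zm by (simp add: sum_gp_strict)
    then show ?thesis using False by (simp add: pw sum_distrib_left[symmetric])
  qed
qed

text \<open>
  Averaging over the \<open>m\<close>-th roots of unity keeps every \<open>m\<close>-th term of the series with parameter \<open>a / m\<close>. The
  offset \<open>j\<close> only renumbers the roots: for \<open>m = 2 * j + 1\<close> and \<open>\<bar>Im w\<bar> \<le> pi\<close> it makes the
  imaginary parts of all the logarithms on the right lie between \<open>-\<pi>\<close> and \<open>\<pi>\<close>.
\<close>

lemma F_multisection:
  fixes m j :: nat
  assumes pos: "0 < a" "0 < b" "0 < \<alpha>" and m: "0 < m"
  shows "F a b \<alpha> (exp w) = (\<Sum>k<m. F (a / m) b \<alpha> (exp ((w + 2 * of_real pi * \<i> * (of_nat k - of_nat j)) / of_nat m))) / of_nat m"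
proof -
  define W where "W = (\<lambda>k. (w + 2 * of_real pi * \<i> * (of_nat k - of_nat j)) / of_nat m)"
  define c where "c = (\<lambda>n. complex_of_real (Gamma (a / real m * real n + b) powr \<alpha>))"
  have am: "0 < a / real m" using pos m by simp
  have s: "(\<lambda>n. exp (W k) ^ n / c n) sums F (a / m) b \<alpha> (exp (W k))" for k
    unfolding c_def by (rule F_sums[OF am pos(2,3)])
  have "(\<lambda>n. \<Sum>k<m. exp (W k) ^ n / c n) sums (\<Sum>k<m. F (a / m) b \<alpha> (exp (W k)))"
    by (intro sums_sum s)
  also have "(\<lambda>n. \<Sum>k<m. exp (W k) ^ n / c n) = (\<lambda>n. if m dvd n then of_nat m * exp (of_nat n * w / of_nat m) / c n else 0)"
  proof
    fix n
    have "exp (W k) ^ n = exp (of_nat n * w / of_nat m) * exp (2 * of_real pi * \<i> * (of_nat k - of_nat j) * of_nat n / of_nat m)" for k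
      unfolding exp_of_nat_mult[symmetric] exp_add[symmetric] W_def
      using m by (intro arg_cong[of _ _ exp]) (simp add: field_simps)
    then have "(\<Sum>k<m. exp (W k) ^ n / c n) = exp (of_nat n * w / of_nat m) / c n
        * (\<Sum>k<m. exp (2 * of_real pi * \<i> * (of_nat k - of_nat j) * of_nat n / of_nat m))"
      by (simp add: sum_distrib_left)
    then show "(\<Sum>k<m. exp (W k) ^ n / c n) = (if m dvd n then of_nat m * exp (of_nat n * w / of_nat m) / c n else 0)"
      unfolding sum_roots_of_unity[OF m] by simp
  qed
  finally have 1: "(\<lambda>n. if m dvd n then of_nat m * exp (of_nat n * w / of_nat m) / c n else 0) sums
     (\<Sum>k<m. F (a / m) b \<alpha> (exp (W k)))" .
  have "(\<lambda>l. of_nat m * exp w ^ l / of_real (Gamma (a * real l + b) powr \<alpha>)) sums (\<Sum>k<m. F (a / m) b \<alpha> (exp (W k)))"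
  proof -
    have "strict_mono ((*) m)" using m by (auto simp: strict_mono_def)
    from sums_mono_reindex[OF this, THEN iffD2, OF _ 1]
    have "(\<lambda>l. if m dvd m * l then of_nat m * exp (of_nat (m * l) * w / of_nat m) / c (m * l) else 0)
       sums (\<Sum>k<m. F (a / m) b \<alpha> (exp (W k)))"
      by (auto simp: image_iff dvd_def)
    then show ?thesis using m by (simp add: c_def exp_of_nat_mult)
  qed
  moreover have "(\<lambda>l. of_nat m * exp w ^ l / of_real (Gamma (a * real l + b) powr \<alpha>)) sums (of_nat m * F a b \<alpha> (exp w))"
    using sums_mult[OF F_sums[OF pos, of "exp w"], of "of_nat m"] by simp
  ultimately have "(\<Sum>k<m. F (a / m) b \<alpha> (exp (W k))) = of_nat m * F a b \<alpha> (exp w)"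
    by (rule sums_unique2)
  then show ?thesis using m unfolding W_def by simp
qed

text \<open>
  Each root of unity contributes, up to a bounded error, the exponential of one branch of \<open>z\<close> to the power
  \<open>1/\<beta>\<close>, or nothing.
\<close>

lemma mittag_leffler_estimate:
  assumes \<beta>: "0 < \<beta>" and b: "0 < b"
  obtains C j where "\<And>w. real (2 * j + 1) \<le> Re w \<Longrightarrow> \<bar>Im w\<bar> \<le> pi \<Longrightarrow>
     norm (F \<beta> b 1 (exp w) - (\<Sum>k<2 * j + 1. let v = (w + 2 * of_real pi * \<i> * (of_nat k - of_nat j)) / of_real \<beta> in
             if \<bar>Im v\<bar> \<le> 7/8 * pi then pole_term \<beta> b v else 0)) \<le> C"
proof -
  \<comment> \<open>an odd number of sections makes the branches symmetric about the principal one\<close>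
  define j where "j = nat \<lceil>\<beta>\<rceil>"
  define m where "m = 2 * j + 1"
  have "\<beta> \<le> real j" unfolding j_def by linarith
  then have m: "0 < m" "\<beta> < real m" unfolding m_def by auto
  define \<beta>' where "\<beta>' = \<beta> / real m"
  have \<beta>': "0 < \<beta>'" "\<beta>' < 1" using m \<beta> by (auto simp: \<beta>'_def)
  obtain C where C: "\<And>w. 1 \<le> Re w \<Longrightarrow> \<bar>Im w\<bar> \<le> pi \<Longrightarrow>
     norm (F \<beta>' b 1 (exp w) - (if \<bar>Im w\<bar> \<le> 7/8 * (\<beta>' * pi) then pole_term \<beta>' b (w / of_real \<beta>') else 0)) \<le> C"
    using mittag_leffler_estimate_small[OF \<beta>' b] by blast
  show ?thesis
  proof (rule that[of j C], fold m_def)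
    fix w :: complex assume w: "real m \<le> Re w" "\<bar>Im w\<bar> \<le> pi"
  let ?r = "\<lambda>k. (w + 2 * of_real pi * \<i> * (of_nat k - of_nat j))"
    define V where "V = (\<lambda>k. ?r k / of_real \<beta>)"
    define W where "W = (\<lambda>k. ?r k / of_nat m)"
    define T where "T = (\<lambda>k. if \<bar>Im (V k)\<bar> \<le> 7/8 * pi then pole_term \<beta> b (V k) else 0)"
  let ?F = "\<lambda>k. F \<beta>' b 1 (exp (W k))"
    have WV: "W k / of_real \<beta>' = V k" for k using m \<beta> by (simp add: W_def V_def \<beta>'_def)
    have ImWV: "\<bar>Im (W k)\<bar> = \<beta>' * \<bar>Im (V k)\<bar>" for k
    proof -
      have "W k = of_real \<beta>' * V k" using WV[of k] \<beta>' by (metis nonzero_mult_div_cancel_left of_real_eq_0_iff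
            order_less_irrefl times_divide_eq_right)
      then show ?thesis using \<beta>' by (simp add: abs_mult)
    qed
    have est: "norm (?F k - of_nat m * T k) \<le> C" if k: "k < m" for k
    proof -
      have "1 \<le> Re (W k)" using w m by (simp add: W_def field_simps)
      moreover have "\<bar>Im (W k)\<bar> \<le> pi"
      proof -
        have "\<bar>real k - real j\<bar> \<le> real j" using k unfolding m_def by (simp add: abs_le_iff)
        then have "\<bar>2 * pi * (real k - real j)\<bar> \<le> 2 * pi * real j" by (simp add: abs_mult)
        then have "\<bar>Im w + 2 * pi * (real k - real j)\<bar> \<le> pi + 2 * pi * real j"
          using w(2) abs_triangle_ineq[of "Im w" "2 * pi * (real k - real j)"] by linarith
        also have "\<dots> = pi * real m" by (simp add: m_def algebra_simps)
        finally show ?thesis using m by (simp add: W_def field_simps)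
      qed
      ultimately have "norm (?F k - (if \<bar>Im (W k)\<bar> \<le> 7/8 * (\<beta>' * pi) then pole_term \<beta>' b (V k) else 0)) \<le> C"
        using C[of "W k"] by (simp only: WV)
      moreover have "(if \<bar>Im (W k)\<bar> \<le> 7/8 * (\<beta>' * pi) then pole_term \<beta>' b (V k) else 0) = of_nat m * T k"
      proof -
        have "\<bar>Im (W k)\<bar> \<le> 7/8 * (\<beta>' * pi) \<longleftrightarrow> \<beta>' * \<bar>Im (V k)\<bar> \<le> \<beta>' * (7/8 * pi)"
          unfolding ImWV by (simp add: mult_ac)
        also have "\<dots> \<longleftrightarrow> \<bar>Im (V k)\<bar> \<le> 7/8 * pi" using \<beta>' by simp
        finally have "\<bar>Im (W k)\<bar> \<le> 7/8 * (\<beta>' * pi) \<longleftrightarrow> \<bar>Im (V k)\<bar> \<le> 7/8 * pi" .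
        then show ?thesis using m by (simp add: T_def pole_term_def \<beta>'_def)
      qed
      ultimately show ?thesis by simp
    qed
    have "F \<beta> b 1 (exp w) - (\<Sum>k<m. T k) = (\<Sum>k<m. ?F k - of_nat m * T k) / of_nat m"
      using F_multisection[OF \<beta> b _ m(1), of 1 w j] m
      by (simp add: W_def \<beta>'_def sum_subtractf sum_distrib_left[symmetric] diff_divide_distrib)
    also have "norm \<dots> \<le> (\<Sum>k<m. norm (?F k - of_nat m * T k)) / m"
      by (simp add: norm_divide divide_right_mono sum_norm_le)
    also have "\<dots> \<le> (\<Sum>k<m. C) / m" by (intro divide_right_mono sum_mono est) auto
    also have "\<dots> = C" using m by simp
    finally show "norm (F \<beta> b 1 (exp w) - (\<Sum>k<m. let v = ?r k / of_real \<beta> in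
             if \<bar>Im v\<bar> \<le> 7/8 * pi then pole_term \<beta> b v else 0)) \<le> C"
      unfolding T_def V_def Let_def .
  qed
qed

lemma norm_pole_term:
  "0 < \<beta> \<Longrightarrow> norm (pole_term \<beta> b v) = exp ((1 - b) * Re v + exp (Re v) * cos (Im v)) / \<beta>"
  using norm_hankel_kernel[of "1 - b" "Re v" "Im v"] by (simp add: pole_term_def norm_divide add.commute)

text \<open>
  All branches \<open>v\<close> have the same real part \<open>s\<close>, so the moduli of their terms differ only by the factors
  \<open>exp (exp s * cos (Im v))\<close>. On the principal branch \<open>\<bar>Im v\<bar> \<le> \<Theta> / \<beta> < \<pi>/2\<close>; on every other branch
  \<open>\<bar>Im v\<bar> \<ge> (2\<pi> - \<Theta>) / \<beta>\<close>, which is larger because \<open>\<Theta> < \<pi>\<close>.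
\<close>

lemma mittag_leffler_asymptotics:
  assumes \<beta>: "0 < \<beta>" and b: "0 < b" and \<Theta>: "0 \<le> \<Theta>" "\<Theta> < pi" "\<Theta> < \<beta> * pi / 2" and e: "0 < e"
  obtains \<rho>0 where "\<And>w. \<rho>0 \<le> Re w \<Longrightarrow> \<bar>Im w\<bar> \<le> \<Theta> \<Longrightarrow>
     norm (F \<beta> b 1 (exp w) - pole_term \<beta> b (w / of_real \<beta>)) \<le> e * norm (pole_term \<beta> b (w / of_real \<beta>))"
proof -
  obtain C j where C: "\<And>w. real (2 * j + 1) \<le> Re w \<Longrightarrow> \<bar>Im w\<bar> \<le> pi \<Longrightarrow>
     norm (F \<beta> b 1 (exp w) - (\<Sum>k<2 * j + 1. let v = (w + 2 * of_real pi * \<i> * (of_nat k - of_nat j)) / of_real \<beta> in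
             if \<bar>Im v\<bar> \<le> 7/8 * pi then pole_term \<beta> b v else 0)) \<le> C"
    using mittag_leffler_estimate[OF \<beta> b] by blast
  define m where "m = 2 * j + 1"
  define c1 where "c1 = \<Theta> / \<beta>"
  \<comment> \<open>lower bound for \<open>\<bar>Im v\<bar>\<close> on the other branches; those beyond \<open>7\<pi>/8\<close> contribute nothing\<close>
  define c2 where "c2 = min ((2 * pi - \<Theta>) / \<beta>) (7/8 * pi)"
  have c1: "0 \<le> c1" "c1 < pi / 2" using \<Theta> \<beta> by (auto simp: c1_def field_simps)
  have "c1 < (2 * pi - \<Theta>) / \<beta>" using \<Theta> \<beta> by (simp add: c1_def divide_strict_right_mono)
  then have c2: "c1 < c2" "c2 \<le> 7/8 * pi" using c1 pi_gt_zero unfolding c2_def by linarith+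
  have cos1: "0 < cos c1" by (rule cos_gt_zero_pi) (use c1 pi_gt_zero in linarith)+
  have cos2: "cos c2 < cos c1" by (rule cos_monotone_0_pi) (use c1 c2 pi_gt_zero in linarith)+
  define err where "err = (\<lambda>s. \<bar>C\<bar> * \<beta> * exp ((b - 1) * s - exp s * cos c1) + m * exp (exp s * (cos c2 - cos c1)))"
  have "(err \<longlongrightarrow> 0) at_top"
  proof -
    have "((\<lambda>s. exp ((b - 1) * s - exp s * cos c1)) \<longlongrightarrow> 0) at_top" using cos1 by real_asymp
    moreover have "((\<lambda>s. exp (exp s * (cos c2 - cos c1))) \<longlongrightarrow> 0) at_top" using cos2 by real_asymp
    ultimately have "(err \<longlongrightarrow> \<bar>C\<bar> * \<beta> * 0 + real m * 0) at_top"
      unfolding err_def by (intro tendsto_add tendsto_mult tendsto_const)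
    then show ?thesis by simp
  qed
  then have "\<forall>\<^sub>F s in at_top. err s < e" using e by (rule order_tendstoD)
  then obtain s0 where s0: "\<And>s. s0 \<le> s \<Longrightarrow> err s < e" by (auto simp: eventually_at_top_linorder)
  show ?thesis
  proof (rule that[of "max (real m) (\<beta> * s0)"])
    fix w assume w: "max (real m) (\<beta> * s0) \<le> Re w" "\<bar>Im w\<bar> \<le> \<Theta>"
    define s where "s = Re w / \<beta>"
  let ?m = "exp ((1 - b) * s + exp s * cos c1)"
  let ?o = "exp ((1 - b) * s + exp s * cos c2)"
    define V where "V = (\<lambda>k. (w + 2 * of_real pi * \<i> * (of_nat k - of_nat j)) / of_real \<beta>)"
    define T where "T = (\<lambda>k. if \<bar>Im (V k)\<bar> \<le> 7/8 * pi then pole_term \<beta> b (V k) else 0)"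
    have ReV: "Re (V k) = s" for k by (simp add: V_def s_def Re_divide_of_real)
    have ImV: "Im (V k) = (Im w + 2 * pi * (real k - real j)) / \<beta>" for k by (simp add: V_def Im_divide_of_real)
    have Vj: "V j = w / of_real \<beta>" by (simp add: V_def)
    have tau: "\<bar>Im (V j)\<bar> \<le> c1" using w(2) \<beta> by (simp add: ImV c1_def divide_right_mono)
    have Tj: "T j = pole_term \<beta> b (w / of_real \<beta>)"
    proof -
      have "\<bar>Im (V j)\<bar> \<le> 7/8 * pi" using tau c1 c2 by linarith
      then show ?thesis by (simp only: T_def Vj if_True)
    qed
    have lower: "?m / \<beta> \<le> norm (T j)"
    proof -
      have "cos c1 \<le> cos \<bar>Im (V j)\<bar>" by (rule cos_monotone_0_pi_le) (use tau c1 in linarith)+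
      then have "cos c1 \<le> cos (Im (V j))" by (simp only: cos_abs_real)
      then show ?thesis using \<beta> unfolding Tj Vj[symmetric] norm_pole_term[OF \<beta>] ReV
        by (intro divide_right_mono) auto
    qed
    have other: "norm (T k) \<le> ?o / \<beta>" if "k \<noteq> j" for k
    proof (cases "\<bar>Im (V k)\<bar> \<le> 7/8 * pi")
      case True
      have "1 \<le> \<bar>real k - real j\<bar>" using that by linarith
      then have "2 * pi * 1 \<le> 2 * pi * \<bar>real k - real j\<bar>" by (intro mult_left_mono) auto
      then have "2 * pi \<le> \<bar>2 * pi * (real k - real j)\<bar>" by (simp add: abs_mult)
      then have "2 * pi - \<Theta> \<le> \<bar>Im w + 2 * pi * (real k - real j)\<bar>" using w(2) by linarith
      then have "(2 * pi - \<Theta>) / \<beta> \<le> \<bar>Im (V k)\<bar>" using \<beta> by (simp add: ImV divide_right_mono)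
      then have "cos \<bar>Im (V k)\<bar> \<le> cos c2"
        by (intro cos_monotone_0_pi_le) (use True c1 c2 pi_gt_zero in \<open>(unfold c2_def, linarith)+\<close>)
      then have "cos (Im (V k)) \<le> cos c2" by (simp only: cos_abs_real)
      then show ?thesis using True \<beta> norm_pole_term[OF \<beta>, of b "V k"] by (simp add: T_def ReV divide_right_mono)
    next
      case False
      then show ?thesis using \<beta> by (simp add: T_def)
    qed
    have jm: "j < m" by (simp add: m_def)
    have split: "(\<Sum>k<m. T k) = T j + (\<Sum>k\<in>{..<m} - {j}. T k)"
      using jm by (intro sum.remove) auto
  let ?R = "(\<Sum>k\<in>{..<m} - {j}. T k)"
    have rest: "norm ?R \<le> m * (?o / \<beta>)"
    proof -
      have "norm ?R \<le> (\<Sum>k\<in>{..<m} - {j}. ?o / \<beta>)"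
        by (rule sum_norm_le) (use other in auto)
      also have "\<dots> \<le> (\<Sum>k\<in>{..<m}. ?o / \<beta>)"
        using \<beta> by (intro sum_mono2) auto
      finally show ?thesis by simp
    qed
    have "norm (F \<beta> b 1 (exp w) - (\<Sum>k<m. T k)) \<le> C"
      using C[of w] w \<Theta> unfolding T_def V_def Let_def m_def by simp
    then have "norm (F \<beta> b 1 (exp w) - T j - ?R) \<le> \<bar>C\<bar>"
      unfolding split by (simp add: algebra_simps)
    then have "norm (F \<beta> b 1 (exp w) - T j) \<le> \<bar>C\<bar> + m * (?o / \<beta>)"
      using rest norm_triangle_ineq[of "F \<beta> b 1 (exp w) - T j - ?R" "\<Sum>k\<in>{..<m} - {j}. T k"]
      by simp
    also have "\<dots> = err s * (?m / \<beta>)"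
    proof -
      have "exp ((b - 1) * s - exp s * cos c1) * ?m = 1"
        by (simp add: exp_add[symmetric] algebra_simps)
      moreover have "exp (exp s * (cos c2 - cos c1)) * ?m = ?o"
        by (simp add: exp_add[symmetric] algebra_simps)
      ultimately show ?thesis using \<beta> unfolding err_def
        by (simp only: distrib_right times_divide_eq_right mult.assoc) (simp add: add_divide_distrib)
    qed
    also have "\<dots> \<le> e * (?m / \<beta>)"
    proof (rule mult_right_mono)
      have "s0 \<le> s" using w(1) \<beta> by (simp add: s_def field_simps)
      then show "err s \<le> e" using s0 by (simp add: less_imp_le)
    qed (use \<beta> in simp)
    also have "\<dots> \<le> e * norm (T j)" using lower e by (intro mult_left_mono) auto
    finally show "norm (F \<beta> b 1 (exp w) - pole_term \<beta> b (w / of_real \<beta>)) \<le> e * norm (pole_term \<beta> b (w / of_real \<beta>))"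
      unfolding Tj .
  qed
qed

section \<open>Laplace transforms of bounded functions\<close>

definition laplace :: "(real \<Rightarrow> real) \<Rightarrow> real \<Rightarrow> real" where
  "laplace f s = integral {0<..} (\<lambda>t. exp (- s * t) * f t)"

lemma has_integral_exp_pos:
  fixes s :: real
  assumes "0 < s" shows "((\<lambda>t. exp (- s * t)) has_integral 1 / s) {0<..}"
proof -
  have "((\<lambda>t. if t \<in> {0<..} then exp (- s * t) else 0) has_integral 1 / s) {0..}"
    by (rule has_integral_spike[of "{0}", rotated 2, where f = "\<lambda>t. exp (- s * t)"])
      (use has_integral_exp_minus_to_infinity[OF assms, of 0] in auto)
  then show ?thesis by (subst (asm) has_integral_restrict) auto
qed

lemma absolutely_integrable_exp_bound:
  fixes f :: "real \<Rightarrow> 'a::euclidean_space"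
  assumes "continuous_on {0<..} f" "0 < s" "\<And>t. 0 < t \<Longrightarrow> norm (f t) \<le> K * exp (- s * t)"
  shows "f absolutely_integrable_on {0<..}" "norm (integral {0<..} f) \<le> K / s"
proof -
  have g: "((\<lambda>t. K * exp (- s * t)) has_integral K * (1 / s)) {0<..}"
    by (intro has_integral_mult_right has_integral_exp_pos assms)
  show f: "f absolutely_integrable_on {0<..}"
    by (rule measurable_bounded_by_integrable_imp_absolutely_integrable[where g = "\<lambda>t. K * exp (- s * t)"])
      (use assms g in \<open>auto intro!: continuous_imp_measurable_on_sets_lebesgue has_integral_integrable\<close>)
  have "norm (integral {0<..} f) \<le> integral {0<..} (\<lambda>t. K * exp (- s * t))"
    using f g assms by (intro integral_norm_bound_integral) (auto simp: absolutely_integrable_on_def)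
  then show "norm (integral {0<..} f) \<le> K / s" unfolding integral_unique[OF g] by simp
qed

lemma laplace_integrable:
  assumes "continuous_on {0<..} f" "0 < s" "\<And>t. 0 < t \<Longrightarrow> \<bar>f t\<bar> \<le> K"
  shows "(\<lambda>t. exp (- s * t) * f t) integrable_on {0<..}" "\<bar>laplace f s\<bar> \<le> K / s"
proof -
  have c: "continuous_on {0<..} (\<lambda>t. exp (- s * t) * f t)" by (intro continuous_intros assms)
  have b: "norm (exp (- s * t) * f t) \<le> K * exp (- s * t)" if "0 < t" for t
    using assms(3)[OF that] by (simp add: abs_mult mult.commute mult_right_mono)
  show "(\<lambda>t. exp (- s * t) * f t) integrable_on {0<..}"
    using absolutely_integrable_exp_bound(1)[OF c assms(2) b] by (auto simp: absolutely_integrable_on_def)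
  show "\<bar>laplace f s\<bar> \<le> K / s"
    using absolutely_integrable_exp_bound(2)[OF c assms(2) b] by (simp add: laplace_def)
qed

lemma exp_neg_le_quadratic: "0 \<le> u \<Longrightarrow> exp (- u) \<le> 1 - u + u\<^sup>2" for u :: real
proof -
  assume u: "0 \<le> u"
  have "exp (- u) \<le> 1 / (1 + u)" using exp_ge_add_one_self[of u] u by (simp add: exp_minus field_simps)
  also have "\<dots> \<le> 1 - u + u\<^sup>2"
  proof -
    have "(1 + u) * (1 - u + u\<^sup>2) = 1 + u ^ 3" by (simp add: algebra_simps power2_eq_square power3_eq_cube)
    then show ?thesis using u by (simp add: divide_le_eq mult.commute)
  qed
  finally show ?thesis .
qed

lemma exp_second_order_bound: "\<bar>exp y - 1 - y\<bar> \<le> y\<^sup>2 * exp \<bar>y\<bar>" for y :: real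
proof -
  have nn: "0 \<le> exp y - 1 - y" using exp_ge_add_one_self[of y] by linarith
  show ?thesis
  proof (cases "0 \<le> y")
    case True
    have "1 - y \<le> exp (- y)" using exp_ge_add_one_self[of "- y"] by simp
    then have "(1 - y) * exp y \<le> exp (- y) * exp y" by (intro mult_right_mono) auto
    then have 1: "exp y - 1 \<le> y * exp y" by (simp add: exp_minus algebra_simps)
    have "exp y - 1 - y \<le> y * exp y - y" using 1 by simp
    also have "\<dots> = y * (exp y - 1)" by (simp add: algebra_simps)
    also have "\<dots> \<le> y * (y * exp y)" using True 1 by (intro mult_left_mono)
    finally show ?thesis using nn True by (simp add: power2_eq_square)
  next
    case False
    have "exp y - 1 - y \<le> y\<^sup>2 * 1" using exp_neg_le_quadratic[of "- y"] False by simp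
    also have "\<dots> \<le> y\<^sup>2 * exp \<bar>y\<bar>" by (intro mult_left_mono) auto
    finally show ?thesis using nn by simp
  qed
qed

text \<open>
  The second-order remainder of \<open>exp (- h * t)\<close> contributes a factor \<open>t\<^sup>2\<close>. One \<open>t\<close> goes into the bounded
  function \<open>t * f t\<close>, the other one and \<open>exp (\<bar>h\<bar> * t)\<close> into the exponential, at the cost of half the decay rate.
\<close>

lemma laplace_has_derivative:
  assumes f: "continuous_on {0<..} f" and s: "0 < s"
    and K: "\<And>t. 0 < t \<Longrightarrow> \<bar>f t\<bar> \<le> K" and K': "\<And>t. 0 < t \<Longrightarrow> \<bar>t * f t\<bar> \<le> K'"
  shows "(laplace f has_real_derivative - laplace (\<lambda>t. t * f t) s) (at s)"
proof -
  define c where "c = K' * (4 / s) / (s / 2)"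
  have K'0: "0 \<le> K'" using K'[of 1] by linarith
  have est: "\<bar>(laplace f (s + h) - laplace f s) / h - (- laplace (\<lambda>t. t * f t) s)\<bar> \<le> c * \<bar>h\<bar>"
    if h: "h \<noteq> 0" "\<bar>h\<bar> \<le> s / 4" for h
  proof -
    let ?R = "\<lambda>t. (exp (- (s + h) * t) * f t - exp (- s * t) * f t) / h + exp (- s * t) * (t * f t)"
    have sh: "0 < s + h" using h s by linarith
    have "(?R has_integral ((laplace f (s + h) - laplace f s) / h + laplace (\<lambda>t. t * f t) s)) {0<..}"
      unfolding laplace_def
      by (intro has_integral_add has_integral_diff has_integral_divide integrable_integral
          laplace_integrable(1)[OF f _ K] laplace_integrable(1)[OF _ _ K'] s sh continuous_intros f)
    moreover have "norm (integral {0<..} ?R) \<le> (\<bar>h\<bar> * (K' * (4 / s))) / (s / 2)"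
    proof (rule absolutely_integrable_exp_bound(2))
      show "continuous_on {0<..} ?R" by (intro continuous_intros f) (use h in auto)
      fix t :: real assume t: "0 < t"
      have "?R t = exp (- s * t) * f t / h * (exp (- h * t) - 1 - (- h * t))"
        using h by (simp add: exp_add[symmetric] field_simps)
      then have "norm (?R t) = exp (- s * t) * \<bar>f t\<bar> / \<bar>h\<bar> * \<bar>exp (- h * t) - 1 - (- h * t)\<bar>"
        by (simp add: abs_mult)
      also have "\<dots> \<le> exp (- s * t) * \<bar>f t\<bar> / \<bar>h\<bar> * ((- h * t)\<^sup>2 * exp \<bar>- h * t\<bar>)"
        by (intro mult_left_mono exp_second_order_bound) auto
      also have "\<dots> = exp (- s * t) * \<bar>h\<bar> * t * \<bar>t * f t\<bar> * exp (\<bar>h\<bar> * t)"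
        using h t by (simp add: abs_mult power2_eq_square field_simps)
      also have "\<dots> \<le> exp (- s * t) * \<bar>h\<bar> * (4 / s * exp (s / 4 * t)) * K' * exp (s / 4 * t)"
      proof -
        have "t \<le> 4 / s * exp (s / 4 * t)"
          using exp_ge_add_one_self[of "s / 4 * t"] s t by (simp add: field_simps)
        moreover have "exp (\<bar>h\<bar> * t) \<le> exp (s / 4 * t)" using h t by (simp add: mult_right_mono)
        ultimately show ?thesis using t s K'[OF t] K'0 by (intro mult_mono) auto
      qed
      also have "\<dots> = \<bar>h\<bar> * (K' * (4 / s)) * (exp (- s * t) * exp (s / 4 * t) * exp (s / 4 * t))" by simp
      also have "exp (- s * t) * exp (s / 4 * t) * exp (s / 4 * t) = exp (- (s / 2) * t)"
        by (simp add: exp_add[symmetric] field_simps)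
      finally show "norm (?R t) \<le> \<bar>h\<bar> * (K' * (4 / s)) * exp (- (s / 2) * t)" .
    qed (use s in simp)
    ultimately show ?thesis by (simp add: integral_unique c_def mult_ac)
  qed
  have "((\<lambda>h. (laplace f (s + h) - laplace f s) / h - (- laplace (\<lambda>t. t * f t) s)) \<longlongrightarrow> 0) (at 0)"
  proof (rule Lim_null_comparison)
    have "\<forall>\<^sub>F h in at 0. \<bar>h\<bar> < s / 4 \<and> h \<noteq> 0"
      unfolding eventually_at using s by (intro exI[of _ "s / 4"]) (auto simp: dist_real_def)
    then show "\<forall>\<^sub>F h in at 0. norm ((laplace f (s + h) - laplace f s) / h - (- laplace (\<lambda>t. t * f t) s)) \<le> c * \<bar>h\<bar>"
      by eventually_elim (use est in auto)
    show "((\<lambda>h. c * \<bar>h\<bar>) \<longlongrightarrow> 0) (at 0)" by (auto intro!: tendsto_eq_intros)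
  qed
  then show ?thesis unfolding DERIV_def by (rule LIM_zero_cancel)
qed

section \<open>Binet's formula, centred at one half\<close>

text \<open>
  The Laplace transform of this function is \<open>Polygamma 1\<close>, the second derivative of \<open>ln \<Gamma>\<close>, at \<open>s + 1/2\<close>.
\<close>

definition psi_density :: "real \<Rightarrow> real" where
  "psi_density t = t / (2 * sinh (t / 2))"

text \<open>
  Dividing by \<open>t\<^sup>2\<close> integrates the Laplace transform twice, and the \<open>1\<close> is the density of \<open>1/s\<close>, the second
  derivative of \<open>s * ln s - s\<close>.
\<close>

definition binet_density :: "real \<Rightarrow> real" where
  "binet_density t = (1 - psi_density t) / t\<^sup>2"

lemma sinh_le_mult_cosh: "0 \<le> x \<Longrightarrow> sinh x \<le> x * cosh x" for x :: real
proof -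
  assume x: "0 \<le> x"
  have "(\<lambda>x. x * cosh x - sinh x) 0 \<le> x * cosh x - sinh x"
  proof (rule DERIV_nonneg_imp_nondecreasing[OF x])
    fix u :: real assume u: "0 \<le> u" "u \<le> x"
    show "\<exists>y. ((\<lambda>x. x * cosh x - sinh x) has_real_derivative y) (at u) \<and> 0 \<le> y"
      using u by (intro exI[of _ "u * sinh u"]) (auto intro!: derivative_eq_intros)
  qed
  then show ?thesis by simp
qed

lemma le_sinh: "0 \<le> x \<Longrightarrow> x \<le> sinh x" for x :: real
proof -
  assume x: "0 \<le> x"
  have "(\<lambda>x. sinh x - x) 0 \<le> sinh x - x"
  proof (rule DERIV_nonneg_imp_nondecreasing[OF x])
    fix u :: real assume u: "0 \<le> u" "u \<le> x"
    show "\<exists>y. ((\<lambda>x. sinh x - x) has_real_derivative y) (at u) \<and> 0 \<le> y"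
      by (intro exI[of _ "cosh u - 1"]) (auto intro!: derivative_eq_intros simp: cosh_real_ge_1)
  qed
  then show ?thesis by simp
qed

lemma psi_density_bounds:
  assumes t: "0 < t"
  shows "0 \<le> psi_density t" "psi_density t \<le> 1" "1 - psi_density t \<le> t\<^sup>2" "1 - psi_density t \<le> t"
proof -
  have sh: "0 < sinh (t / 2)" "t / 2 \<le> sinh (t / 2)" using t le_sinh[of "t / 2"] by auto
  show 0: "0 \<le> psi_density t" using sh t by (simp add: psi_density_def)
  show "psi_density t \<le> 1" using sh t by (simp add: psi_density_def divide_le_eq)
  have ge: "1 - psi_density t \<le> t\<^sup>2 / 4" if "t \<le> 1"
  proof -
    let ?x = "t / 2"
    have "cosh ?x \<le> 1 + ?x\<^sup>2"
      using exp_bound[of ?x] exp_neg_le_quadratic[of ?x] t that by (simp add: cosh_def)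
    have "sinh ?x \<le> ?x * cosh ?x" using t by (intro sinh_le_mult_cosh) simp
    also have "\<dots> \<le> ?x * (1 + ?x\<^sup>2)" using \<open>cosh ?x \<le> 1 + ?x\<^sup>2\<close> t by (intro mult_left_mono) auto
    finally have "sinh ?x \<le> ?x * (1 + ?x\<^sup>2)" .
    moreover have "?x * ?x\<^sup>2 \<le> sinh ?x * ?x\<^sup>2" using sh(2) by (intro mult_right_mono) auto
    ultimately have "sinh ?x * (1 - ?x\<^sup>2) \<le> ?x" by (simp add: algebra_simps)
    then have "1 - ?x\<^sup>2 \<le> ?x / sinh ?x" using sh by (simp add: field_simps)
    then show ?thesis by (simp add: psi_density_def power_divide)
  qed
  show "1 - psi_density t \<le> t\<^sup>2"
  proof (cases "t \<le> 1")
    case True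
    then show ?thesis using ge zero_le_power2[of t] by linarith
  next
    case False
    then have "1 \<le> t\<^sup>2" by (simp add: one_le_power)
    then show ?thesis using 0 by linarith
  qed
  show "1 - psi_density t \<le> t"
  proof (cases "t \<le> 1")
    case True
    have "t\<^sup>2 \<le> t" using True t by (simp add: power2_eq_square mult_left_le)
    then show ?thesis using ge[OF True] t by (simp add: field_simps)
  next
    case False
    then show ?thesis using 0 by linarith
  qed
qed

lemma binet_density_bounds:
  assumes t: "0 < t"
  shows "\<bar>binet_density t\<bar> \<le> 1" "\<bar>t * binet_density t\<bar> \<le> 1" "\<bar>t * (t * binet_density t)\<bar> \<le> 1"
    and "t * (t * binet_density t) = 1 - psi_density t"
proof -
  note b = psi_density_bounds[OF t]
  show eq: "t * (t * binet_density t) = 1 - psi_density t"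
    using t by (simp add: binet_density_def power2_eq_square)
  show "\<bar>t * (t * binet_density t)\<bar> \<le> 1" unfolding eq using b by simp
  show "\<bar>binet_density t\<bar> \<le> 1" using b t by (simp add: binet_density_def abs_divide)
  have "t * binet_density t = (1 - psi_density t) / t" using t by (simp add: binet_density_def power2_eq_square)
  then show "\<bar>t * binet_density t\<bar> \<le> 1" using b t by (simp add: abs_divide)
qed

lemma continuous_on_psi_density [continuous_intros]: "continuous_on {0<..} psi_density"
  unfolding psi_density_def by (intro continuous_intros) auto

lemma continuous_on_binet_density [continuous_intros]: "continuous_on {0<..} binet_density"
  unfolding binet_density_def by (intro continuous_intros) auto

lemma laplace_one: "0 < s \<Longrightarrow> laplace (\<lambda>_. 1) s = 1 / s"
  using has_integral_exp_pos[of s] by (simp add: laplace_def integral_unique)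

text \<open>
  The derivative at \<open>s/2\<close> of the Laplace transform of \<open>exp (- (s/2) * t)\<close>; half of the exponential is kept
  as density because \<open>t\<close> alone is not bounded.
\<close>

lemma has_integral_t_exp:
  fixes s :: real
  assumes s: "0 < s"
  shows "((\<lambda>t. t * exp (- s * t)) has_integral 1 / s\<^sup>2) {0<..}"
proof -
  let ?g = "\<lambda>t. exp (- (s/2) * t) * (t * exp (- (s/2) * t))"
  have p: "t * exp (- (s/2) * t) \<le> 2 / s" if "0 < t" for t
    using exp_ge_add_one_self[of "s / 2 * t"] s that by (simp add: exp_minus field_simps)
  have int: "(\<lambda>t. exp (- (s/2) * t) * (t * exp (- (s/2) * t))) integrable_on {0<..}"
    by (rule laplace_integrable(1)[where K = "2 / s"])
      (use s p in \<open>auto intro!: continuous_intros\<close>)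
  have d: "(laplace (\<lambda>t. exp (- (s/2) * t)) has_real_derivative - laplace (\<lambda>t. t * exp (- (s/2) * t)) (s/2)) (at (s/2))"
    by (rule laplace_has_derivative[where K = 1 and K' = "2 / s"])
      (use s p in \<open>auto intro!: continuous_intros simp: abs_mult\<close>)
  have "laplace (\<lambda>t. exp (- (s/2) * t)) u = 1 / (u + s / 2)" if "0 < u" for u
  proof -
    have "laplace (\<lambda>t. exp (- (s/2) * t)) u = integral {0<..} (\<lambda>t. exp (- (u + s/2) * t))"
      unfolding laplace_def by (intro integral_cong) (simp add: exp_add[symmetric] algebra_simps)
    also have "\<dots> = 1 / (u + s / 2)" using has_integral_exp_pos[of "u + s/2"] s that by (simp add: integral_unique)
    finally show ?thesis .
  qed
  then have ev: "\<forall>\<^sub>F u in nhds (s / 2). laplace (\<lambda>t. exp (- (s/2) * t)) u = 1 / (u + s / 2)"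
    using eventually_nhds_in_open[of "{0<..}" "s / 2"] s by (auto elim!: eventually_mono)
  have "((\<lambda>u. 1 / (u + s / 2)) has_real_derivative - laplace (\<lambda>t. t * exp (- (s/2) * t)) (s/2)) (at (s/2))"
    using d DERIV_cong_ev[OF refl ev refl] by blast
  moreover have "((\<lambda>u. 1 / (u + s / 2)) has_real_derivative - 1 / s\<^sup>2) (at (s/2))"
    using s by (auto intro!: derivative_eq_intros simp: power2_eq_square)
  ultimately have "- laplace (\<lambda>t. t * exp (- (s/2) * t)) (s/2) = - 1 / s\<^sup>2" by (rule DERIV_unique)
  then have "integral {0<..} ?g = 1 / s\<^sup>2" by (simp add: laplace_def)
  with int have "(?g has_integral 1 / s\<^sup>2) {0<..}" by (simp add: has_integral_iff)
  moreover have "?g = (\<lambda>t. t * exp (- s * t))"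
    by (rule ext) (simp add: mult.left_commute mult.assoc exp_add[symmetric])
  ultimately show ?thesis by (simp only:)
qed

text \<open>
  Termwise, \<open>1 / (x + k)\<^sup>2\<close> is the integral of \<open>t * exp (- (x + k) * t)\<close>; the sum over \<open>k\<close> is a
  geometric series, and centring at \<open>x = s + 1/2\<close> makes its denominator the hyperbolic sine.
\<close>

lemma Polygamma_1_eq_laplace:
  assumes s: "0 < s"
  shows "Polygamma 1 (s + 1/2) = laplace psi_density s"
proof -
  let ?x = "s + 1/2"
  let ?f = "\<lambda>n t. \<Sum>k<n. t * exp (- (?x + real k) * t)"
  have fin: "?f n t = exp (- s * t) * psi_density t * (1 - exp (- t) ^ n)" if t: "0 < t" for n t
  proof -
    have e1: "exp (- t) \<noteq> 1" using t by simp
    have "?f n t = t * exp (- ?x * t) * (\<Sum>k<n. exp (- t) ^ k)"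
      unfolding sum_distrib_left
      by (intro sum.cong refl) (simp add: exp_of_nat_mult[symmetric] exp_add[symmetric] algebra_simps)
    also have "(\<Sum>k<n. exp (- t) ^ k) = (1 - exp (- t) ^ n) / (1 - exp (- t))"
      using e1 sum_gp_strict[of "exp (- t)" n] by simp
    also have "t * exp (- ?x * t) * ((1 - exp (- t) ^ n) / (1 - exp (- t)))
        = exp (- s * t) * (t * (exp (- (t / 2)) / (1 - exp (- t)))) * (1 - exp (- t) ^ n)"
      by (simp add: exp_add[symmetric] algebra_simps)
    also have "exp (- (t / 2)) / (1 - exp (- t)) = 1 / (2 * sinh (t / 2))"
    proof -
      have "exp (- (t/2)) * (2 * sinh (t / 2)) = 1 - exp (- t)"
        by (simp add: sinh_def right_diff_distrib exp_add[symmetric])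
      moreover have "sinh (t / 2) \<noteq> 0" using t by simp
      ultimately show ?thesis using e1 by (simp add: field_simps)
    qed
    finally show ?thesis by (simp add: psi_density_def)
  qed
  have 1: "((\<lambda>t. exp (- s * t) * psi_density t) has_integral Polygamma 1 ?x) {0<..}"
  proof (rule has_integral_dominated_convergence)
    show "(?f n has_integral (\<Sum>k<n. 1 / (?x + real k)\<^sup>2)) {0<..}" for n
      by (intro has_integral_sum has_integral_t_exp) (use s in auto)
    show "(\<lambda>t. exp (- s * t)) integrable_on {0<..}" using has_integral_exp_pos[OF s] by blast
    show "\<forall>t\<in>{0<..}. norm (?f n t) \<le> exp (- s * t)" for n
    proof
      fix t :: real assume "t \<in> {0<..}"
      then have t: "0 < t" by simp
      note b = psi_density_bounds[OF t]
      have "0 \<le> 1 - exp (- t) ^ n" "1 - exp (- t) ^ n \<le> 1" using t by (auto simp: power_le_one)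
      then have "exp (- s * t) * psi_density t * (1 - exp (- t) ^ n) \<le> exp (- s * t) * 1 * 1"
        using b by (intro mult_mono) auto
      then show "norm (?f n t) \<le> exp (- s * t)"
        unfolding fin[OF t] using b \<open>0 \<le> 1 - exp (- t) ^ n\<close> by (simp add: abs_mult)
    qed
    show "\<forall>t\<in>{0<..}. (\<lambda>n. ?f n t) \<longlonglongrightarrow> exp (- s * t) * psi_density t"
    proof
      fix t :: real assume "t \<in> {0<..}"
      then have t: "0 < t" by simp
      have "(\<lambda>n. exp (- s * t) * psi_density t * (1 - exp (- t) ^ n)) \<longlonglongrightarrow> exp (- s * t) * psi_density t * (1 - 0)"
        by (intro tendsto_intros LIMSEQ_power_zero) (use t in simp)
      then show "(\<lambda>n. ?f n t) \<longlonglongrightarrow> exp (- s * t) * psi_density t" unfolding fin[OF t] by simp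
    qed
    have "(\<lambda>k. inverse ((?x + of_nat k) ^ Suc 1)) sums ((-1) ^ Suc 1 * Polygamma 1 ?x / fact 1)"
      by (rule Polygamma_LIMSEQ) (use s in auto)
    moreover have "inverse ((?x + of_nat k) ^ Suc 1) = 1 / (?x + real k)\<^sup>2" for k
      by (simp only: inverse_eq_divide Suc_1)
    moreover have "(-1) ^ Suc 1 * Polygamma 1 ?x / fact 1 = Polygamma 1 ?x" by simp
    ultimately show "(\<lambda>n. \<Sum>k<n. 1 / (?x + real k)\<^sup>2) \<longlonglongrightarrow> Polygamma 1 ?x"
      unfolding sums_def by (simp only:)
  qed
  then show ?thesis by (simp add: laplace_def integral_unique)
qed

lemma tendsto_laplace_at_top:
  assumes "continuous_on {0<..} f" "\<And>t. 0 < t \<Longrightarrow> \<bar>f t\<bar> \<le> K"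
  shows "(laplace f \<longlongrightarrow> 0) at_top"
proof (rule Lim_null_comparison)
  show "\<forall>\<^sub>F s in at_top. norm (laplace f s) \<le> K / s"
    using eventually_gt_at_top[of 0] by eventually_elim (use laplace_integrable(2)[OF assms(1) _ assms(2)] in auto)
  show "((\<lambda>s. K / s) \<longlongrightarrow> 0) at_top" by real_asymp
qed

text \<open>
  Both sides have the second derivative \<open>Polygamma 1 (s + 1/2)\<close>.
\<close>

lemma ln_Gamma_minus_stirling_linear:
  obtains c0 c1 where "\<And>s. 0 < s \<Longrightarrow> ln_Gamma (s + 1/2) = s * ln s - s - laplace binet_density s + c0 + c1 * s"
proof -
  let ?q1 = "\<lambda>t. t * binet_density t"
  let ?q2 = "\<lambda>t. t * (t * binet_density t)"
  have c1: "continuous_on {0<..} ?q1" by (intro continuous_intros)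
  define D where "D = (\<lambda>s. ln_Gamma (s + 1/2) - s * ln s + s + laplace binet_density s)"
  define D1 where "D1 = (\<lambda>s. Digamma (s + 1/2) - ln s - laplace ?q1 s)"
  have der: "(D has_real_derivative D1 s) (at s)" if s: "0 < s" for s
    unfolding D_def D1_def using s
    by (auto intro!: derivative_eq_intros laplace_has_derivative[where K = 1 and K' = 1] continuous_intros
        simp: binet_density_bounds)
  have der1: "(D1 has_real_derivative 0) (at s)" if s: "0 < s" for s
  proof -
    have "(laplace ?q1 has_real_derivative - laplace ?q2 s) (at s)"
      by (rule laplace_has_derivative[OF c1 s, where K = 1 and K' = 1]) (use binet_density_bounds in auto)
    moreover have "((\<lambda>s. Digamma (s + 1/2)) has_real_derivative Polygamma 1 (s + 1/2)) (at s)"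
    proof -
      have "s + 1/2 \<notin> \<int>\<^sub>\<le>\<^sub>0" using s by (auto elim!: nonpos_Ints_cases)
      then have "(Digamma has_real_derivative Polygamma 1 (s + 1/2)) (at (s + 1/2))"
        using has_field_derivative_Polygamma[of "s + 1/2" 0] by simp
      then show ?thesis by (simp only: DERIV_shift)
    qed
    moreover have "(ln has_real_derivative 1 / s) (at s)" using s by (rule DERIV_ln_divide)
    ultimately have d: "(D1 has_real_derivative (Polygamma 1 (s + 1/2) - 1 / s - - laplace ?q2 s)) (at s)"
      unfolding D1_def by (intro DERIV_diff)
    have "laplace ?q2 s = integral {0<..} (\<lambda>t. exp (- s * t) * 1 - exp (- s * t) * psi_density t)"
      unfolding laplace_def
      by (intro integral_cong) (simp add: binet_density_bounds(4) right_diff_distrib)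
    also have "\<dots> = laplace (\<lambda>_. 1) s - laplace psi_density s"
      unfolding laplace_def
      by (intro integral_diff laplace_integrable(1)[where K = 1] s continuous_intros)
        (use psi_density_bounds in \<open>auto simp: abs_le_iff intro: order.trans[of _ 0]\<close>)
    finally have "laplace ?q2 s = 1 / s - Polygamma 1 (s + 1/2)"
      unfolding laplace_one[OF s] Polygamma_1_eq_laplace[OF s] .
    with d show ?thesis by simp
  qed
  obtain c where c: "\<And>s. 0 < s \<Longrightarrow> D1 s = c"
    using has_field_derivative_zero_constant[of "{0<..}" D1] der1
    by (auto intro: has_field_derivative_at_within)
  have "((\<lambda>s. D s - c * s) has_real_derivative 0) (at s)" if s: "0 < s" for s
    using der[OF s] c[OF s] by (auto intro!: derivative_eq_intros)
  then obtain d where d: "\<And>s. 0 < s \<Longrightarrow> D s - c * s = d"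
    using has_field_derivative_zero_constant[of "{0<..}" "\<lambda>s. D s - c * s"]
    by (auto intro: has_field_derivative_at_within)
  show ?thesis
  proof (rule that[of d c])
    fix s :: real assume "0 < s"
    from d[OF this] show "ln_Gamma (s + 1/2) = s * ln s - s - laplace binet_density s + d + c * s"
      by (simp add: D_def)
  qed
qed

text \<open>
  The constants left open by \<open>ln_Gamma_minus_stirling_linear\<close> are found by letting \<open>s\<close> tend to infinity, where
  the Laplace transform vanishes: the functional equation of \<open>\<Gamma>\<close> gives \<open>c1 = 0\<close>, and Legendre's
  duplication formula gives \<open>c0\<close>.
\<close>

theorem ln_Gamma_binet_half:
  assumes s: "0 < s"
  shows "ln_Gamma (s + 1/2) = s * ln s - s + ln (2 * pi) / 2 - laplace binet_density s"
proof -
  let ?Q = "laplace binet_density"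
  obtain c0 c1 where c: "\<And>s. 0 < s \<Longrightarrow> ln_Gamma (s + 1/2) = s * ln s - s - ?Q s + c0 + c1 * s"
    using ln_Gamma_minus_stirling_linear by blast
  have Q0: "(?Q \<longlongrightarrow> 0) at_top"
    by (rule tendsto_laplace_at_top[where K = 1]) (use binet_density_bounds in \<open>auto intro!: continuous_intros\<close>)
  have Qs: "((\<lambda>s. ?Q (k * s + d)) \<longlongrightarrow> 0) at_top" if "0 < k" for k d
    by (rule filterlim_compose[OF Q0]) (use that in real_asymp)
  have "c1 = 0"
  proof -
    have e1: "c1 = (ln (s + 1/2) - (s + 1) * ln (s + 1) + s * ln s + 1) + (?Q (1 * s + 1) - ?Q (1 * s + 0))" if s: "0 < s" for s
    proof -
      have "Gamma (s + 1/2 + 1) = (s + 1/2) * Gamma (s + 1/2)"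
        by (rule Gamma_plus1) (use s in \<open>auto elim!: nonpos_Ints_cases\<close>)
      then have "ln_Gamma (s + 1 + 1/2) = ln ((s + 1/2) * Gamma (s + 1/2))"
        using s by (simp add: ln_Gamma_real_pos add_ac)
      also have "\<dots> = ln (s + 1/2) + ln (Gamma (s + 1/2))"
        by (rule ln_mult_pos) (use s Gamma_real_pos[of "s + 1/2"] in auto)
      finally have "ln_Gamma (s + 1 + 1/2) = ln (s + 1/2) + ln_Gamma (s + 1/2)"
        using s by (simp add: ln_Gamma_real_pos)
      then show ?thesis using c[of s] c[of "s + 1"] s by (simp add: algebra_simps)
    qed
    then have "\<forall>\<^sub>F s in at_top. (ln (s + 1/2) - (s + 1) * ln (s + 1) + s * ln s + 1) + (?Q (1 * s + 1) - ?Q (1 * s + 0)) = c1"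
      by (intro eventually_mono[OF eventually_gt_at_top[of "0::real"]]) (rule e1[symmetric])
    moreover have "((\<lambda>s::real. ln (s + 1/2) - (s + 1) * ln (s + 1) + s * ln s + 1) \<longlongrightarrow> 0) at_top"
      by real_asymp
    then have "((\<lambda>s. (ln (s + 1/2) - (s + 1) * ln (s + 1) + s * ln s + 1) + (?Q (1 * s + 1) - ?Q (1 * s + 0))) \<longlongrightarrow> 0 + (0 - 0)) at_top"
      by (intro tendsto_add tendsto_diff Qs) auto
    ultimately have "((\<lambda>_::real. c1) \<longlongrightarrow> 0 + (0 - 0)) at_top"
      by (rule Lim_transform_eventually[rotated])
    then show ?thesis by (simp add: tendsto_const_iff)
  qed
  have "c0 = ln (2 * pi) / 2"
  proof -
    define G where "G = (\<lambda>s::real. (1 - 2 * (s + 1/2)) * ln 2 + ln pi / 2 + ((2 * s + 1/2) * ln (2 * s + 1/2) - (2 * s + 1/2))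
         - (s * ln s - s) - ((s + 1/2) * ln (s + 1/2) - (s + 1/2)))"
    have e1: "c0 = G s + (?Q (1 * s + 0) + ?Q (1 * s + 1/2) - ?Q (2 * s + 1/2))" if s: "0 < s" for s
    proof -
      have np: "complex_of_real x \<notin> \<int>\<^sub>\<le>\<^sub>0" if "0 < x" for x
        using that by (auto elim!: nonpos_Ints_cases simp: complex_eq_iff)
      have "Gamma (complex_of_real (s + 1/2)) * Gamma (complex_of_real (s + 1/2) + 1/2) =
             exp ((1 - 2*complex_of_real (s + 1/2)) * of_real (ln 2)) * of_real (sqrt pi) * Gamma (2*complex_of_real (s + 1/2))"
        by (rule Gamma_legendre_duplication)
          (use np[of "s + 1/2"] np[of "s + 1"] s in \<open>auto simp: add_ac\<close>)
      also have "complex_of_real (s + 1/2) + 1/2 = of_real (s + 1)" by simp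
      also have "(1 - 2*complex_of_real (s + 1/2)) * of_real (ln 2) = of_real ((1 - 2 * (s + 1/2)) * ln 2)" by simp
      also have "2*complex_of_real (s + 1/2) = of_real (2 * s + 1)" by simp
      finally have "complex_of_real (Gamma (s + 1/2) * Gamma (s + 1)) = of_real (exp ((1 - 2 * (s + 1/2)) * ln 2) * sqrt pi * Gamma (2 * s + 1))"
        by (simp only: Gamma_complex_of_real of_real_mult exp_of_real[symmetric])
      then have "Gamma (s + 1/2) * Gamma (s + 1) = exp ((1 - 2 * (s + 1/2)) * ln 2) * sqrt pi * Gamma (2 * s + 1)"
        by (simp only: of_real_eq_iff)
      moreover have g: "0 < Gamma (s + 1/2)" "0 < Gamma (s + 1)" "0 < Gamma (2 * s + 1)"
        by (rule Gamma_real_pos, use s in simp)+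
      ultimately have "ln (Gamma (s + 1/2)) + ln (Gamma (s + 1)) = ln (exp ((1 - 2 * (s + 1/2)) * ln 2) * sqrt pi * Gamma (2 * s + 1))"
        by (metis ln_mult_pos)
      also have "\<dots> = (1 - 2 * (s + 1/2)) * ln 2 + ln (sqrt pi) + ln (Gamma (2 * s + 1))"
        using g by (subst ln_mult_pos, simp, simp, subst ln_mult_pos, simp_all)
      finally have "ln_Gamma (s + 1/2) + ln_Gamma (s + 1) = (1 - 2 * (s + 1/2)) * ln 2 + ln pi / 2 + ln_Gamma (2 * s + 1)"
        using s by (simp add: ln_sqrt ln_Gamma_real_pos)
      then show ?thesis using c[of s] c[of "s + 1/2"] c[of "2 * s + 1/2"] s \<open>c1 = 0\<close>
        by (simp add: G_def add.assoc)
    qed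
    then have "\<forall>\<^sub>F s in at_top. G s + (?Q (1 * s + 0) + ?Q (1 * s + 1/2) - ?Q (2 * s + 1/2)) = c0"
      by (intro eventually_mono[OF eventually_gt_at_top[of "0::real"]]) (rule e1[symmetric])
    moreover have "(G \<longlongrightarrow> ln 2 / 2 + ln pi / 2) at_top"
      unfolding G_def by real_asymp
    then have "((\<lambda>s. G s + (?Q (1 * s + 0) + ?Q (1 * s + 1/2) - ?Q (2 * s + 1/2))) \<longlongrightarrow> ln 2 / 2 + ln pi / 2 + (0 + 0 - 0)) at_top"
      by (intro tendsto_add tendsto_diff Qs) auto
    ultimately have "((\<lambda>_::real. c0) \<longlongrightarrow> ln 2 / 2 + ln pi / 2 + (0 + 0 - 0)) at_top"
      by (rule Lim_transform_eventually[rotated])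
    then have "c0 = ln 2 / 2 + ln pi / 2" by (simp add: tendsto_const_iff)
    then show ?thesis by (simp add: ln_mult add_divide_distrib)
  qed
  with c[OF s] \<open>c1 = 0\<close> show ?thesis by simp
qed

section \<open>Exponentials of Laplace multipliers\<close>

lemma summable_bounded_multiplier:
  fixes c l :: "nat \<Rightarrow> real" and z :: complex
  assumes sum: "summable (\<lambda>n. \<bar>c n\<bar> * norm z ^ n)" and l: "\<And>n. \<bar>l n\<bar> \<le> M"
  shows "summable (\<lambda>n. of_real (c n * l n) * z ^ n)"
proof (rule summable_comparison_test'[OF summable_mult[OF sum, of M]])
  fix n :: nat
  have "\<bar>c n\<bar> * norm z ^ n * \<bar>l n\<bar> \<le> \<bar>c n\<bar> * norm z ^ n * M" by (intro mult_left_mono l) auto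
  then show "norm (of_real (c n * l n) * z ^ n) \<le> M * (\<bar>c n\<bar> * norm z ^ n)"
    by (simp add: norm_mult norm_power abs_mult mult_ac)
qed

text \<open>
  The number \<open>laplace \<kappa> (a * real n + \<nu>) * z ^ n\<close> is the integral of \<open>(z * exp (- a * t)) ^ n\<close> against the
  weight \<open>\<kappa> t * exp (- \<nu> * t)\<close>, which is the same for all \<open>n\<close>.
\<close>

lemma multiplier_series_has_integral:
  fixes c :: "nat \<Rightarrow> real" and z :: complex
  assumes a: "0 \<le> a" and \<nu>: "0 < \<nu>" and \<kappa>: "continuous_on {0<..} \<kappa>" "\<And>t. 0 < t \<Longrightarrow> \<bar>\<kappa> t\<bar> \<le> K"
    and sum: "summable (\<lambda>n. \<bar>c n\<bar> * norm z ^ n)"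
  shows "((\<lambda>t. of_real (\<kappa> t * exp (- \<nu> * t)) * (\<Sum>n. of_real (c n) * (z * of_real (exp (- a * t))) ^ n))
     has_integral (\<Sum>n. of_real (c n * laplace \<kappa> (a * real n + \<nu>)) * z ^ n)) {0<..}"
proof (rule has_integral_dominated_convergence)
  let ?z = "\<lambda>t. z * of_real (exp (- a * t))"
  let ?f = "\<lambda>N t. \<Sum>n<N. of_real (\<kappa> t * exp (- \<nu> * t)) * (of_real (c n) * (?z t) ^ n)"
  define S where "S = (\<Sum>n. \<bar>c n\<bar> * norm z ^ n)"
  have pos: "0 < a * real n + \<nu>" for n using a \<nu> by (intro add_nonneg_pos) auto
  have K0: "0 \<le> K" using \<kappa>(2)[of 1] by linarith
  show "(?f N has_integral (\<Sum>n<N. of_real (c n * laplace \<kappa> (a * real n + \<nu>)) * z ^ n)) {0<..}" for N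
  proof (rule has_integral_sum)
    fix n
    have "((\<lambda>t. exp (- (a * real n + \<nu>) * t) * \<kappa> t) has_integral laplace \<kappa> (a * real n + \<nu>)) {0<..}"
      unfolding laplace_def by (intro integrable_integral laplace_integrable(1)[OF \<kappa>(1) pos \<kappa>(2)])
    then have "((\<lambda>t. (of_real (c n) * z ^ n) * complex_of_real (exp (- (a * real n + \<nu>) * t) * \<kappa> t))
        has_integral (of_real (c n) * z ^ n) * of_real (laplace \<kappa> (a * real n + \<nu>))) {0<..}"
      by (intro has_integral_mult_right has_integral_of_real)
    moreover have "(\<lambda>t. (of_real (c n) * z ^ n) * complex_of_real (exp (- (a * real n + \<nu>) * t) * \<kappa> t))
       = (\<lambda>t. of_real (\<kappa> t * exp (- \<nu> * t)) * (of_real (c n) * (?z t) ^ n))"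
    proof
      fix t
      have "exp (- (a * real n + \<nu>) * t) = exp (- \<nu> * t) * exp (- a * t) ^ n"
        by (simp add: exp_of_nat_mult[symmetric] exp_add[symmetric] algebra_simps)
      then show "(of_real (c n) * z ^ n) * complex_of_real (exp (- (a * real n + \<nu>) * t) * \<kappa> t)
          = of_real (\<kappa> t * exp (- \<nu> * t)) * (of_real (c n) * (?z t) ^ n)"
        by (simp add: power_mult_distrib mult_ac)
    qed
    ultimately show "((\<lambda>t. of_real (\<kappa> t * exp (- \<nu> * t)) * (of_real (c n) * (?z t) ^ n))
        has_integral of_real (c n * laplace \<kappa> (a * real n + \<nu>)) * z ^ n) {0<..}"
      by (simp add: mult_ac)
  qed simp
  show "(\<lambda>t. K * S * exp (- \<nu> * t)) integrable_on {0<..}"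
    using has_integral_mult_right[OF has_integral_exp_pos[OF \<nu>], of "K * S"] by blast
  have le: "norm (of_real (c n) * (?z t) ^ n) \<le> \<bar>c n\<bar> * norm z ^ n" if "0 < t" for n t
  proof -
    have "norm (?z t) \<le> norm z * 1"
      unfolding norm_mult using that a by (intro mult_left_mono) auto
    then show ?thesis by (simp add: norm_mult norm_power mult_left_mono power_mono)
  qed
  show "\<forall>t\<in>{0<..}. norm (?f N t) \<le> K * S * exp (- \<nu> * t)" for N
  proof
    fix t :: real assume "t \<in> {0<..}"
    then have t: "0 < t" by simp
    have "norm (?f N t) = \<bar>\<kappa> t\<bar> * exp (- \<nu> * t) * norm (\<Sum>n<N. of_real (c n) * (?z t) ^ n)"
      by (simp add: sum_distrib_left[symmetric] norm_mult)
    also have "\<dots> \<le> K * exp (- \<nu> * t) * S"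
    proof (intro mult_mono)
      have "norm (\<Sum>n<N. of_real (c n) * (?z t) ^ n) \<le> (\<Sum>n<N. \<bar>c n\<bar> * norm z ^ n)"
        by (intro sum_norm_le le[OF t])
      also have "\<dots> \<le> S" unfolding S_def by (rule sum_le_suminf[OF sum]) auto
      finally show "norm (\<Sum>n<N. of_real (c n) * (?z t) ^ n) \<le> S" .
    qed (use \<kappa>(2)[OF t] K0 in auto)
    finally show "norm (?f N t) \<le> K * S * exp (- \<nu> * t)" by (simp add: mult_ac)
  qed
  show "\<forall>t\<in>{0<..}. (\<lambda>N. ?f N t) \<longlonglongrightarrow> of_real (\<kappa> t * exp (- \<nu> * t)) * (\<Sum>n. of_real (c n) * (?z t) ^ n)"
  proof
    fix t :: real assume "t \<in> {0<..}"
    then have t: "0 < t" by simp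
    have "summable (\<lambda>n. of_real (c n) * (?z t) ^ n)"
      by (rule summable_comparison_test'[OF sum]) (use le[OF t] in auto)
    from tendsto_mult[OF tendsto_const summable_LIMSEQ[OF this]]
    show "(\<lambda>N. ?f N t) \<longlonglongrightarrow> of_real (\<kappa> t * exp (- \<nu> * t)) * (\<Sum>n. of_real (c n) * (?z t) ^ n)"
      by (simp add: sum_distrib_left[symmetric])
  qed
  have "\<bar>laplace \<kappa> (a * real n + \<nu>)\<bar> \<le> K / \<nu>" for n
  proof -
    have "\<bar>laplace \<kappa> (a * real n + \<nu>)\<bar> \<le> K / (a * real n + \<nu>)" by (rule laplace_integrable(2)[OF \<kappa>(1) pos \<kappa>(2)])
    also have "\<dots> \<le> K / \<nu>" using K0 \<nu> a by (intro divide_left_mono mult_pos_pos pos) auto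
    finally show ?thesis .
  qed
  then have "summable (\<lambda>n. of_real (c n * laplace \<kappa> (a * real n + \<nu>)) * z ^ n)"
    by (rule summable_bounded_multiplier[OF sum])
  then show "(\<lambda>N. \<Sum>n<N. of_real (c n * laplace \<kappa> (a * real n + \<nu>)) * z ^ n) \<longlonglongrightarrow> (\<Sum>n. of_real (c n * laplace \<kappa> (a * real n + \<nu>)) * z ^ n)"
    by (rule summable_LIMSEQ)
qed

lemma norm_has_integral_le:
  fixes f :: "real \<Rightarrow> complex"
  assumes "(f has_integral I) S" "(g has_integral J) S" "\<And>t. t \<in> S \<Longrightarrow> norm (f t) \<le> g t"
  shows "norm I \<le> J"
  using integral_norm_bound_integral[of f S g] assms by (metis has_integral_iff)

lemma exp_multiplier_sums:
  fixes c l :: "nat \<Rightarrow> real" and z :: complex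
  assumes sum: "summable (\<lambda>n. \<bar>c n\<bar> * norm z ^ n)" and l: "\<And>n. \<bar>l n\<bar> \<le> M"
  shows "(\<lambda>k. (\<Sum>n. of_real (c n * l n ^ k) * z ^ n) / of_real (fact k)) sums (\<Sum>n. of_real (c n * exp (l n)) * z ^ n)"
proof -
  let ?s = "\<lambda>j. (\<Sum>n. of_real (c n * l n ^ j) * z ^ n)"
  define a where "a = (\<lambda>n k. of_real (c n * (\<Sum>j<k. l n ^ j / fact j)) * z ^ n)"
  have sk: "summable (\<lambda>n. of_real (c n * l n ^ k) * z ^ n)" for k
    by (rule summable_bounded_multiplier[OF sum, where M = "M ^ k"]) (simp add: power_abs power_mono l)
  have part: "\<bar>\<Sum>j<k. l n ^ j / fact j\<bar> \<le> exp M" for n k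
  proof -
    have "\<bar>\<Sum>j<k. l n ^ j / fact j\<bar> \<le> (\<Sum>j<k. \<bar>l n ^ j / fact j\<bar>)" by (rule sum_abs)
    also have "\<dots> \<le> (\<Sum>j<k. M ^ j / fact j)"
      using l[of n] by (intro sum_mono) (auto simp: abs_divide power_abs intro!: divide_right_mono power_mono)
    also have "\<dots> \<le> (\<Sum>j. M ^ j / fact j)"
      using l[of 0] summable_exp_generic[of M] by (intro sum_le_suminf) (auto simp: divide_inverse mult.commute)
    also have "\<dots> = exp M" by (simp add: exp_def divide_inverse mult.commute)
    finally show ?thesis .
  qed
  have "(\<lambda>k. \<Sum>n. a n k) \<longlonglongrightarrow> (\<Sum>n. of_real (c n * exp (l n)) * z ^ n)"
  proof (rule conjunct2[OF conjunct2[OF tannerys_theorem[where M = "\<lambda>n. exp M * (\<bar>c n\<bar> * norm z ^ n)"]]])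
    show "(\<lambda>k. a n k) \<longlonglongrightarrow> of_real (c n * exp (l n)) * z ^ n" for n
    proof -
      have "(\<lambda>j. l n ^ j / fact j) sums exp (l n)"
        using exp_converges[of "l n"] by (simp add: divide_inverse mult.commute)
      then show ?thesis unfolding a_def sums_def by (intro tendsto_intros)
    qed
    have "norm (a n k) \<le> exp M * (\<bar>c n\<bar> * norm z ^ n)" for n k
      using mult_right_mono[OF part[of n k], of "\<bar>c n\<bar> * norm z ^ n"]
      by (simp add: a_def norm_mult norm_power abs_mult mult_ac del: of_real_sum of_real_mult)
    then show "\<forall>\<^sub>F (n, k) in at_top \<times>\<^sub>F sequentially. norm (a n k) \<le> exp M * (\<bar>c n\<bar> * norm z ^ n)"
      by (intro always_eventually) auto
  qed (use sum in \<open>auto intro: summable_mult\<close>)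
  moreover have "(\<Sum>n. a n k) = (\<Sum>j<k. ?s j / of_real (fact j))" for k
  proof -
    have "(\<lambda>n. \<Sum>j<k. (of_real (c n * l n ^ j) * z ^ n) / of_real (fact j)) sums (\<Sum>j<k. ?s j / of_real (fact j))"
      by (intro sums_sum sums_divide summable_sums sk)
    moreover have "a n k = (\<Sum>j<k. (of_real (c n * l n ^ j) * z ^ n) / of_real (fact j))" for n
      unfolding a_def by (simp add: sum_distrib_left sum_distrib_right)
    ultimately have "(\<lambda>n. a n k) sums (\<Sum>j<k. ?s j / of_real (fact j))"
      by (simp only:)
    then show ?thesis by (rule sums_unique[symmetric])
  qed
  ultimately show ?thesis by (simp add: sums_def)
qed

text \<open>
  Along the ray through \<open>z\<close> the function \<open>E\<close> is dominated by \<open>V\<close>, in a variable that starts at \<open>y\<close> and is scaled by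
  \<open>exp (- d * t)\<close> when \<open>z\<close> is scaled by \<open>exp (- a * t)\<close>. Since \<open>V\<close> increases, applying the integral operator
  \<open>k\<close> times multiplies the bound by at most \<open>(K / \<nu>) ^ k\<close>. The outermost application is treated more
  carefully: for \<open>t \<le> 1 / N\<close> the integrand is dominated by \<open>V y * exp (1 - N * t)\<close>, whose integral has the
  small factor \<open>1 / N\<close>, and for larger \<open>t\<close> the argument of \<open>V\<close> has dropped to at most \<open>exp (- d / N) * y\<close>, where
  a rapidly growing \<open>V\<close> is much smaller than at \<open>y\<close>.
\<close>

lemma exp_multiplier_perturbation:
  fixes c :: "nat \<Rightarrow> real" and z :: complex and V :: "real \<Rightarrow> real"
  defines "E \<equiv> \<lambda>z. \<Sum>n. of_real (c n) * z ^ n"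
  assumes a: "0 < a" and d: "0 < d" and \<nu>: "0 < \<nu>"
    and \<kappa>: "continuous_on {0<..} \<kappa>" "\<And>t. 0 < t \<Longrightarrow> \<bar>\<kappa> t\<bar> \<le> K"
    and sum: "\<And>r. 0 \<le> r \<Longrightarrow> summable (\<lambda>n. \<bar>c n\<bar> * r ^ n)"
    and V: "\<And>x y. 0 \<le> x \<Longrightarrow> x \<le> y \<Longrightarrow> V x \<le> V y" "\<And>x. 0 \<le> x \<Longrightarrow> 0 \<le> V x"
    and A: "0 \<le> A" and y: "0 \<le> y"
    and E: "\<And>t. 0 \<le> t \<Longrightarrow> norm (E (z * of_real (exp (- a * t)))) \<le> A * V (exp (- d * t) * y)"
    and N: "0 < N"
  shows "norm ((\<Sum>n. of_real (c n * exp (laplace \<kappa> (a * real n + \<nu>))) * z ^ n) - E z)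
    \<le> A * K * exp (K / \<nu>) * (exp 1 / N * V y + V (exp (- d / N) * y) / \<nu>)"
proof -
  let ?D = "V (exp (- d / N) * y)"
  let ?V = "\<lambda>t. V (exp (- d * t) * y)"
  let ?z = "\<lambda>t. z * of_real (exp (- a * t))"
  define l where "l = (\<lambda>n. laplace \<kappa> (a * real n + \<nu>))"
  define M where "M = K / \<nu>"
  define G where "G = (\<lambda>k z. \<Sum>n. of_real (c n * l n ^ k) * z ^ n :: complex)"
  have K0: "0 \<le> K" using \<kappa>(2)[of 1] by linarith
  have M0: "0 \<le> M" using K0 \<nu> by (simp add: M_def)
  have l: "\<bar>l n\<bar> \<le> M" for n
  proof -
    have pos: "0 < a * real n + \<nu>" using a \<nu> by (intro add_nonneg_pos) auto
    have "\<bar>l n\<bar> \<le> K / (a * real n + \<nu>)" unfolding l_def by (rule laplace_integrable(2)[OF \<kappa>(1) pos \<kappa>(2)])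
    also have "\<dots> \<le> M" unfolding M_def using K0 \<nu> a by (intro divide_left_mono mult_pos_pos pos) auto
    finally show ?thesis .
  qed
  have sumk: "summable (\<lambda>n. \<bar>c n * l n ^ k\<bar> * r ^ n)" if "0 \<le> r" for k r
  proof (rule summable_comparison_test'[OF summable_mult[OF sum[OF that], of "M ^ k"]])
    fix n :: nat
    have "\<bar>l n\<bar> ^ k \<le> M ^ k" by (intro power_mono l) auto
    then have "\<bar>c n\<bar> * r ^ n * \<bar>l n\<bar> ^ k \<le> \<bar>c n\<bar> * r ^ n * M ^ k" using that by (intro mult_left_mono) auto
    then show "norm (\<bar>c n * l n ^ k\<bar> * r ^ n) \<le> M ^ k * (\<bar>c n\<bar> * r ^ n)"
      using that by (simp add: abs_mult power_abs mult_ac)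
  qed
  have step: "((\<lambda>t. of_real (\<kappa> t * exp (- \<nu> * t)) * G k (u * of_real (exp (- a * t)))) has_integral G (Suc k) u) {0<..}" for k u
  proof -
    have eq: "(c n * l n ^ k) * l n = c n * l n ^ Suc k" for n by simp
    have ll: "laplace \<kappa> (a * real n + \<nu>) = l n" for n by (simp add: l_def)
    show ?thesis
      using multiplier_series_has_integral[OF less_imp_le[OF a] \<nu> \<kappa> sumk[OF norm_ge_zero], of k u, unfolded ll eq]
      unfolding G_def .
  qed
  have ptw: "norm (of_real (\<kappa> t * exp (- \<nu> * t)) * G k u) \<le> K * B * exp (- \<nu> * t)"
    if "0 < t" "norm (G k u) \<le> B" for t k u B
  proof -
    have "norm (of_real (\<kappa> t * exp (- \<nu> * t)) * G k u) = \<bar>\<kappa> t\<bar> * norm (G k u) * exp (- \<nu> * t)"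
      by (simp add: norm_mult mult_ac)
    also have "\<dots> \<le> K * B * exp (- \<nu> * t)"
      using \<kappa>(2)[OF that(1)] that(2) K0 by (intro mult_mono mult_right_mono) auto
    finally show ?thesis .
  qed
  have G: "norm (G k (?z t)) \<le> A * M ^ k * ?V t" if "0 \<le> t" for k t
    using that
  proof (induction k arbitrary: t)
    case 0
    then show ?case using E[of t] by (simp add: G_def E_def)
  next
    case (Suc k)
    have "norm (G (Suc k) (?z t)) \<le> K * (A * M ^ k * ?V t) * (1 / \<nu>)"
    proof (rule norm_has_integral_le[OF step has_integral_mult_right[OF has_integral_exp_pos[OF \<nu>]]])
      fix x :: real assume x: "x \<in> {0<..}"
      have "norm (G k (?z (t + x))) \<le> A * M ^ k * ?V (t + x)"
        using Suc.IH[of "t + x"] Suc.prems x by simp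
      also have "\<dots> \<le> A * M ^ k * ?V t"
        using A M0 x d y by (intro mult_left_mono V(1) mult_right_mono) auto
      finally show "norm (of_real (\<kappa> x * exp (- \<nu> * x)) * G k (?z t * of_real (exp (- a * x))))
          \<le> K * (A * M ^ k * ?V t) * exp (- \<nu> * x)"
        using x by (intro ptw) (auto simp: distrib_left exp_add mult.assoc exp_diff exp_minus divide_inverse)
    qed
    then show ?case by (simp add: M_def mult_ac)
  qed
  define W where "W = exp 1 / N * V y + ?D / \<nu>"
  have W0: "0 \<le> W" using V(2)[OF y] V(2)[of "exp (- d / N) * y"] y N \<nu> by (simp add: W_def)
  have G1: "norm (G (Suc k) z) \<le> A * K * W * M ^ k" for k
  proof -
    have "norm (G (Suc k) z) \<le> K * (A * M ^ k) * (exp 1 * V y * (1 / N) + ?D * (1 / \<nu>))"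
    proof (rule norm_has_integral_le[OF step])
      show "((\<lambda>t. K * (A * M ^ k) * (exp 1 * V y * exp (- N * t) + ?D * exp (- \<nu> * t)))
         has_integral K * (A * M ^ k) * (exp 1 * V y * (1 / N) + ?D * (1 / \<nu>))) {0<..}"
        by (intro has_integral_mult_right has_integral_add has_integral_exp_pos N \<nu>)
      fix t :: real assume t: "t \<in> {0<..}"
      have "exp (- \<nu> * t) * ?V t \<le> exp 1 * V y * exp (- N * t) + ?D * exp (- \<nu> * t)"
      proof (cases "t \<le> 1 / N")
        case True
        then have "N * t \<le> 1" using N by (simp add: field_simps)
        then have "1 \<le> exp (1 - N * t)" by simp
        moreover have "exp (- \<nu> * t) \<le> 1" using \<nu> t by simp
        ultimately have "exp (- \<nu> * t) \<le> exp (1 - N * t)" by linarith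
        then have 1: "exp (- \<nu> * t) \<le> exp 1 * exp (- N * t)" by (simp add: exp_add[symmetric])
        have "?V t \<le> V y" using d t y by (intro V(1)) (auto simp: mult_left_le_one_le)
        then have "exp (- \<nu> * t) * ?V t \<le> exp 1 * exp (- N * t) * V y"
          using 1 V(2) y by (intro mult_mono) auto
        moreover have "0 \<le> ?D * exp (- \<nu> * t)" using V(2) y by simp
        ultimately show ?thesis by (simp add: mult_ac)
      next
        case False
        then have "d / N \<le> d * t" using d N by (simp add: field_simps)
        then have "?V t \<le> ?D" using y by (intro V(1) mult_right_mono) auto
        then have "exp (- \<nu> * t) * ?V t \<le> ?D * exp (- \<nu> * t)"
          by (simp add: mult.commute)
        moreover have "0 \<le> exp 1 * V y * exp (- N * t)" using V(2) y by simp
        ultimately show ?thesis by linarith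
      qed
      then have "K * (A * M ^ k) * (exp (- \<nu> * t) * ?V t) \<le> K * (A * M ^ k) * (exp 1 * V y * exp (- N * t) + ?D * exp (- \<nu> * t))"
        using K0 A M0 by (intro mult_left_mono) auto
      moreover have "norm (of_real (\<kappa> t * exp (- \<nu> * t)) * G k (?z t)) \<le> K * (A * M ^ k * ?V t) * exp (- \<nu> * t)"
        using t by (intro ptw G) auto
      ultimately show "norm (of_real (\<kappa> t * exp (- \<nu> * t)) * G k (?z t))
         \<le> K * (A * M ^ k) * (exp 1 * V y * exp (- N * t) + ?D * exp (- \<nu> * t))"
        by (simp add: mult_ac)
    qed
    then show ?thesis by (simp add: W_def mult_ac)
  qed
  have sumG: "(\<lambda>k. G k z / of_real (fact k)) sums (\<Sum>n. of_real (c n * exp (l n)) * z ^ n)"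
    unfolding G_def by (rule exp_multiplier_sums[OF sum l]) simp
  have tail: "(\<lambda>k. G (Suc k) z / of_real (fact (Suc k))) sums ((\<Sum>n. of_real (c n * exp (l n)) * z ^ n) - G 0 z / of_real (fact 0))"
    using sums_Suc_iff[of "\<lambda>k. G k z / of_real (fact k)"] sumG by simp
  have ms: "(\<lambda>k. A * K * W * (M ^ k / fact k)) sums (A * K * W * exp M)"
    using sums_mult[OF exp_converges[of M], of "A * K * W"] by (simp add: divide_inverse mult.commute)
  have tail_le: "norm (G (Suc k) z / of_real (fact (Suc k))) \<le> A * K * W * (M ^ k / fact k)" for k
  proof -
    have nn: "0 \<le> A * K * W * M ^ k" using A K0 W0 M0 by simp
    have "norm (G (Suc k) z / of_real (fact (Suc k))) = norm (G (Suc k) z) / fact (Suc k)"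
      by (simp add: norm_divide del: fact_Suc)
    also have "\<dots> \<le> (A * K * W * M ^ k) / fact (Suc k)"
      by (rule divide_right_mono[OF G1]) simp
    also have "\<dots> \<le> (A * K * W * M ^ k) / fact k"
      by (rule divide_left_mono[OF fact_mono nn]) simp_all
    finally have "norm (G (Suc k) z / of_real (fact (Suc k))) \<le> (A * K * W * M ^ k) / fact k" .
    then show ?thesis by simp
  qed
  have "norm ((\<Sum>n. of_real (c n * exp (l n)) * z ^ n) - G 0 z / of_real (fact 0)) \<le> A * K * W * exp M"
    by (rule norm_sums_le[OF tail ms tail_le])
  then show ?thesis by (simp add: l_def G_def E_def W_def M_def mult_ac)
qed

section \<open>Comparison of the coefficients\<close>

lemma laplace_scale:
  assumes c: "0 < c" and s: "0 < s" and f: "continuous_on {0<..} f" "\<And>t. 0 < t \<Longrightarrow> \<bar>f t\<bar> \<le> K"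
  shows "laplace f (c * s) = laplace (\<lambda>t. f (t / c) / c) s"
proof -
  let ?h = "\<lambda>t. exp (- (c * s) * t) * f t"
  have cs: "0 < c * s" using c s by simp
  have h: "?h absolutely_integrable_on {0<..}"
    by (rule absolutely_integrable_exp_bound(1)[where s = "c * s" and K = K])
      (use f cs in \<open>auto intro!: continuous_intros simp: abs_mult mult.commute mult_right_mono\<close>)
  have img: "(\<lambda>t. t / c) ` {0<..} = {0<..}"
    using c by (auto simp: image_iff intro!: bexI[of _ "x * c" for x])
  have "(\<lambda>t. \<bar>1 / c\<bar> * ?h (t / c)) absolutely_integrable_on {0<..} \<and>
      integral {0<..} (\<lambda>t. \<bar>1 / c\<bar> * ?h (t / c)) = laplace f (c * s)"
    by (subst has_absolute_integral_change_of_variables_1'[where g = "\<lambda>t. t / c" and g' = "\<lambda>_. 1 / c"])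
      (use c h in \<open>auto intro!: derivative_eq_intros simp: img laplace_def inj_on_def\<close>)
  then have "laplace f (c * s) = integral {0<..} (\<lambda>t. \<bar>1 / c\<bar> * ?h (t / c))" by simp
  also have "\<dots> = laplace (\<lambda>t. f (t / c) / c) s"
    unfolding laplace_def using c by (intro integral_cong) (simp add: abs_of_pos)
  finally show ?thesis .
qed

definition ratio_density :: "real \<Rightarrow> real \<Rightarrow> real" where
  "ratio_density \<alpha> t = \<alpha> * binet_density t - binet_density (t / \<alpha>) / \<alpha>"

lemma continuous_on_binet_density_scaled:
  "0 < \<alpha> \<Longrightarrow> continuous_on {0<..} (\<lambda>t. binet_density (t / \<alpha>) / \<alpha>)"
  by (intro continuous_intros continuous_on_compose2[OF continuous_on_binet_density]) auto

lemma continuous_on_ratio_density: "0 < \<alpha> \<Longrightarrow> continuous_on {0<..} (ratio_density \<alpha>)"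
  unfolding ratio_density_def[abs_def]
  by (intro continuous_on_diff continuous_on_binet_density_scaled continuous_on_mult
      continuous_on_const continuous_on_binet_density)

lemma ratio_density_bound:
  assumes "0 < \<alpha>" "0 < t" shows "\<bar>ratio_density \<alpha> t\<bar> \<le> \<alpha> + 1 / \<alpha>"
proof -
  have "\<bar>ratio_density \<alpha> t\<bar> \<le> \<bar>\<alpha> * binet_density t\<bar> + \<bar>binet_density (t / \<alpha>) / \<alpha>\<bar>"
    unfolding ratio_density_def by (rule abs_triangle_ineq4)
  also have "\<dots> \<le> \<alpha> * 1 + 1 / \<alpha>"
    using assms binet_density_bounds(1)[of t] binet_density_bounds(1)[of "t / \<alpha>"]
    by (intro add_mono) (auto simp: abs_mult abs_divide divide_right_mono)
  finally show ?thesis by simp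
qed

lemma laplace_ratio_density:
  assumes \<alpha>: "0 < \<alpha>" and s: "0 < s"
  shows "laplace (ratio_density \<alpha>) s = \<alpha> * laplace binet_density s - laplace binet_density (\<alpha> * s)"
proof -
  have b: "\<bar>binet_density (t / \<alpha>) / \<alpha>\<bar> \<le> 1 / \<alpha>" if "0 < t" for t
    using binet_density_bounds(1)[of "t / \<alpha>"] \<alpha> that by (simp add: abs_divide divide_right_mono)
  have "laplace (ratio_density \<alpha>) s = integral {0<..} (\<lambda>t. \<alpha> * (exp (- s * t) * binet_density t) - exp (- s * t) * (binet_density (t / \<alpha>) / \<alpha>))"
    unfolding laplace_def ratio_density_def by (intro integral_cong) (simp add: algebra_simps)
  also have "\<dots> = \<alpha> * laplace binet_density s - laplace (\<lambda>t. binet_density (t / \<alpha>) / \<alpha>) s"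
    unfolding laplace_def
    by (subst integral_diff)
      (use laplace_integrable(1)[OF continuous_on_binet_density s binet_density_bounds(1)]
          laplace_integrable(1)[OF continuous_on_binet_density_scaled[OF \<alpha>] s b] in
        \<open>auto intro!: integrable_on_mult_right\<close>)
  also have "laplace (\<lambda>t. binet_density (t / \<alpha>) / \<alpha>) s = laplace binet_density (\<alpha> * s)"
    by (rule laplace_scale[OF \<alpha> s continuous_on_binet_density binet_density_bounds(1), symmetric])
  finally show ?thesis .
qed

text \<open>
  Binet's formula at \<open>s = a * n + \<nu>\<close> and at \<open>\<alpha> * s\<close>: the terms \<open>\<alpha> * s * ln s\<close> and \<open>\<alpha> * s\<close> cancel, and
  \<open>\<alpha> * s * ln \<alpha>\<close>, which is affine in \<open>n\<close>, remains.
\<close>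

lemma inverse_Gamma_powr_eq:
  assumes a: "0 < a" and \<alpha>: "0 < \<alpha>" and \<nu>: "0 < \<nu>"
  shows "1 / Gamma (a * real n + (\<nu> + 1/2)) powr \<alpha>
    = exp ((1 - \<alpha>) * ln (2 * pi) / 2 + \<alpha> * \<nu> * ln \<alpha>) * (exp (a * \<alpha> * ln \<alpha>) ^ n
       * (rGamma (a * \<alpha> * real n + (\<alpha> * \<nu> + 1/2)) * exp (laplace (ratio_density \<alpha>) (a * real n + \<nu>))))"
proof -
  define s where "s = a * real n + \<nu>"
  have s: "0 < s" unfolding s_def using a \<nu> by (intro add_nonneg_pos) auto
  have as: "0 < \<alpha> * s" using s \<alpha> by simp
  have g1: "Gamma (s + 1/2) = exp (ln_Gamma (s + 1/2))"
    using s Gamma_real_pos[of "s + 1/2"] by (simp add: ln_Gamma_real_pos)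
  have g2: "rGamma (\<alpha> * s + 1/2) = exp (- ln_Gamma (\<alpha> * s + 1/2))"
    using as Gamma_real_pos[of "\<alpha> * s + 1/2"] by (simp add: ln_Gamma_real_pos rGamma_inverse_Gamma exp_minus)
  have "1 / Gamma (s + 1/2) powr \<alpha> = exp (- \<alpha> * ln_Gamma (s + 1/2))"
    unfolding g1 by (simp only: exp_powr_real exp_minus[symmetric] inverse_eq_divide[symmetric] mult_minus_left mult.commute)
  also have "- \<alpha> * ln_Gamma (s + 1/2) = ((1 - \<alpha>) * ln (2 * pi) / 2 + \<alpha> * \<nu> * ln \<alpha>) + (real n * (a * \<alpha> * ln \<alpha>)
     + (- ln_Gamma (\<alpha> * s + 1/2) + laplace (ratio_density \<alpha>) s))"
  proof -
    have "ln (\<alpha> * s) = ln \<alpha> + ln s" using \<alpha> s by (rule ln_mult_pos)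
    moreover have "\<alpha> * s * ln \<alpha> = \<alpha> * \<nu> * ln \<alpha> + real n * (a * \<alpha> * ln \<alpha>)"
      by (simp add: s_def algebra_simps)
    ultimately show ?thesis
      unfolding ln_Gamma_binet_half[OF s] ln_Gamma_binet_half[OF as] laplace_ratio_density[OF \<alpha> s]
      by (simp add: algebra_simps add_divide_distrib diff_divide_distrib)
  qed
  also have "exp \<dots> = exp ((1 - \<alpha>) * ln (2 * pi) / 2 + \<alpha> * \<nu> * ln \<alpha>) * (exp (a * \<alpha> * ln \<alpha>) ^ n
       * (rGamma (\<alpha> * s + 1/2) * exp (laplace (ratio_density \<alpha>) s)))"
    unfolding g2 by (simp only: exp_add exp_of_nat_mult)
  finally show ?thesis by (simp add: s_def algebra_simps)
qed

section \<open>Growth of the Mittag-Leffler function in a sector\<close>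

text \<open>
  Asymptotic to a constant multiple of \<open>exp y * y powr (- P)\<close>, which is the size of the main term of the
  Mittag-Leffler function with second parameter \<open>P + 1\<close>. The logarithmic derivative is \<open>y / (P + y)\<close>, so that,
  unlike this simpler expression, the majorant increases from \<open>y = 0\<close> on.
\<close>

definition majorant :: "real \<Rightarrow> real \<Rightarrow> real" where
  "majorant P y = exp y * (1 + y / P) powr (- P)"

lemma majorant_mono:
  assumes P: "0 < P" and xy: "0 \<le> x" "x \<le> y"
  shows "majorant P x \<le> majorant P y"
proof -
  let ?r = "(exp ((y - x) / P) * (1 + x / P))"
  let ?p = "\<lambda>x. (1 + x / P) powr (- P)"
  have "(1 + y / P) \<le> exp ((y - x) / P) * (1 + x / P)"
  proof -
    have "1 + y / P = (1 + x / P) + (y - x) / P" by (simp add: diff_divide_distrib)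
    also have "\<dots> \<le> (1 + x / P) + (y - x) / P * (1 + x / P)"
      using mult_left_mono[of 1 "1 + x / P" "(y - x) / P"] P xy by simp
    also have "\<dots> = (1 + (y - x) / P) * (1 + x / P)" by (simp add: algebra_simps)
    also have "\<dots> \<le> exp ((y - x) / P) * (1 + x / P)"
      using P xy by (intro mult_right_mono exp_ge_add_one_self) auto
    finally show ?thesis .
  qed
  then have "?r powr (- P) \<le> ?p y"
    using P xy by (intro powr_mono2') (auto intro!: add_pos_nonneg)
  moreover have "?r powr (- P) = exp (x - y) * ?p x"
    using P xy by (subst powr_mult) (auto simp: powr_def field_simps)
  ultimately have "exp y * (exp (x - y) * ?p x) \<le> exp y * ?p y"
    by (intro mult_left_mono) auto
  then show ?thesis by (simp add: majorant_def mult.assoc[symmetric] exp_add[symmetric])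
qed

lemma majorant_nonneg: "0 \<le> majorant P y"
  by (simp add: majorant_def)

lemma majorant_ge_1: "0 < P \<Longrightarrow> 0 \<le> y \<Longrightarrow> 1 \<le> majorant P y"
  using majorant_mono[of P 0 y] by (simp add: majorant_def)

lemma majorant_scaled_ratio:
  assumes P: "0 < P" and c: "0 < c" "c < 1"
  shows "((\<lambda>y. majorant P (c * y) / majorant P y) \<longlongrightarrow> 0) at_top"
  unfolding majorant_def using assms by real_asymp

text \<open>
  In a sector on which \<open>cos (Im v)\<close> is bounded below by a positive number, \<open>Re (exp v)\<close> is comparable to
  \<open>exp (Re v)\<close>; therefore the majorant and the modulus of the pole term are comparable, as this lemma and the
  next one make precise.
\<close>

lemma pole_term_le_majorant:
  assumes \<beta>: "0 < \<beta>" and P: "0 < P" and v: "0 \<le> Re v" "0 \<le> cos (Im v)"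
  shows "norm (pole_term \<beta> (P + 1) v) \<le> (1 + 1 / P) powr P / \<beta> * majorant P (Re (exp v))"
proof -
  let ?q = "(1 + 1 / P) powr P"
  define s where "s = Re v"
  define y where "y = exp s * cos (Im v)"
  have y: "0 \<le> y" "y \<le> exp s" "Re (exp v) = y"
    using v by (auto simp: y_def s_def Re_exp mult_left_le)
  have "1 + y / P \<le> (1 + 1 / P) * exp s"
  proof -
    have "1 \<le> exp s" using v by (simp add: s_def)
    moreover have "y / P \<le> exp s / P" using y P by (intro divide_right_mono) auto
    moreover have "(1 + 1 / P) * exp s = exp s + exp s / P" by (simp add: distrib_right)
    ultimately show ?thesis by linarith
  qed
  then have "((1 + 1 / P) * exp s) powr (- P) \<le> (1 + y / P) powr (- P)"
    using P y by (intro powr_mono2') (auto intro!: add_pos_nonneg)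
  also have "((1 + 1 / P) * exp s) powr (- P) = (1 + 1 / P) powr (- P) * exp (- P * s)"
    using P by (subst powr_mult) (auto simp: exp_powr_real mult.commute)
  finally have "?q * ((1 + 1 / P) powr (- P) * exp (- P * s)) \<le> ?q * (1 + y / P) powr (- P)"
    by (intro mult_left_mono) auto
  moreover have "?q * (1 + 1 / P) powr (- P) = 1"
  proof -
    have "0 < 1 + 1 / P" using P by (simp add: add_pos_pos)
    then show ?thesis by (simp only: powr_add[symmetric]) simp
  qed
  ultimately have le: "exp (- P * s) \<le> ?q * (1 + y / P) powr (- P)"
    by (simp add: mult.assoc[symmetric])
  have "norm (pole_term \<beta> (P + 1) v) = exp (- P * s) * exp y / \<beta>"
    unfolding norm_pole_term[OF \<beta>] by (simp add: s_def[symmetric] y_def exp_add[symmetric])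
  also have "\<dots> \<le> ?q * (1 + y / P) powr (- P) * exp y / \<beta>"
    using le \<beta> by (intro divide_right_mono mult_right_mono) auto
  finally show ?thesis by (simp add: y(3) majorant_def mult_ac)
qed

lemma majorant_le_pole_term:
  assumes \<beta>: "0 < \<beta>" and P: "0 < P" and c: "0 < c" "c \<le> cos (Im v)"
  shows "majorant P (Re (exp v)) \<le> \<beta> * (P / c) powr P * norm (pole_term \<beta> (P + 1) v)"
proof -
  define s where "s = Re v"
  define y where "y = exp s * cos (Im v)"
  have y: "Re (exp v) = y" by (simp add: y_def s_def Re_exp)
  have "exp s * c \<le> y" unfolding y_def using c by (intro mult_left_mono) auto
  then have "exp s * c / P \<le> 1 + y / P"
    using P divide_right_mono[of "exp s * c" y P] by linarith
  then have "(1 + y / P) powr (- P) \<le> (exp s * c / P) powr (- P)"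
    using P c by (intro powr_mono2') auto
  also have "\<dots> = (P / c) powr P * exp (- P * s)"
    using P c by (simp add: powr_def ln_div ln_mult exp_add[symmetric] algebra_simps)
  finally have le: "(1 + y / P) powr (- P) \<le> (P / c) powr P * exp (- P * s)" .
  have n: "norm (pole_term \<beta> (P + 1) v) = exp (- P * s) * exp y / \<beta>"
    unfolding norm_pole_term[OF \<beta>] by (simp add: s_def[symmetric] y_def exp_add[symmetric])
  have "majorant P y \<le> exp y * ((P / c) powr P * exp (- P * s))"
    unfolding majorant_def using le by (intro mult_left_mono) auto
  also have "\<dots> = \<beta> * (P / c) powr P * norm (pole_term \<beta> (P + 1) v)"
    unfolding n using \<beta> by simp
  finally show ?thesis by (simp add: y)
qed

lemma cos_ge_in_sector:
  assumes \<beta>: "0 < \<beta>" and \<Theta>: "0 \<le> \<Theta>" "\<Theta> < \<beta> * pi / 2" and w: "\<bar>Im w\<bar> \<le> \<Theta>"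
  shows "0 < cos (\<Theta> / \<beta>)" "cos (\<Theta> / \<beta>) \<le> cos (Im (w / of_real \<beta>))"
proof -
  have c1: "0 \<le> \<Theta> / \<beta>" "\<Theta> / \<beta> < pi / 2" using \<Theta> \<beta> by (auto simp: field_simps)
  show "0 < cos (\<Theta> / \<beta>)" by (rule cos_gt_zero_pi) (use c1 pi_gt_zero in linarith)+
  have "\<bar>Im w / \<beta>\<bar> \<le> \<Theta> / \<beta>" using w \<beta> by (simp add: divide_right_mono)
  then have "cos (\<Theta> / \<beta>) \<le> cos \<bar>Im w / \<beta>\<bar>"
    by (intro cos_monotone_0_pi_le) (use c1 in linarith)+
  then show "cos (\<Theta> / \<beta>) \<le> cos (Im (w / of_real \<beta>))" by (simp only: cos_abs_real Im_divide_of_real)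
qed

text \<open>
  For large \<open>Re w\<close> this is the asymptotics of the Mittag-Leffler function; on the rest of the sector the function
  is bounded, and the majorant is at least \<open>1\<close>.
\<close>

lemma mittag_leffler_majorant:
  assumes \<beta>: "0 < \<beta>" and P: "0 < P" and \<Theta>: "0 \<le> \<Theta>" "\<Theta> < pi" "\<Theta> < \<beta> * pi / 2"
  obtains A where "0 \<le> A" "\<And>w. \<bar>Im w\<bar> \<le> \<Theta> \<Longrightarrow> norm (F \<beta> (P + 1) 1 (exp w)) \<le> A * majorant P (Re (exp (w / of_real \<beta>)))"
proof -
  let ?G = "\<lambda>n. Gamma (\<beta> * real n + (P + 1))"
  have P1: "0 < P + 1" using P by simp
  obtain \<rho>0 where \<rho>0: "\<And>w. \<rho>0 \<le> Re w \<Longrightarrow> \<bar>Im w\<bar> \<le> \<Theta> \<Longrightarrow>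
     norm (F \<beta> (P + 1) 1 (exp w) - pole_term \<beta> (P + 1) (w / of_real \<beta>)) \<le> 1 * norm (pole_term \<beta> (P + 1) (w / of_real \<beta>))"
    using mittag_leffler_asymptotics[OF \<beta> P1 \<Theta>, of 1] by auto
  define r where "r = exp (max \<rho>0 0)"
  define A1 where "A1 = (\<Sum>n. r ^ n / ?G n powr 1)"
  define A2 where "A2 = 2 * ((1 + 1 / P) powr P / \<beta>)"
  have sm: "summable (\<lambda>n. r ^ n / ?G n powr 1)"
    by (rule summable_F_norm) (use \<beta> P in \<open>auto simp: r_def\<close>)
  have A1: "0 \<le> A1" unfolding A1_def by (rule suminf_nonneg[OF sm]) (simp add: r_def)
  have A2: "0 \<le> A2" using \<beta> by (simp add: A2_def)
  show ?thesis
  proof (rule that[of "A1 + A2"])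
    fix w :: complex assume w: "\<bar>Im w\<bar> \<le> \<Theta>"
    let ?v = "w / of_real \<beta>"
  let ?M = "majorant P (Re (exp ?v))"
    note cs = cos_ge_in_sector[OF \<beta> \<Theta>(1,3) w]
    have y: "0 \<le> Re (exp ?v)" unfolding Re_exp using cs by (intro mult_nonneg_nonneg) auto
    show "norm (F \<beta> (P + 1) 1 (exp w)) \<le> (A1 + A2) * ?M"
    proof (cases "max \<rho>0 0 \<le> Re w")
      case True
      have "norm (F \<beta> (P + 1) 1 (exp w)) \<le> 2 * norm (pole_term \<beta> (P + 1) ?v)"
        using \<rho>0[OF _ w] True norm_triangle_ineq[of "F \<beta> (P + 1) 1 (exp w) - pole_term \<beta> (P + 1) ?v" "pole_term \<beta> (P + 1) ?v"]
        by simp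
      also have "\<dots> \<le> 2 * ((1 + 1 / P) powr P / \<beta> * ?M)"
        using True \<beta> cs by (intro mult_left_mono pole_term_le_majorant P) (auto simp: Re_divide_of_real)
      also have "\<dots> = A2 * ?M" by (simp add: A2_def)
      also have "\<dots> \<le> (A1 + A2) * ?M"
        using A1 by (intro mult_right_mono majorant_nonneg) simp
      finally show ?thesis .
    next
      case False
      have "norm (F \<beta> (P + 1) 1 (exp w)) \<le> A1"
        unfolding A1_def
      proof (rule norm_sums_le[OF F_sums summable_sums[OF sm]])
        fix n
        have "norm (exp w) ^ n \<le> r ^ n" using False by (intro power_mono) (auto simp: r_def norm_exp_eq_Re)
        then show "norm (exp w ^ n / of_real (?G n powr 1)) \<le> r ^ n / ?G n powr 1"
          unfolding norm_divide norm_power norm_of_real by (simp add: divide_right_mono)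
      qed (use \<beta> P in auto)
      also have "A1 \<le> (A1 + A2) * 1" using A2 by simp
      also have "\<dots> \<le> (A1 + A2) * ?M"
        using A1 A2 y P by (intro mult_left_mono majorant_ge_1) auto
      finally show ?thesis .
    qed
  qed (use A1 A2 in simp)
qed

section \<open>The asymptotics\<close>

text \<open>
  The asymptotic expression in the variable \<open>w = ln z\<close>, in which the powers of \<open>z\<close> are entire functions.
\<close>

definition leading_term :: "real \<Rightarrow> real \<Rightarrow> real \<Rightarrow> complex \<Rightarrow> complex" where
  "leading_term a b \<alpha> w = of_real (1 / (a * sqrt \<alpha>) * (2 * pi) powr ((1 - \<alpha>) / 2))
     * exp (of_real ((\<alpha> - 2 * b * \<alpha> + 1) / (2 * a * \<alpha>)) * w + of_real \<alpha> * exp (w / of_real (a * \<alpha>)))"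

lemma leading_term_nonzero: "0 < a \<Longrightarrow> 0 < \<alpha> \<Longrightarrow> leading_term a b \<alpha> w \<noteq> 0"
  by (simp add: leading_term_def)

text \<open>
  The shift of \<open>w\<close> accounts for \<open>Z = \<alpha> powr (a * \<alpha>) * z\<close>. It turns \<open>exp v\<close> into \<open>\<alpha> * exp (w / (a * \<alpha>))\<close>, and
  the powers of \<open>\<alpha>\<close> in front combine to \<open>sqrt \<alpha>\<close>.
\<close>

lemma leading_term_eq_pole_term:
  assumes a: "0 < a" and \<alpha>: "0 < \<alpha>"
  shows "of_real (exp ((1 - \<alpha>) * ln (2 * pi) / 2 + \<alpha> * \<nu> * ln \<alpha>))
       * pole_term (a * \<alpha>) (\<alpha> * \<nu> - 1/2 + 1) ((w + of_real (a * \<alpha> * ln \<alpha>)) / of_real (a * \<alpha>)) = leading_term a (\<nu> + 1/2) \<alpha> w"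
proof -
  define \<beta> where "\<beta> = a * \<alpha>"
  have \<beta>: "0 < \<beta>" using a \<alpha> by (simp add: \<beta>_def)
  define P where "P = \<alpha> * \<nu> - 1/2"
  let ?e = "of_real \<alpha> * exp (w / of_real \<beta>)"
  let ?v = "(w + of_real (\<beta> * ln \<alpha>)) / of_real \<beta>"
  have v: "?v = w / of_real \<beta> + of_real (ln \<alpha>)" using \<beta> by (simp add: add_divide_distrib)
  have ev: "exp ?v = ?e"
    unfolding v exp_add exp_of_real using \<alpha> by simp
  have sq: "exp (ln \<alpha> / 2) = sqrt \<alpha>"
    using \<alpha> by (simp add: powr_half_sqrt[symmetric] powr_def)
  have "of_real (exp ((1 - \<alpha>) * ln (2 * pi) / 2 + \<alpha> * \<nu> * ln \<alpha>)) * pole_term \<beta> (P + 1) ?v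
     = of_real (exp ((1 - \<alpha>) * ln (2 * pi) / 2) * exp (\<alpha> * \<nu> * ln \<alpha>)) * exp (?e - of_real P * ?v) / of_real \<beta>"
  proof -
    have "pole_term \<beta> (P + 1) ?v = exp (?e - of_real P * ?v) / of_real \<beta>"
      unfolding pole_term_def hankel_kernel_def ev by simp
    then show ?thesis by (simp only: exp_add times_divide_eq_right)
  qed
  also have "exp (?e - of_real P * ?v)
     = of_real (exp (- P * ln \<alpha>)) * exp (of_real (- P / \<beta>) * w + ?e)"
    unfolding v exp_of_real[symmetric] exp_add[symmetric] by (intro arg_cong[of _ _ exp]) (simp add: algebra_simps)
  also have "of_real (exp ((1 - \<alpha>) * ln (2 * pi) / 2) * exp (\<alpha> * \<nu> * ln \<alpha>)) *
       (of_real (exp (- P * ln \<alpha>)) * exp (of_real (- P / \<beta>) * w + ?e)) / of_real \<beta>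
     = of_real (exp ((1 - \<alpha>) * ln (2 * pi) / 2) * (exp (\<alpha> * \<nu> * ln \<alpha>) * exp (- P * ln \<alpha>)) / \<beta>)
        * exp (of_real (- P / \<beta>) * w + ?e)"
    by simp
  also have "exp (\<alpha> * \<nu> * ln \<alpha>) * exp (- P * ln \<alpha>) = sqrt \<alpha>"
    unfolding exp_add[symmetric] sq[symmetric] by (intro arg_cong[of _ _ exp]) (simp add: P_def algebra_simps)
  also have "exp ((1 - \<alpha>) * ln (2 * pi) / 2) = (2 * pi) powr ((1 - \<alpha>) / 2)"
    by (simp add: powr_def)
  also have "(2 * pi) powr ((1 - \<alpha>) / 2) * sqrt \<alpha> / \<beta> = 1 / (a * sqrt \<alpha>) * (2 * pi) powr ((1 - \<alpha>) / 2)"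
  proof -
    have "r / (a * (r * r)) = 1 / (a * r)" if "0 < r" for r :: real
      using that a by (simp add: field_simps)
    from this[of "sqrt \<alpha>"] have r: "sqrt \<alpha> / (a * \<alpha>) = 1 / (a * sqrt \<alpha>)" using \<alpha> by simp
    have "(2 * pi) powr ((1 - \<alpha>) / 2) * sqrt \<alpha> / \<beta> = sqrt \<alpha> / (a * \<alpha>) * (2 * pi) powr ((1 - \<alpha>) / 2)"
      by (simp add: \<beta>_def)
    then show ?thesis unfolding r .
  qed
  also have "- P / \<beta> = (\<alpha> - 2 * (\<nu> + 1/2) * \<alpha> + 1) / (2 * a * \<alpha>)"
    using a \<alpha> by (simp add: P_def \<beta>_def field_simps)
  finally show ?thesis unfolding leading_term_def \<beta>_def P_def by (simp only: mult.assoc)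
qed

text \<open>
  The hypothesis on \<open>\<nu>\<close> makes the exponent \<open>P\<close> of the majorant positive. Half of the relative error \<open>e\<close> is spent
  on the approximation of the Mittag-Leffler function by its pole term, and a quarter on each of the two summands in
  \<open>exp_multiplier_perturbation\<close>: \<open>N\<close> is chosen for the first, and \<open>y0\<close>, depending on \<open>N\<close>, for the second.
\<close>

lemma F_asymptotics_large_shift:
  assumes a: "0 < a" and \<alpha>: "0 < \<alpha>" and \<nu>: "1/2 < \<alpha> * \<nu>"
    and \<Theta>: "0 \<le> \<Theta>" "\<Theta> < pi" "\<Theta> < a * \<alpha> * pi / 2" and e: "0 < e"
  obtains \<rho> where "\<And>w. \<rho> \<le> Re w \<Longrightarrow> \<bar>Im w\<bar> \<le> \<Theta> \<Longrightarrow>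
     norm (F a (\<nu> + 1/2) \<alpha> (exp w) - leading_term a (\<nu> + 1/2) \<alpha> w) \<le> e * norm (leading_term a (\<nu> + 1/2) \<alpha> w)"
proof -
  let ?l = "\<lambda>n. laplace (ratio_density \<alpha>) (a * real n + \<nu>)"
  define \<beta> where "\<beta> = a * \<alpha>"
  define P where "P = \<alpha> * \<nu> - 1/2"
  have \<beta>: "0 < \<beta>" using a \<alpha> by (simp add: \<beta>_def)
  have P: "0 < P" "0 < P + 1" using \<nu> by (auto simp: P_def)
  have \<nu>0: "0 < \<nu>" using \<nu> \<alpha> by (metis zero_less_mult_pos half_gt_zero_iff less_trans zero_less_one)
  have \<Theta>': "\<Theta> < \<beta> * pi / 2" using \<Theta> by (simp add: \<beta>_def)
  define K where "K = \<alpha> + 1 / \<alpha>"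
  define c where "c = (\<lambda>n. rGamma (\<beta> * real n + (P + 1)))"
  define C0 where "C0 = exp ((1 - \<alpha>) * ln (2 * pi) / 2 + \<alpha> * \<nu> * ln \<alpha>)"
  have C0: "0 < C0" by (simp add: C0_def)
  have K0: "0 < K" using \<alpha> by (simp add: K_def add_pos_pos)
  define cc where "cc = cos (\<Theta> / \<beta>)"
  have cc: "0 < cc" unfolding cc_def using cos_ge_in_sector(1)[OF \<beta> \<Theta>(1) \<Theta>', of 0] \<Theta>(1) by simp
  define B where "B = \<beta> * (P / cc) powr P"
  have B: "0 < B" using \<beta> P cc by (simp add: B_def)
  obtain A where A: "0 \<le> A" "\<And>w. \<bar>Im w\<bar> \<le> \<Theta> \<Longrightarrow> norm (F \<beta> (P + 1) 1 (exp w)) \<le> A * majorant P (Re (exp (w / of_real \<beta>)))"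
    using mittag_leffler_majorant[OF \<beta> P(1) \<Theta>(1,2) \<Theta>'] by blast
  obtain \<rho>0 where \<rho>0: "\<And>w. \<rho>0 \<le> Re w \<Longrightarrow> \<bar>Im w\<bar> \<le> \<Theta> \<Longrightarrow>
     norm (F \<beta> (P + 1) 1 (exp w) - pole_term \<beta> (P + 1) (w / of_real \<beta>)) \<le> (e / 2) * norm (pole_term \<beta> (P + 1) (w / of_real \<beta>))"
    using mittag_leffler_asymptotics[OF \<beta> P(2) \<Theta>(1,2) \<Theta>', of "e / 2"] e by auto
  define D where "D = A * K * exp (K / \<nu>)"
  have D: "0 \<le> D" using A K0 by (simp add: D_def)
  \<comment> \<open>with \<open>D + 1\<close> instead of \<open>D\<close>, which may be zero\<close>
  define N where "N = exp 1 * ((D + 1) * (4 * B / e))"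
  have N: "0 < N" using D B e by (simp add: N_def)
  have DN: "D * (exp 1 / N) \<le> e / (4 * B)"
  proof -
    have "exp 1 / N = 1 / ((D + 1) * (4 * B / e))" by (simp add: N_def)
    then have "D * (exp 1 / N) = D / (D + 1) * (e / (4 * B))" by simp
    also have "\<dots> \<le> 1 * (e / (4 * B))" using D B e by (intro mult_right_mono) auto
    finally show ?thesis by simp
  qed
  define q where "q = exp (- (1 / \<alpha>) / N)"
  have q: "0 < q" "q < 1" using \<alpha> N by (auto simp: q_def)
  have "((\<lambda>y. D / \<nu> * (majorant P (q * y) / majorant P y)) \<longlongrightarrow> D / \<nu> * 0) at_top"
    by (intro tendsto_mult tendsto_const majorant_scaled_ratio P q)
  then have "\<forall>\<^sub>F y in at_top. D / \<nu> * (majorant P (q * y) / majorant P y) < e / (4 * B)"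
    by (rule order_tendstoD) (use e B in simp)
  then obtain y0 where y0: "\<And>y. y0 \<le> y \<Longrightarrow> D / \<nu> * (majorant P (q * y) / majorant P y) < e / (4 * B)"
    by (auto simp: eventually_at_top_linorder)
  have c_pos: "0 \<le> c n" for n
  proof -
    have "0 < \<beta> * real n + (P + 1)" using \<beta> P by (intro add_nonneg_pos) auto
    then have "0 < Gamma (\<beta> * real n + (P + 1))" by (rule Gamma_real_pos)
    then show ?thesis by (simp add: c_def rGamma_inverse_Gamma)
  qed
  have c_sum: "summable (\<lambda>n. \<bar>c n\<bar> * r ^ n)" if "0 \<le> r" for r
  proof -
    have "\<bar>c n\<bar> * r ^ n = r ^ n / Gamma (\<beta> * real n + (P + 1)) powr 1" for n
    proof -
      have "0 < \<beta> * real n + (P + 1)" using \<beta> P by (intro add_nonneg_pos) auto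
      then have "0 < Gamma (\<beta> * real n + (P + 1))" by (rule Gamma_real_pos)
      then show ?thesis using c_pos[of n] by (simp add: c_def rGamma_inverse_Gamma divide_inverse mult.commute)
    qed
    then show ?thesis using summable_F_norm[OF \<beta> P(2) zero_less_one that] by simp
  qed
  have E: "(\<Sum>n. of_real (c n) * z ^ n) = F \<beta> (P + 1) 1 z" for z :: complex
    using sums_unique[OF mittag_leffler_sums[OF \<beta> P(2), of z]] by (simp add: c_def mult.commute)
  show ?thesis
  proof (rule that[of "max (\<rho>0 - \<beta> * ln \<alpha>) (\<beta> * ln (max 1 (y0 / cc)) - \<beta> * ln \<alpha>)"])
    fix w :: complex
    assume w: "max (\<rho>0 - \<beta> * ln \<alpha>) (\<beta> * ln (max 1 (y0 / cc)) - \<beta> * ln \<alpha>) \<le> Re w" "\<bar>Im w\<bar> \<le> \<Theta>"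
    define W where "W = w + of_real (\<beta> * ln \<alpha>)"
  let ?T = "leading_term a (\<nu> + 1/2) \<alpha> w"
  let ?S = "(\<Sum>n. of_real (c n * exp (?l n)) * exp W ^ n)"
    define v where "v = W / of_real \<beta>"
    define y where "y = Re (exp v)"
    define T where "T = pole_term \<beta> (P + 1) v"
    have W: "\<bar>Im W\<bar> \<le> \<Theta>" "\<rho>0 \<le> Re W" "\<beta> * ln (max 1 (y0 / cc)) \<le> Re W" using w by (auto simp: W_def)
    note cs = cos_ge_in_sector[OF \<beta> \<Theta>(1) \<Theta>' W(1), folded cc_def v_def]
    have ey: "exp (Re v) * cc \<le> y" unfolding y_def Re_exp using cs by (intro mult_left_mono) auto
    have "y0 \<le> y"
    proof -
      have "ln (max 1 (y0 / cc)) \<le> Re v" using W(3) \<beta> by (simp add: v_def Re_divide_of_real field_simps)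
      then have "exp (ln (max 1 (y0 / cc))) \<le> exp (Re v)" by (simp only: exp_le_cancel_iff)
      moreover have "exp (ln (max 1 (y0 / cc))) = max 1 (y0 / cc)" by (rule exp_ln) simp
      ultimately have "max 1 (y0 / cc) \<le> exp (Re v)" by simp
      then have "y0 / cc \<le> exp (Re v)" by simp
      then have "y0 \<le> exp (Re v) * cc" using cc by (simp add: field_simps)
      with ey show ?thesis by simp
    qed
    have y: "0 \<le> y" using ey cc by (meson less_imp_le mult_pos_pos exp_gt_zero order.trans)
    have "norm (?S - (\<Sum>n. of_real (c n) * exp W ^ n))
      \<le> A * K * exp (K / \<nu>) * (exp 1 / N * majorant P y + majorant P (exp (- (1 / \<alpha>) / N) * y) / \<nu>)"
    proof (rule exp_multiplier_perturbation[OF a _ \<nu>0 continuous_on_ratio_density[OF \<alpha>] _ c_sum _ majorant_nonneg A(1) y _ N])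
      show "0 < 1 / \<alpha>" using \<alpha> by simp
      show "\<bar>ratio_density \<alpha> t\<bar> \<le> K" if "0 < t" for t unfolding K_def by (rule ratio_density_bound[OF \<alpha> that])
      show "majorant P x \<le> majorant P x'" if "0 \<le> x" "x \<le> x'" for x x' by (rule majorant_mono[OF P(1) that])
      fix t :: real assume t: "0 \<le> t"
      have "exp W * of_real (exp (- a * t)) = exp (W - of_real (a * t))"
      proof -
        have "W - of_real (a * t) = W + of_real (- a * t)" by simp
        then show ?thesis by (simp only: exp_add exp_of_real)
      qed
      moreover have "Re (exp ((W - of_real (a * t)) / of_real \<beta>)) = exp (- (1 / \<alpha>) * t) * y"
      proof -
        have "(W - of_real (a * t)) / of_real \<beta> = v + of_real (- (1 / \<alpha>) * t)"
          using a \<alpha> by (simp add: v_def \<beta>_def diff_divide_distrib)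
        then have "exp ((W - of_real (a * t)) / of_real \<beta>) = of_real (exp (- (1 / \<alpha>) * t)) * exp v"
          by (simp only: exp_add exp_of_real mult.commute)
        then show ?thesis by (simp add: y_def)
      qed
      ultimately show "norm (\<Sum>n. of_real (c n) * (exp W * of_real (exp (- a * t))) ^ n) \<le> A * majorant P (exp (- (1 / \<alpha>) * t) * y)"
        unfolding E using A(2)[of "W - of_real (a * t)"] W(1) by simp
    qed
    also have "\<dots> = (D * (exp 1 / N)) * majorant P y + D / \<nu> * (majorant P (q * y) / majorant P y) * majorant P y"
      using majorant_ge_1[OF P(1) y] by (simp add: D_def q_def algebra_simps)
    also have "\<dots> \<le> e / (4 * B) * majorant P y + e / (4 * B) * majorant P y"
      using DN y0[OF \<open>y0 \<le> y\<close>] by (intro add_mono mult_right_mono majorant_nonneg) auto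
    also have "\<dots> = e / (2 * B) * majorant P y" using B by (simp add: field_simps)
    also have "\<dots> \<le> e / (2 * B) * (B * norm T)"
      unfolding B_def T_def y_def using e \<beta> cs cc P
      by (intro mult_left_mono majorant_le_pole_term) auto
    also have "\<dots> = e / 2 * norm T" using B by simp
    finally have 1: "norm (?S - F \<beta> (P + 1) 1 (exp W)) \<le> e / 2 * norm T"
      unfolding E .
    have 2: "norm (F \<beta> (P + 1) 1 (exp W) - T) \<le> e / 2 * norm T"
      unfolding T_def v_def by (rule \<rho>0[OF W(2,1)])
    have FW: "F a (\<nu> + 1/2) \<alpha> (exp w) = of_real C0 * ?S"
    proof -
      have "exp w ^ n / of_real (Gamma (a * real n + (\<nu> + 1/2)) powr \<alpha>)
          = of_real C0 * (of_real (c n * exp (?l n)) * exp W ^ n)" for n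
      proof -
        have "exp w ^ n / of_real (Gamma (a * real n + (\<nu> + 1/2)) powr \<alpha>) = exp w ^ n * of_real (1 / Gamma (a * real n + (\<nu> + 1/2)) powr \<alpha>)"
          by simp
        also have "1 / Gamma (a * real n + (\<nu> + 1/2)) powr \<alpha> = C0 * (exp (\<beta> * ln \<alpha>) ^ n * (c n * exp (?l n)))"
          unfolding inverse_Gamma_powr_eq[OF a \<alpha> \<nu>0] C0_def c_def \<beta>_def P_def by (simp add: add_ac)
        also have "exp w ^ n * of_real (C0 * (exp (\<beta> * ln \<alpha>) ^ n * (c n * exp (?l n))))
            = of_real C0 * (of_real (c n * exp (?l n)) * (exp w * of_real (exp (\<beta> * ln \<alpha>))) ^ n)"
          by (simp add: power_mult_distrib mult_ac)
        also have "exp w * of_real (exp (\<beta> * ln \<alpha>)) = exp W"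
          unfolding W_def exp_add exp_of_real ..
        finally show ?thesis .
      qed
      moreover have "summable (\<lambda>n. of_real (c n * exp (?l n)) * exp W ^ n)"
      proof (rule summable_bounded_multiplier[where M = "exp (K / \<nu>)"])
        fix n
        have s: "0 < a * real n + \<nu>" using a \<nu>0 by (intro add_nonneg_pos) auto
        have "\<bar>?l n\<bar> \<le> K / (a * real n + \<nu>)"
          by (rule laplace_integrable(2)[OF continuous_on_ratio_density[OF \<alpha>] s])
            (unfold K_def, rule ratio_density_bound[OF \<alpha>])
        also have "\<dots> \<le> K / \<nu>" using K0 \<nu>0 a s by (intro divide_left_mono) auto
        finally show "\<bar>exp (?l n)\<bar> \<le> exp (K / \<nu>)" by simp
      qed (rule c_sum, simp)
      ultimately show ?thesis unfolding F_def by (simp only: suminf_mult)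
    qed
    have leading_term: "?T = of_real C0 * T"
      using leading_term_eq_pole_term[OF a \<alpha>, of \<nu> w] unfolding C0_def T_def v_def W_def \<beta>_def P_def by simp
    have "norm (F a (\<nu> + 1/2) \<alpha> (exp w) - ?T)
       = C0 * norm (?S - T)"
      unfolding FW leading_term right_diff_distrib[symmetric] norm_mult using C0 by simp
    also have "\<dots> \<le> C0 * (e * norm T)"
      using norm_triangle_le[OF add_mono[OF 1 2]] C0 by (intro mult_left_mono) auto
    also have "\<dots> = e * norm (?T)" unfolding leading_term norm_mult using C0 by simp
    finally show "norm (F a (\<nu> + 1/2) \<alpha> (exp w) - ?T) \<le> e * norm (?T)" .
  qed
qed

lemma F_split_initial:
  assumes a: "0 < a" and b: "0 < b" and \<alpha>: "0 < \<alpha>"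
  shows "F a b \<alpha> z = z ^ N * F a (b + a * real N) \<alpha> z + (\<Sum>n<N. z ^ n / of_real (Gamma (a * real n + b) powr \<alpha>))"
proof -
  let ?f = "\<lambda>n. z ^ n / of_real (Gamma (a * real n + b) powr \<alpha>)"
  have b': "0 < b + a * real N" using a b by (intro add_pos_nonneg) auto
  have sm: "summable ?f" using F_sums[OF a b \<alpha>, of z] by (simp add: sums_iff)
  have "F a b \<alpha> z = (\<Sum>n. ?f (n + N)) + (\<Sum>n<N. ?f n)"
    unfolding F_def by (rule suminf_split_initial_segment[OF sm])
  also have "(\<lambda>n. ?f (n + N)) = (\<lambda>n. z ^ N * (z ^ n / of_real (Gamma (a * real n + (b + a * real N)) powr \<alpha>)))"
    by (rule ext) (simp add: power_add algebra_simps)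
  also have "(\<Sum>n. z ^ N * (z ^ n / of_real (Gamma (a * real n + (b + a * real N)) powr \<alpha>))) = z ^ N * F a (b + a * real N) \<alpha> z"
    using F_sums[OF a b' \<alpha>, of z] unfolding F_def by (intro suminf_mult) (simp add: sums_iff)
  finally show ?thesis .
qed

text \<open>
  The asymptotic expression behaves like the tail of the series when \<open>b\<close> is replaced by \<open>b + a * N\<close>: both
  lose a factor \<open>z ^ N\<close>.
\<close>

lemma leading_term_shift:
  assumes a: "0 < a" and \<alpha>: "0 < \<alpha>"
  shows "leading_term a b \<alpha> w = exp w ^ N * leading_term a (b + a * real N) \<alpha> w"
proof -
  let ?p = "\<lambda>b. (\<alpha> - 2 * b * \<alpha> + 1) / (2 * a * \<alpha>)"
  let ?e = "of_real \<alpha> * exp (w / of_real (a * \<alpha>))"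
  have "?p b = real N + ?p (b + a * real N)"
    using a \<alpha> by (simp add: field_simps)
  then have "exp (of_real (?p b) * w + ?e)
     = exp w ^ N * exp (of_real (?p (b + a * real N)) * w + ?e)"
    by (simp only: of_real_add of_real_of_nat_eq distrib_right exp_add exp_of_nat_mult mult.assoc)
  then show ?thesis unfolding leading_term_def by (simp only: mult.left_commute)
qed

lemma norm_leading_term:
  assumes "0 < a" "0 < \<alpha>"
  shows "norm (leading_term a b \<alpha> w) = 1 / (a * sqrt \<alpha>) * (2 * pi) powr ((1 - \<alpha>) / 2)
     * exp ((\<alpha> - 2 * b * \<alpha> + 1) / (2 * a * \<alpha>) * Re w + \<alpha> * (exp (Re w / (a * \<alpha>)) * cos (Im (w / of_real (a * \<alpha>)))))"
  using assms by (simp add: leading_term_def norm_mult norm_exp_eq_Re Re_exp Re_divide_of_real abs_mult abs_divide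
      del: of_real_mult of_real_divide of_real_add of_real_diff)

lemma F_asymptotics_log:
  assumes a: "0 < a" and b: "0 < b" and \<alpha>: "0 < \<alpha>"
    and \<Theta>: "0 \<le> \<Theta>" "\<Theta> < pi" "\<Theta> < a * \<alpha> * pi / 2" and e: "0 < e"
  obtains \<rho> where "\<And>w. \<rho> \<le> Re w \<Longrightarrow> \<bar>Im w\<bar> \<le> \<Theta> \<Longrightarrow>
     norm (F a b \<alpha> (exp w) - leading_term a b \<alpha> w) \<le> e * norm (leading_term a b \<alpha> w)"
proof -
  have \<beta>: "0 < a * \<alpha>" using a \<alpha> by simp
  \<comment> \<open>large enough for \<open>F_asymptotics_large_shift\<close> to apply to \<open>b + a * N\<close>\<close>
  obtain N :: nat where N: "(1 / (2 * \<alpha>) + 1/2) / a < real N" using reals_Archimedean2 by blast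
  define b' where "b' = b + a * real N"
  define \<nu> where "\<nu> = b' - 1/2"
  have "1 / (2 * \<alpha>) + 1/2 < a * real N" using N a by (simp add: field_simps)
  then have "1 / (2 * \<alpha>) < \<nu>" using b unfolding \<nu>_def b'_def by linarith
  then have \<nu>: "1/2 < \<alpha> * \<nu>" using \<alpha> by (simp add: field_simps)
  have b': "\<nu> + 1/2 = b'" by (simp add: \<nu>_def)
  obtain \<rho>1 where \<rho>1: "\<And>w. \<rho>1 \<le> Re w \<Longrightarrow> \<bar>Im w\<bar> \<le> \<Theta> \<Longrightarrow>
     norm (F a b' \<alpha> (exp w) - leading_term a b' \<alpha> w) \<le> (e / 2) * norm (leading_term a b' \<alpha> w)"
    using F_asymptotics_large_shift[OF a \<alpha> \<nu> \<Theta>, of "e / 2", unfolded b'] e by auto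
  define S where "S = (\<Sum>n<N. 1 / Gamma (a * real n + b) powr \<alpha>)"
  let ?G = "\<lambda>n. Gamma (a * real n + b) powr \<alpha>"
  have S: "0 \<le> S" by (auto simp: S_def intro!: sum_nonneg)
  define p where "p = (\<alpha> - 2 * b * \<alpha> + 1) / (2 * a * \<alpha>)"
  define C where "C = 1 / (a * sqrt \<alpha>) * (2 * pi) powr ((1 - \<alpha>) / 2)"
  have C: "0 < C" using a \<alpha> by (simp add: C_def)
  define cc where "cc = cos (\<Theta> / (a * \<alpha>))"
  have cc: "0 < cc" unfolding cc_def using cos_ge_in_sector(1)[OF \<beta> \<Theta>(1,3), of 0] \<Theta>(1) by simp
  have "((\<lambda>r. S * exp (real N * r) / exp (p * r + \<alpha> * (exp (r / (a * \<alpha>)) * cc))) \<longlongrightarrow> 0) at_top"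
  proof -
    define k d \<kappa> where "k = 1 / (a * \<alpha>)" and "d = real N - p" and "\<kappa> = \<alpha> * cc"
    have "0 < k" "0 < \<kappa>" using \<beta> \<alpha> cc by (auto simp: k_def \<kappa>_def)
    then have "((\<lambda>r. exp (d * r - \<kappa> * exp (k * r))) \<longlongrightarrow> 0) at_top" by real_asymp
    from tendsto_mult[OF tendsto_const this, of S]
    have "((\<lambda>r. S * exp (d * r - \<kappa> * exp (k * r))) \<longlongrightarrow> 0) at_top" by simp
    also have "(\<lambda>r. S * exp (d * r - \<kappa> * exp (k * r)))
        = (\<lambda>r. S * exp (real N * r) / exp (p * r + \<alpha> * (exp (r / (a * \<alpha>)) * cc)))"
      by (rule ext) (simp add: k_def d_def \<kappa>_def exp_diff exp_add left_diff_distrib right_diff_distrib mult_ac)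
    finally show ?thesis .
  qed
  then have "\<forall>\<^sub>F r in at_top. S * exp (real N * r) / exp (p * r + \<alpha> * (exp (r / (a * \<alpha>)) * cc)) < e / 2 * C"
    by (rule order_tendstoD) (use e C in simp)
  then obtain r0 where r0: "\<And>r. r0 \<le> r \<Longrightarrow> S * exp (real N * r) / exp (p * r + \<alpha> * (exp (r / (a * \<alpha>)) * cc)) < e / 2 * C"
    by (auto simp: eventually_at_top_linorder)
  show ?thesis
  proof (rule that[of "max (max \<rho>1 r0) 0"])
    fix w :: complex assume w: "max (max \<rho>1 r0) 0 \<le> Re w" "\<bar>Im w\<bar> \<le> \<Theta>"
    note cs = cos_ge_in_sector(2)[OF \<beta> \<Theta>(1,3) w(2), folded cc_def]
  let ?d = "F a b' \<alpha> (exp w) - leading_term a b' \<alpha> w"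
  let ?u = "\<alpha> * (exp (Re w / (a * \<alpha>)) * cc)"
  let ?x = "\<alpha> * (exp (Re w / (a * \<alpha>)) * cos (Im (w / of_real (a * \<alpha>))))"
    let ?p = "\<Sum>n<N. exp w ^ n / of_real (?G n)"
    have "norm ?p \<le> (\<Sum>n<N. exp (real N * Re w) * (1 / ?G n))"
    proof (rule sum_norm_le)
      fix n assume "n \<in> {..<N}"
      then have "real n * Re w \<le> real N * Re w" using w by (intro mult_right_mono) auto
      then show "norm (exp w ^ n / of_real (?G n)) \<le> exp (real N * Re w) * (1 / ?G n)"
        by (simp add: norm_divide norm_power norm_exp_eq_Re exp_of_nat_mult[symmetric] divide_right_mono)
    qed
    also have "\<dots> = S * exp (real N * Re w)" by (simp add: S_def sum_distrib_left mult.commute)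
    also have "\<dots> \<le> e / 2 * C * exp (p * Re w + ?u)"
      using r0[of "Re w"] w(1) by (simp add: divide_less_eq less_imp_le)
    also have "\<dots> \<le> e / 2 * (C * exp (p * Re w + ?x))"
    proof -
      have "?u \<le> ?x"
        using \<alpha> cs by (intro mult_left_mono) auto
      then have "exp (p * Re w + ?u)
          \<le> exp (p * Re w + ?x)"
        by (simp only: exp_le_cancel_iff add_left_mono)
      then show ?thesis unfolding mult.assoc using e C by (intro mult_left_mono) auto
    qed
    also have "\<dots> = e / 2 * norm (leading_term a b \<alpha> w)" unfolding norm_leading_term[OF a \<alpha>] C_def p_def ..
    finally have 1: "norm ?p \<le> e / 2 * norm (leading_term a b \<alpha> w)" .
    have "F a b \<alpha> (exp w) - leading_term a b \<alpha> w = exp w ^ N * (?d) + ?p"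
      unfolding F_split_initial[OF a b \<alpha>, of "exp w" N] leading_term_shift[OF a \<alpha>, of b w N] b'_def
      by (simp add: algebra_simps)
    also have "norm \<dots> \<le> norm (exp w ^ N * (?d)) + norm ?p"
      by (rule norm_triangle_ineq)
    also have "norm (exp w ^ N * (?d)) \<le> norm (exp w ^ N) * (e / 2 * norm (leading_term a b' \<alpha> w))"
      unfolding norm_mult[of "exp w ^ N"] by (intro mult_left_mono \<rho>1) (use w in auto)
    also have "\<dots> = e / 2 * norm (leading_term a b \<alpha> w)"
      unfolding leading_term_shift[OF a \<alpha>, of b w N] b'_def norm_mult by simp
    finally show "norm (F a b \<alpha> (exp w) - leading_term a b \<alpha> w) \<le> e * norm (leading_term a b \<alpha> w)" using 1 by simp
  qed
qed

text \<open>
  A negative bound makes the sector empty and the filter trivial. Otherwise the bound is less than both \<open>\<pi>\<close> and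
  \<open>a\<alpha>\<pi>/2\<close>, and \<open>F_asymptotics_log\<close> applies to \<open>w = Ln z\<close>.
\<close>

theorem theorem1:
  fixes \<alpha> a b \<epsilon> :: real
  assumes "\<alpha> > 0" and "a > 0" and "b > 0" and "\<epsilon> > 0"
  shows "F a b \<alpha> \<sim>[at_infinity_in (sector (sector_bound a \<alpha> \<epsilon>))]
    (\<lambda>z. of_real (1 / (a * sqrt \<alpha>) * (2 * pi) powr ((1 - \<alpha>) / 2))
          * z powr of_real ((\<alpha> - 2 * b * \<alpha> + 1) / (2 * a * \<alpha>))
          * exp (of_real \<alpha> * z powr of_real (1 / (a * \<alpha>))))"
    (is "_ \<sim>[_] ?g")
proof (rule asymp_equivI', rule tendstoI)
  fix e :: real assume e: "0 < e"
  define \<Theta> where "\<Theta> = sector_bound a \<alpha> \<epsilon>"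
  let ?l = "leading_term a b \<alpha>"
  have g: "?g (exp w) = ?l w" if "\<bar>Im w\<bar> < pi" for w
  proof -
    have "Ln (exp w) = w" using that by (intro Ln_exp) auto
    then show ?thesis by (simp add: leading_term_def powr_def exp_add mult.assoc)
  qed
  show "\<forall>\<^sub>F z in at_infinity_in (sector (sector_bound a \<alpha> \<epsilon>)). dist (F a b \<alpha> z / ?g z) 1 < e"
  proof (cases "0 \<le> \<Theta>")
    case False
    then have "sector (sector_bound a \<alpha> \<epsilon>) = {}" by (auto simp: sector_def \<Theta>_def)
    then show ?thesis by (simp add: at_infinity_in_def)
  next
    case True
    have \<beta>: "0 < a * \<alpha>" using assms by simp
    have "\<Theta> < pi \<and> \<Theta> < a * \<alpha> * pi / 2"
    proof -
      consider "a * \<alpha> < 2" | "2 \<le> a * \<alpha>" "a * \<alpha> < 4" | "4 \<le> a * \<alpha>" by linarith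
      then show ?thesis
      proof cases
        case 1
        then have "a * \<alpha> * pi < 2 * pi" by (intro mult_strict_right_mono) auto
        moreover have "\<Theta> = a * \<alpha> * pi / 2 - \<epsilon>" using 1 by (simp add: \<Theta>_def sector_bound_def)
        ultimately show ?thesis using assms(4) by linarith
      next
        case 2
        then have "2 * pi \<le> a * \<alpha> * pi" by (intro mult_right_mono) auto
        moreover have "\<Theta> = 2 * pi - a * \<alpha> * pi / 2 - \<epsilon>"
          using 2 by (simp add: \<Theta>_def sector_bound_def algebra_simps)
        ultimately show ?thesis using assms(4) by linarith
      next
        case 3
        then have "\<Theta> = 0" by (simp add: \<Theta>_def sector_bound_def)
        then show ?thesis using \<beta> by simp
      qed
    qed
    then have \<Theta>: "\<Theta> < pi" "\<Theta> < a * \<alpha> * pi / 2" by auto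
    obtain \<rho> where \<rho>: "\<And>w. \<rho> \<le> Re w \<Longrightarrow> \<bar>Im w\<bar> \<le> \<Theta> \<Longrightarrow>
       norm (F a b \<alpha> (exp w) - ?l w) \<le> (e / 2) * norm (?l w)"
      using F_asymptotics_log[OF assms(2,3,1) True \<Theta>, of "e / 2"] e by auto
    have "dist (F a b \<alpha> z / ?g z) 1 < e" if z: "exp \<rho> \<le> norm z" "z \<in> sector \<Theta>" for z
    proof -
      have z0: "z \<noteq> 0" using z(1) by auto
      define w where "w = Ln z"
      have zw: "z = exp w" using z0 by (simp add: w_def)
      have im: "\<bar>Im w\<bar> \<le> \<Theta>" using z(2) z0 by (simp add: w_def sector_def Arg_eq_Im_Ln)
      have "\<rho> \<le> Re w"
      proof -
        have "exp \<rho> \<le> exp (Re w)" using z(1) by (simp add: zw norm_exp_eq_Re)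
        then show ?thesis by simp
      qed
      note est = \<rho>[OF this im]
      have gz: "?g z = ?l w" unfolding zw by (rule g) (use im \<Theta> in linarith)
      have l0: "?l w \<noteq> 0" using leading_term_nonzero[OF assms(2,1)] .
      have "F a b \<alpha> z / ?l w - 1 = (F a b \<alpha> (exp w) - ?l w) / ?l w"
        using l0 by (simp add: zw diff_divide_distrib)
      then have "dist (F a b \<alpha> z / ?l w) 1 = norm (F a b \<alpha> (exp w) - ?l w) / norm (?l w)"
        by (simp add: dist_norm norm_divide)
      also have "\<dots> \<le> e / 2" using est l0 by (simp add: divide_le_eq)
      also have "\<dots> < e" using e by simp
      finally show ?thesis unfolding gz .
    qed
    then have "\<forall>\<^sub>F z in at_infinity. z \<in> sector \<Theta> \<longrightarrow> dist (F a b \<alpha> z / ?g z) 1 < e"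
      unfolding eventually_at_infinity by blast
    then show ?thesis unfolding at_infinity_in_def eventually_inf_principal \<Theta>_def .
  qed
qed

end
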